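(* Let $r\ge1$ be an integer and let $m$ be an $L^{2r}(\mathbb{R})$ multiplier supported in $(-1/2,1/2]$. Let $Z$ be a finite set of integers contained in $(1,q(Z)]$, and suppose $0<\varepsilon<q(Z)^{-2}$. Then for all $f\in\ell^{2r}(\mathbb{Z})$, $$\Big\|\Big(\sum_{a/q\in\mathcal{R}(Z)}|f_{a/q}|^2\Big)^{1/2}\Big\|_{\ell^{2r}(\mathbb{Z})}\le C_{2r}\|f\|_{\ell^{2r}(\mathbb{Z})},$$ for a constant $C_{2r}$ depending (besides $r$) only on the $L^{2r}(\mathbb{R})$ multiplier norm of $m$.
   Context: For $f\in\ell^1(\mathbb{Z})$ put $\widehat f(\xi)=\sum_{n\in\mathbb{Z}}f(n)e^{-2\pi i n\xi}$, a 1-periodic function. Let $\mathscr{F}$ be the Euclidean Fourier transform on $\mathbb{R}$. A bounded measurable function $m:\mathbb{R}\to\mathbb{C}$ is an $L^p(\mathbb{R})$ multiplier of norm $B_p$ if $Tf=\mathscr{F}^{-1}(m\cdot\mathscr{F}f)$ satisfies $\|Tf\|_{L^p}\le B_p\|f\|_{L^p}$ for all $f\in L^p(\mathbb{R})$. For a finite set $Z$ of positive integers, $\mathcal{R}(Z)=\{a/q: q\in Z,\ 1\le a\le q,\ \gcd(a,q)=1\}$. $q(Z)$ denotes a number with $Z\subset(1,q(Z)]$. Given $m$ and $\varepsilon$, the function $f_{a/q}$ on $\mathbb{Z}$ is defined for $f\in\ell^1(\mathbb{Z})$ by $$\widehat{f_{a/q}}(\xi)=\sum_{\ell\in\mathbb{Z}}m\big(\varepsilon^{-1}(\xi-\ell-a/q)\big)\,\widehat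 f(\xi);$$ for $f\in\ell^{2r}(\mathbb{Z})$ the operators $f\mapsto f_{a/q}$ are understood as the bounded extensions by density. *)

theory Defs
  imports "HOL-Analysis.Analysis"
begin

definition Lp_space :: "'a measure \<Rightarrow> real \<Rightarrow> ('a \<Rightarrow> 'b::{banach, second_countable_topology}) set"
  where "Lp_space M p = {f \<in> borel_measurable M. integrable M (\<lambda>x. norm (f x) powr p)}"

text \<open>Only meaningful on \<^const>\<open>Lp_space\<close>: elsewhere the Bochner integral is 0 by convention,
  so every norm inequality below is accompanied by membership.\<close>

definition Lp_norm :: "'a measure \<Rightarrow> real \<Rightarrow> ('a \<Rightarrow> 'b::{banach, second_countable_topology}) \<Rightarrow> real"
  where "Lp_norm M p f = (LINT x|M. norm (f x) powr p) powr (1 / p)"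

abbreviation ell :: "real \<Rightarrow> (int \<Rightarrow> 'b::{banach, second_countable_topology}) set"
  where "ell p \<equiv> Lp_space (count_space UNIV) p"

abbreviation ell_norm :: "real \<Rightarrow> (int \<Rightarrow> 'b::{banach, second_countable_topology}) \<Rightarrow> real"
  where "ell_norm p \<equiv> Lp_norm (count_space UNIV) p"

definition Lp_tendsto ::
    "'a measure \<Rightarrow> real \<Rightarrow> (nat \<Rightarrow> 'a \<Rightarrow> 'b::{banach, second_countable_topology}) \<Rightarrow> ('a \<Rightarrow> 'b) \<Rightarrow> bool"
  where "Lp_tendsto M p u f \<longleftrightarrow>
    f \<in> Lp_space M p \<and> (\<forall>k. u k \<in> Lp_space M p) \<and>
    (\<lambda>k. Lp_norm M p (\<lambda>x. u k x - f x)) \<longlonglongrightarrow> 0"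

text \<open>The value \<open>g\<close> at \<open>f\<close> of the extension by density to \<open>L\<^sup>p\<close> of an operator \<open>T\<close>
  that is given on \<open>D\<close>; \<open>g\<close> is determined up to null sets as soon as \<open>f\<close> is an
  \<open>L\<^sup>p\<close> limit of elements of \<open>D\<close>.\<close>

definition density_ext ::
    "'a measure \<Rightarrow> real \<Rightarrow> ('a \<Rightarrow> 'b::{banach, second_countable_topology}) set \<Rightarrow>
     (('a \<Rightarrow> 'b) \<Rightarrow> ('a \<Rightarrow> 'b)) \<Rightarrow> ('a \<Rightarrow> 'b) \<Rightarrow> ('a \<Rightarrow> 'b) \<Rightarrow> bool"
  where "density_ext M p D T f g \<longleftrightarrow>
    g \<in> Lp_space M p \<and>
    (\<forall>u. (\<forall>k. u k \<in> D) \<and> Lp_tendsto M p u f \<longrightarrow> Lp_tendsto M p (\<lambda>k. T (u k)) g)"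

definition fourier_R :: "(real \<Rightarrow> complex) \<Rightarrow> real \<Rightarrow> complex"
  where "fourier_R f \<xi> = (LINT x|lebesgue. f x * cis (- 2 * pi * x * \<xi>))"

definition inv_fourier_R :: "(real \<Rightarrow> complex) \<Rightarrow> real \<Rightarrow> complex"
  where "inv_fourier_R h x = (LINT \<xi>|lebesgue. h \<xi> * cis (2 * pi * x * \<xi>))"

definition multiplier_op :: "(real \<Rightarrow> complex) \<Rightarrow> (real \<Rightarrow> complex) \<Rightarrow> real \<Rightarrow> complex"
  where "multiplier_op m f = inv_fourier_R (\<lambda>\<xi>. m \<xi> * fourier_R f \<xi>)"

text \<open>The functions in \<open>L\<^sup>p\<close> for which both integrals in \<^const>\<open>multiplier_op\<close> converge
  absolutely. They contain the Schwartz functions, hence are dense in \<open>L\<^sup>p\<close>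
  for \<open>1 \<le> p < \<infinity>\<close>.\<close>

definition multiplier_dom :: "real \<Rightarrow> (real \<Rightarrow> complex) \<Rightarrow> (real \<Rightarrow> complex) set"
  where "multiplier_dom p m =
    {f \<in> Lp_space lebesgue p. integrable lebesgue f \<and>
       integrable lebesgue (\<lambda>\<xi>. m \<xi> * fourier_R f \<xi>)}"

text \<open>\<open>B\<close> is a bound for the norm of the multiplier. For a general \<open>f \<in> L\<^sup>p\<close> the Fourier
  transform is not a function, so the operator is the extension by density.\<close>

definition Lp_multiplier :: "real \<Rightarrow> (real \<Rightarrow> complex) \<Rightarrow> real \<Rightarrow> bool"
  where "Lp_multiplier p m B \<longleftrightarrow>
    bounded (range m) \<and> m \<in> borel_measurable lebesgue \<and>
    (\<forall>f \<in> Lp_space lebesgue p. \<exists>g.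
       density_ext lebesgue p (multiplier_dom p m) (multiplier_op m) f g \<and>
       Lp_norm lebesgue p g \<le> B * Lp_norm lebesgue p f)"

definition fourier_Z :: "(int \<Rightarrow> complex) \<Rightarrow> real \<Rightarrow> complex"
  where "fourier_Z f \<xi> = (\<Sum>\<^sub>\<infinity>n. f n * cis (- 2 * pi * of_int n * \<xi>))"

definition inv_fourier_Z :: "(real \<Rightarrow> complex) \<Rightarrow> int \<Rightarrow> complex"
  where "inv_fourier_Z h n = (LINT \<xi>:{0..1}|lebesgue. h \<xi> * cis (2 * pi * of_int n * \<xi>))"

lemma inv_fourier_Z_fourier_Z:
  assumes "f \<in> ell 1"
  shows "inv_fourier_Z (fourier_Z f) n = f n"
proof -
  have i: "integrable (count_space UNIV) (\<lambda>k. norm (f k))"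
    using assms by (simp add: Lp_space_def)
  define e where "e = (\<lambda>k \<xi>. cis (2 * pi * of_int (n - k) * \<xi>))"
  define K where "K = (\<lambda>\<xi> k. indicator {0..1} \<xi> *\<^sub>R (f k * e k \<xi>))"
  interpret C: sigma_finite_measure "count_space (UNIV :: int set)"
    by (rule sigma_finite_measure_count_space)
  interpret P: pair_sigma_finite "lborel :: real measure" "count_space (UNIV :: int set)" ..
  have ne: "norm (e k \<xi>) = 1" for k \<xi> by (simp add: e_def)
  have ce: "continuous_on A (e k)" for k A
    unfolding e_def cis_conv_exp by (intro continuous_intros)
  have me: "e k \<in> borel_measurable borel" for k
    by (rule borel_measurable_continuous_onI) (rule ce)
  have Km: "(\<lambda>\<xi>. K \<xi> k) \<in> borel_measurable lborel" for k
    unfolding K_def using me[of k] by measurable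
  have mK: "case_prod K \<in> borel_measurable (lborel \<Otimes>\<^sub>M count_space UNIV)"
    by (subst measurable_pair_swap_iff)
       (auto simp: case_prod_unfold intro!: measurable_pair_measure_countable1 Km[simplified])
  have iKx: "integrable (count_space UNIV) (K \<xi>)" for \<xi>
    by (rule Bochner_Integration.integrable_bound[OF i])
       (auto simp: K_def norm_mult ne indicator_def)
  have iK: "integrable (lborel \<Otimes>\<^sub>M count_space UNIV) (case_prod K)"
  proof (rule P.Fubini_integrable)
    have "(\<lambda>\<xi>. LINT k|count_space UNIV. norm (K \<xi> k)) =
        (\<lambda>\<xi>. indicator {0..1} \<xi> *\<^sub>R (LINT k|count_space UNIV. norm (f k)))"
      by (auto simp: K_def norm_mult ne fun_eq_iff)
    then show "integrable lborel (\<lambda>\<xi>. LINT k|count_space UNIV. norm (case (\<xi>, k) of (a, b) \<Rightarrow> K a b))"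
      by simp
  qed (use mK iKx in auto)
  have z: "indicator {0..1} \<xi> *\<^sub>R (fourier_Z f \<xi> * cis (2 * pi * of_int n * \<xi>))
      = (LINT k|count_space UNIV. K \<xi> k)" for \<xi>
  proof -
    have "integrable (count_space UNIV) (\<lambda>k. f k * cis (- 2 * pi * of_int k * \<xi>))"
      by (rule Bochner_Integration.integrable_bound[OF i]) (auto simp: norm_mult)
    then have "fourier_Z f \<xi> = (LINT k|count_space UNIV. f k * cis (- 2 * pi * of_int k * \<xi>))"
      unfolding fourier_Z_def
      by (subst infsetsum_infsum[symmetric])
         (auto simp: infsetsum_def abs_summable_on_def abs_summable_equivalent[symmetric])
    then have "fourier_Z f \<xi> * cis (2 * pi * of_int n * \<xi>) =
        (LINT k|count_space UNIV. f k * cis (- 2 * pi * of_int k * \<xi>) * cis (2 * pi * of_int n * \<xi>))"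
      by simp
    also have "\<dots> = (LINT k|count_space UNIV. f k * e k \<xi>)"
      by (simp add: e_def mult.assoc cis_mult) (simp add: algebra_simps)
    finally show ?thesis by (simp add: K_def)
  qed
  have ie: "(LINT \<xi>|lborel. K \<xi> k) = (if k = n then f n else 0)" for k
  proof (cases "k = n")
    case True
    then show ?thesis by (simp add: K_def e_def)
  next
    case False
    define c where "c = 2 * pi * \<i> * of_int (n - k)"
    have c: "c \<noteq> 0" using False by (simp add: c_def)
    have e: "e k \<xi> = exp (c * of_real \<xi>)" for \<xi>
      by (simp add: e_def c_def cis_conv_exp mult_ac)
    have "exp c = 1" using exp_integer_2pi[of "of_int (n - k)"] by (simp add: c_def mult_ac)
    moreover have "(LINT \<xi>|lborel. indicator {0..1} \<xi> *\<^sub>R e k \<xi>) = exp (c * of_real 1) / c - exp (c * of_real 0) / c"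
    proof (rule integral_FTC_Icc)
      fix x :: real
      have "((\<lambda>z. exp (c * z) / c) has_field_derivative exp (c * of_real x)) (at (of_real x))"
        using c by (auto intro!: derivative_eq_intros)
      then show "((\<lambda>x. exp (c * of_real x) / c) has_vector_derivative e k x) (at x within {0..1})"
        unfolding e by (rule has_vector_derivative_real_field)
    qed (auto simp: ce)
    ultimately have "(LINT \<xi>|lborel. indicator {0..1} \<xi> *\<^sub>R e k \<xi>) = 0" by simp
    moreover have "(LINT \<xi>|lborel. K \<xi> k) = f k * (LINT \<xi>|lborel. indicator {0..1} \<xi> *\<^sub>R e k \<xi>)"
      unfolding K_def by (subst integral_mult_right_zero[symmetric]) simp
    ultimately show ?thesis using False by simp
  qed
  have "inv_fourier_Z (fourier_Z f) n = (LINT \<xi>|lebesgue. LINT k|count_space UNIV. K \<xi> k)"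
    by (simp only: inv_fourier_Z_def set_lebesgue_integral_def z)
  also have "\<dots> = (LINT \<xi>|lborel. LINT k|count_space UNIV. K \<xi> k)"
    by (rule integral_completion) (rule C.borel_measurable_lebesgue_integral[OF mK])
  also have "\<dots> = (LINT k|count_space UNIV. LINT \<xi>|lborel. K \<xi> k)"
    using P.Fubini_integral[OF iK] by simp
  also have "\<dots> = (LINT k|count_space UNIV. (if k = n then f n else 0))"
    by (simp only: ie)
  also have "\<dots> = f n"
    by (subst lebesgue_integral_count_space_finite_support) auto
  finally show ?thesis .
qed

text \<open>\<open>f\<^sub>\<theta>\<close> for \<open>f \<in> \<ell>\<^sup>1\<close>. The multiplier is bounded and 1-periodic, so
  prescribing the Fourier series of \<open>f\<^sub>\<theta>\<close> means prescribing its Fourier coefficients;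
  \<open>f\<^sub>\<theta>\<close> lies in \<open>\<ell>\<^sup>2\<close> but in general not in \<open>\<ell>\<^sup>1\<close>.\<close>

definition piece_ell1 ::
    "(real \<Rightarrow> complex) \<Rightarrow> real \<Rightarrow> real \<Rightarrow> (int \<Rightarrow> complex) \<Rightarrow> int \<Rightarrow> complex"
  where "piece_ell1 m \<epsilon> \<theta> f =
    inv_fourier_Z (\<lambda>\<xi>. \<Sum>\<^sub>\<infinity>l::int. m ((\<xi> - of_int l - \<theta>) / \<epsilon>) * fourier_Z f \<xi>)"

definition piece ::
    "real \<Rightarrow> (real \<Rightarrow> complex) \<Rightarrow> real \<Rightarrow> real \<Rightarrow> (int \<Rightarrow> complex) \<Rightarrow> int \<Rightarrow> complex"
  where "piece p m \<epsilon> \<theta> f =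
    (THE g. density_ext (count_space UNIV) p (ell 1) (piece_ell1 m \<epsilon> \<theta>) f g)"

definition reduced_fractions :: "int set \<Rightarrow> real set"
  where "reduced_fractions Z =
    {of_int a / of_int q | a q. q \<in> Z \<and> 1 \<le> a \<and> a \<le> q \<and> coprime a q}"

end

theory Submission
  imports Defs "HOL-Probability.Sinc_Integral"
begin

text \<open>Write \<open>e(x) = cis (2 \<pi> x)\<close> and let \<open>K\<close> be the inverse Fourier transform of \<open>m\<close>. Choose an integrable
  kernel \<open>\<phi>\<close> with \<open>\<bar>\<phi> x\<bar> \<le> A / (1 + x\<^sup>2)\<close> whose Fourier transform is 1 on \<open>[-1/2, 1/2]\<close>. For a finitely supported
  \<open>f\<close> put \<open>F\<^sub>\<theta> x = \<Sum>k. f k e(- k \<theta>) \<phi> (x - \<epsilon> k)\<close>. The multiplier replaces \<open>\<phi>\<close> by \<open>K\<close>, and the result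
  \<open>G\<^sub>\<theta>\<close> satisfies \<open>\<bar>f\<^sub>\<theta> n\<bar> = \<epsilon> \<bar>G\<^sub>\<theta> (\<epsilon> n)\<bar>\<close>, so that no separate transference from \<open>\<real>\<close> to \<open>\<int>\<close> is
  needed. Random signs linearise the square function. For each choice of signs, \<open>G = G * \<phi>\<close> bounds the
  \<open>\<ell>\<^sup>2\<^sup>r\<close> norm of the samples by the \<open>L\<^sup>2\<^sup>r\<close> norm of \<open>G\<close>, to which the multiplier hypothesis applies.
  Averaging back with Khintchine's inequality leaves \<open>\<Sum>\<theta>. \<bar>F\<^sub>\<theta> x\<bar>\<^sup>2\<close>. The
  fractions are more than \<open>\<epsilon>\<close> apart, so the large sieve bounds this pointwise by
  \<open>C / \<epsilon> * (\<Sum>k. \<bar>f k\<bar>\<^sup>2 / (1 + (x - \<epsilon> k)\<^sup>2))\<close>, and convexity finishes the proof.\<close>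

section \<open>Weighted power means and the weight 1 / (1 + y^2)\<close>

text \<open>The constant may depend neither on \<epsilon> nor on the number of fractions, so all
  powers of \<epsilon> have to cancel. Sampling costs \<open>\<epsilon>^(-1)\<close>, the large
  sieve raised to the power r costs \<open>\<epsilon>^(-r)\<close>, and convexity with weights of
  total mass of order \<open>1 / \<epsilon>\<close> costs \<open>\<epsilon>^(-(r-1))\<close>. The
  factor \<open>\<epsilon>^(2r)\<close> that comes from \<open>\<epsilon> * G\<close> pays exactly
  for this. The large sieve fits because near x only the k within order
  \<open>1 / \<epsilon>\<close> of \<open>x / \<epsilon>\<close> matter, and on a block of that
  length exponentials with \<epsilon>-separated frequencies are almost orthogonal. The decay of the
  kernel is chosen to match: its square times the quadratic weight produced by the sieve is still an
  integrable weight. The hypothesis controls the operator on scalar functions only. Signs suffice to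
  reach the square function, since the operator is linear and each signed sum of the
  \<open>F\<^sub>\<theta>\<close> is again a sum of translates of the kernel. Estimates on the
  integers are stated for 2r-th powers and for finite sets of points, where pointwise limits can be
  taken term by term; the root is extracted only at the very end.\<close>

lemma integrable_one_over_one_plus_square: "integrable lborel (\<lambda>x::real. 1 / (1 + x\<^sup>2))"
  using integrable_inverse_1_plus_square by (simp add: set_integrable_def inverse_eq_divide)

text \<open>The transforms integrate over \<open>lebesgue\<close>, so Fubini is needed for the
  completed measure as well.\<close>

lemma sigma_finite_lebesgue: "sigma_finite_measure (lebesgue :: 'a::euclidean_space measure)"
proof
  obtain A :: "'a set set" where A: "countable A" "A \<subseteq> sets lborel" "\<Union>A = space lborel"
      "\<forall>a\<in>A. emeasure lborel a \<noteq> \<infinity>"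
    using lborel.sigma_finite_countable by blast
  then show "\<exists>A::'a set set. countable A \<and> A \<subseteq> sets lebesgue \<and> \<Union> A = space lebesgue \<and> (\<forall>a\<in>A. emeasure lebesgue a \<noteq> \<infinity>)"
    by (intro exI[of _ A]) auto
qed

text \<open>Convexity of \<open>y ^ Suc n\<close>, in the form of its tangent at \<open>c\<close>.
  In the induction step, passing from the factor \<open>y\<close> to the factor \<open>c\<close> is
  controlled by \<open>(y - c) * (y ^ Suc n - c ^ Suc n) \<ge> 0\<close>.\<close>

lemma power_ge_tangent:
  fixes y c :: real
  assumes "y \<ge> 0" "c \<ge> 0"
  shows "y ^ Suc n \<ge> real (Suc n) * c ^ n * y - real n * c ^ Suc n"
proof (induction n)
  case 0 then show ?case by simp
next
  case (Suc n)
  have "0 \<le> (y - c) * (y ^ Suc n - c ^ Suc n)"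
  proof (cases "y \<ge> c")
    case True then show ?thesis using assms power_mono[of c y "Suc n"] by (intro mult_nonneg_nonneg) auto
  next
    case False then show ?thesis using assms power_mono[of y c "Suc n"] by (intro mult_nonpos_nonpos) auto
  qed
  then have "y * y ^ Suc n \<ge> c * y ^ Suc n + y * c ^ Suc n - c * c ^ Suc n"
    by (simp add: algebra_simps)
  moreover have "c * y ^ Suc n \<ge> c * (real (Suc n) * c ^ n * y - real n * c ^ Suc n)"
    using Suc assms by (intro mult_left_mono)
  ultimately have "y * y ^ Suc n \<ge> c * (real (Suc n) * c ^ n * y - real n * c ^ Suc n) + y * c ^ Suc n - c * c ^ Suc n"
    by linarith
  then show ?case by (simp add: algebra_simps)
qed

text \<open>Jensen's inequality, obtained by integrating the tangent at the weighted mean. The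
  weight is not normalised; its total mass to the power \<open>n\<close> is where powers of
  \<open>1 / \<epsilon>\<close> enter later.\<close>

lemma power_integral_le:
  fixes w y :: "'a \<Rightarrow> real"
  assumes w: "integrable M w" "\<And>x. w x \<ge> 0"
    and y: "\<And>x. y x \<ge> 0" "integrable M (\<lambda>x. y x * w x)" "integrable M (\<lambda>x. y x ^ Suc n * w x)"
  shows "(LINT x|M. y x * w x) ^ Suc n \<le> (LINT x|M. w x) ^ n * (LINT x|M. y x ^ Suc n * w x)"
proof -
  define W I J where "W = (LINT x|M. w x)" and "I = (LINT x|M. y x * w x)" and "J = (LINT x|M. y x ^ Suc n * w x)"
  have pos: "W \<ge> 0" "I \<ge> 0" "J \<ge> 0" unfolding W_def I_def J_def
    by (intro integral_nonneg_AE; use w y in simp)+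
  show ?thesis
  proof (cases "W = 0")
    case True
    then have "AE x in M. w x = 0" using integral_nonneg_eq_0_iff_AE[of M w] w unfolding W_def by auto
    then have "I = (LINT x|M. 0)" unfolding I_def
      using y(2) by (intro integral_cong_AE) auto
    then show ?thesis unfolding I_def[symmetric] J_def[symmetric] W_def[symmetric] using pos by (simp del: power_Suc add: power_0_left)
  next
    case False
    \<comment> \<open>The weighted mean of \<open>y\<close>, at which the tangent is the best
      choice.\<close>
    define c where "c = I / W"
    have c: "c \<ge> 0" "c * W = I" using pos False by (auto simp: c_def)
    have "(LINT x|M. real (Suc n) * c ^ n * (y x * w x) - real n * c ^ Suc n * w x) \<le> J"
      unfolding J_def
    proof (rule integral_mono)
      fix x
      show "real (Suc n) * c ^ n * (y x * w x) - real n * c ^ Suc n * w x \<le> y x ^ Suc n * w x"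
        using mult_right_mono[OF power_ge_tangent[OF y(1)[of x] c(1), of n] w(2)[of x]]
        by (simp add: algebra_simps)
    qed (use w y in auto)
    then have "real (Suc n) * c ^ n * I - real n * c ^ Suc n * W \<le> J"
      using w y by (simp add: I_def W_def)
    moreover have "real n * c ^ Suc n * W = real n * c ^ n * I" using c(2)[symmetric] by simp
    moreover have "real (Suc n) * c ^ n * I = c ^ n * I + real n * c ^ n * I" by (simp add: algebra_simps)
    ultimately have "c ^ n * I \<le> J" by linarith
    then have "W ^ n * (c ^ n * I) \<le> W ^ n * J" using pos by (intro mult_left_mono) auto
    moreover have "W ^ n * (c ^ n * I) = I ^ Suc n" unfolding c(2)[symmetric] power_mult_distrib by simp
    ultimately show ?thesis unfolding I_def J_def W_def by simp
  qed
qed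

lemma power_sum_le:
  fixes w y :: "'a \<Rightarrow> real"
  assumes "finite A" "\<And>x. x \<in> A \<Longrightarrow> w x \<ge> 0" "\<And>x. x \<in> A \<Longrightarrow> y x \<ge> 0"
  shows "(\<Sum>x\<in>A. y x * w x) ^ Suc n \<le> (\<Sum>x\<in>A. w x) ^ n * (\<Sum>x\<in>A. y x ^ Suc n * w x)"
proof -
  have i: "integrable (count_space A) f" for f :: "'a \<Rightarrow> real"
    using assms(1) by (simp add: integrable_count_space)
  \<comment> \<open>Extension by zero, because \<open>power_integral_le\<close> asks for its sign
    conditions at every point.\<close>
  define v z where "v = (\<lambda>x. if x \<in> A then w x else 0)" and "z = (\<lambda>x. if x \<in> A then y x else 0)"
  have "(LINT x|count_space A. z x * v x) ^ Suc n \<le> (LINT x|count_space A. v x) ^ n * (LINT x|count_space A. z x ^ Suc n * v x)"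
    by (rule power_integral_le) (use assms i in \<open>auto simp: v_def z_def\<close>)
  then show ?thesis by (simp add: lebesgue_integral_count_space_finite assms(1) v_def z_def)
qed

text \<open>Its reciprocal is the quadratic polynomial that the large sieve produces, up to
  constants, so one factor \<open>decay\<close> absorbs that polynomial.\<close>

definition decay :: "real \<Rightarrow> real" where "decay y = 1 / (1 + y\<^sup>2)"

lemma decay_pos: "decay y > 0" by (simp add: decay_def add_pos_nonneg)
lemma decay_nonneg[simp]: "decay y \<ge> 0" using decay_pos[of y] by simp
lemma decay_le_1: "decay y \<le> 1" by (simp add: decay_def add_pos_nonneg)
lemma decay_minus: "decay (x - y) = decay (y - x)" by (simp add: decay_def power2_commute)
lemma decay_measurable[measurable]: "decay \<in> borel_measurable borel" unfolding decay_def[abs_def] by measurable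
lemma integrable_decay: "integrable lborel decay"
  using integrable_one_over_one_plus_square by (simp add: decay_def[abs_def])

lemma integrable_decay_affine: "c \<noteq> 0 \<Longrightarrow> integrable lborel (\<lambda>x. decay (t + c * x))"
  by (simp add: lborel_integrable_real_affine_iff integrable_decay)

lemma decay_near:
  assumes "\<bar>x - y\<bar> \<le> 1"
  shows "decay x \<le> 3 * decay y"
proof -
  have "y\<^sup>2 \<le> 2 * x\<^sup>2 + 2"
  proof -
    have "(x - y)\<^sup>2 \<le> 1" using assms by (simp add: abs_square_le_1)
    \<comment> \<open>The parallelogram law for \<open>x\<close> and \<open>x - y\<close>, whose sum
      is \<open>2 * x - y\<close> and whose difference is \<open>y\<close>.\<close>
    moreover have "y\<^sup>2 = 2 * x\<^sup>2 + 2 * (x - y)\<^sup>2 - (2 * x - y)\<^sup>2"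
      by (simp add: power2_eq_square algebra_simps)
    ultimately show ?thesis using zero_le_power2[of "2 * x - y"] by linarith
  qed
  then have "1 + y\<^sup>2 \<le> 3 * (1 + x\<^sup>2)" by (smt (verit) realpow_square_minus_le)
  then show ?thesis by (simp add: decay_def field_simps add_pos_nonneg)
qed

text \<open>A Riemann sum comparison: since \<open>\<epsilon> \<le> 1\<close>, the images of a cell
  \<open>[n, n + 1)\<close> have length at most 1, so \<open>decay_near\<close> replaces each sample
  by an integral over its cell at the cost of the factor 3. The cells are disjoint, and scaling
  gives \<open>1 / \<epsilon>\<close>.\<close>

lemma sum_decay_le:
  fixes N :: "int set"
  assumes "finite N" "0 < \<epsilon>" "\<epsilon> \<le> 1"
  shows "(\<Sum>n\<in>N. decay (x - \<epsilon> * of_int n)) \<le> 3 * (LINT y|lborel. decay y) / \<epsilon>"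
proof -
  have i: "integrable lborel (\<lambda>t. 3 * decay (x - \<epsilon> * t))"
    using integrable_decay_affine[of "-\<epsilon>" x] assms by simp
  have ib: "integrable lborel (\<lambda>t. indicator {real_of_int n..<real_of_int n+1} t * (3 * decay (x - \<epsilon> * t)))" for n :: int
    using integrable_mult_indicator[OF _ i, of "{real_of_int n..<real_of_int n+1}"] by simp
  have "decay (x - \<epsilon> * of_int n) \<le> (LINT t|lborel. indicator {real_of_int n..<real_of_int n+1} t * (3 * decay (x - \<epsilon> * t)))" for n
  proof -
    have "(LINT t|lborel. indicator {real_of_int n..<real_of_int n+1} t * decay (x - \<epsilon> * of_int n)) \<le> (LINT t|lborel. indicator {real_of_int n..<real_of_int n+1} t * (3 * decay (x - \<epsilon> * t)))"
    proof (rule integral_mono)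
      fix t
      have "\<bar>\<epsilon> * t - \<epsilon> * of_int n\<bar> \<le> 1" if "real_of_int n \<le> t" "t < n + 1"
      proof -
        have "\<bar>\<epsilon> * t - \<epsilon> * of_int n\<bar> = \<epsilon> * \<bar>t - of_int n\<bar>" using assms by (simp add: abs_mult flip: right_diff_distrib)
        also have "\<dots> \<le> 1 * 1" using that assms by (intro mult_mono) auto
        finally show ?thesis by simp
      qed
      then have "decay (x - \<epsilon> * of_int n) \<le> 3 * decay (x - \<epsilon> * t)" if "real_of_int n \<le> t" "t < n + 1"
        using that by (intro decay_near) auto
      then show "indicator {real_of_int n..<real_of_int n+1} t * decay (x - \<epsilon> * of_int n) \<le> indicator {real_of_int n..<real_of_int n+1} t * (3 * decay (x - \<epsilon> * t))"
        by (auto simp: indicator_def)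
    qed (use ib in auto)
    then show ?thesis by simp
  qed
  then have "(\<Sum>n\<in>N. decay (x - \<epsilon> * of_int n)) \<le> (\<Sum>n\<in>N. (LINT t|lborel. indicator {real_of_int n..<real_of_int n+1} t * (3 * decay (x - \<epsilon> * t))))"
    by (rule sum_mono)
  also have "\<dots> = (LINT t|lborel. (\<Sum>n\<in>N. indicator {real_of_int n..<real_of_int n+1} t * (3 * decay (x - \<epsilon> * t))))"
    using ib by simp
  also have "\<dots> \<le> (LINT t|lborel. 3 * decay (x - \<epsilon> * t))"
  proof (rule integral_mono)
    fix t
    \<comment> \<open>Only the cell of \<open>\<lfloor>t\<rfloor>\<close> can contain
      \<open>t\<close>.\<close>
    have "(\<Sum>n\<in>N. indicator {real_of_int n..<real_of_int n+1} t * (3 * decay (x - \<epsilon> * t))) = (\<Sum>n\<in>N. if n = \<lfloor>t\<rfloor> then 3 * decay (x - \<epsilon> * t) else 0)"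
      by (rule sum.cong) (auto simp: indicator_def floor_eq_iff, linarith+)
    also have "\<dots> \<le> 3 * decay (x - \<epsilon> * t)" using assms by simp
    finally show "(\<Sum>n\<in>N. indicator {real_of_int n..<real_of_int n+1} t * (3 * decay (x - \<epsilon> * t))) \<le> 3 * decay (x - \<epsilon> * t)" .
  qed (use ib i in auto)
  also have "\<dots> = 3 * (LINT y|lborel. decay y) / \<epsilon>"
    using lborel_integral_real_affine[of "-\<epsilon>" decay x] assms by simp
  finally show ?thesis .
qed

section \<open>A kernel of de la Vallee-Poussin type\<close>

text \<open>The kernel \<open>(cos (\<pi> x) - cos (2 \<pi> x)) / x\<^sup>2\<close> is a multiple of a difference of two Fejer kernels; its
  Fourier transform is a multiple of \<open>2 \<bar>1 + \<xi>\<bar> + 2 \<bar>1 - \<xi>\<bar> - \<bar>1 + 2 \<xi>\<bar> - \<bar>1 - 2 \<xi>\<bar>\<close>.\<close>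

definition cosker :: "real \<Rightarrow> real \<Rightarrow> real" where "cosker a x = (1 - cos (a * x)) / x\<^sup>2"

lemma cosker_measurable[measurable]: "cosker a \<in> borel_measurable borel"
  unfolding cosker_def[abs_def] by measurable

lemma one_minus_cos_le: "1 - cos x \<le> x\<^sup>2 / (2::real)"
proof -
  have "1 - cos x = 2 * (sin (x/2))\<^sup>2" using cos_double_sin[of "x/2"] by simp
  also have "\<dots> \<le> 2 * (x/2)\<^sup>2"
    using abs_sin_x_le_abs_x[of "x/2"] by (simp add: abs_le_square_iff del: abs_divide)
  finally show ?thesis by (simp add: power2_eq_square)
qed

text \<open>Two bounds are added: \<open>a\<^sup>2 / 2\<close>, decisive near the origin, and
  \<open>2 / x\<^sup>2\<close>, decisive at infinity.\<close>

lemma cosker_bound: "0 \<le> cosker a x \<and> cosker a x \<le> (a\<^sup>2 / 2 + 2) * decay x"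
proof
  show "0 \<le> cosker a x" by (simp add: cosker_def)
  show "cosker a x \<le> (a\<^sup>2 / 2 + 2) * decay x"
  proof (cases "x = 0")
    \<comment> \<open>Division by zero gives \<open>cosker a 0\<close> the value 0 instead of the
      limit \<open>a\<^sup>2 / 2\<close>; one point does not affect the integrals.\<close>
    case True then show ?thesis by (simp add: cosker_def decay_def)
  next
    case False
    have "x\<^sup>2 * (1 - cos (a * x)) \<le> x\<^sup>2 * 2"
      by (intro mult_left_mono) (use cos_ge_minus_one[of "a*x"] in linarith, simp)
    moreover have "1 - cos (a * x) \<le> a\<^sup>2 * x\<^sup>2 / 2" using one_minus_cos_le[of "a * x"] by (simp add: power_mult_distrib)
    ultimately have "(1 - cos (a * x)) * (1 + x\<^sup>2) \<le> (a\<^sup>2 / 2 + 2) * x\<^sup>2" by (simp add: algebra_simps)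
    then show ?thesis using False by (simp add: cosker_def decay_def pos_divide_le_eq pos_le_divide_eq add_pos_nonneg)
  qed
qed

lemma cosker_integrable: "integrable lborel (cosker a)"
proof (rule Bochner_Integration.integrable_bound)
  show "integrable lborel (\<lambda>x. (a\<^sup>2 / 2 + 2) * decay x)" using integrable_decay by simp
  have "norm (cosker a x) \<le> norm ((a\<^sup>2 / 2 + 2) * decay x)" for x
    using cosker_bound[of a x] by simp
  then show "AE x in lborel. norm (cosker a x) \<le> norm ((a\<^sup>2 / 2 + 2) * decay x)" by simp
qed simp

text \<open>Scaling: \<open>cosker a x = a\<^sup>2 * cosker 1 (a * x)\<close>. The absolute value of
  \<open>a\<close> is the source of the piecewise linear Fourier transform of the kernel.\<close>

lemma integral_cosker: "(LINT x|lborel. cosker a x) = \<bar>a\<bar> * (LINT x|lborel. cosker 1 x)"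
proof (cases "a = 0")
  case True then show ?thesis by (simp add: cosker_def)
next
  case False
  have "cosker 1 (a * x) * a\<^sup>2 = cosker a x" for x using False by (simp add: cosker_def power_mult_distrib)
  then have "(LINT x|lborel. cosker a x) = (LINT x|lborel. cosker 1 (a * x)) * a\<^sup>2"
    by (metis (no_types, lifting) Bochner_Integration.integral_cong integral_mult_left_zero)
  also have "\<bar>a\<bar> * (LINT x|lborel. cosker 1 (a * x)) = (LINT x|lborel. cosker 1 x)"
    using lborel_integral_real_affine[OF False, of "cosker 1" 0] by simp
  then have "(LINT x|lborel. cosker 1 (a * x)) * a\<^sup>2 = \<bar>a\<bar> * (LINT x|lborel. cosker 1 x)"
  proof -
    assume h: "\<bar>a\<bar> * (LINT x|lborel. cosker 1 (a * x)) = (LINT x|lborel. cosker 1 x)"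
    have "a\<^sup>2 = \<bar>a\<bar> * \<bar>a\<bar>" by (simp add: power2_eq_square)
    then show ?thesis unfolding h[symmetric] by simp
  qed
  finally show ?thesis .
qed

text \<open>This permits the normalisation in \<open>vp_kernel\<close>. The integrand is
  nonnegative, and it does not vanish on \<open>(pi/2, pi)\<close>, where the cosine is
  negative.\<close>

lemma integral_cosker_pos: "(LINT x|lborel. cosker 1 x) > 0"
proof -
  have "\<not> (AE x in lborel. cosker 1 x = 0)"
  proof
    assume "AE x in lborel. cosker 1 x = 0"
    then have "AE x in lborel. x \<notin> {pi/2<..<pi}"
    proof eventually_elim
      case (elim x)
      then have "1 - cos x = 0 \<or> x\<^sup>2 = 0" unfolding cosker_def divide_eq_0_iff mult_1_left .
      moreover have "cos x < 0" if "pi/2 < x" "x < pi"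
        using cos_monotone_0_pi[of "pi/2" x] that by (simp add: cos_pi_half)
      moreover have "x > 0" if "pi/2 < x" using that pi_half_gt_zero by linarith
      ultimately show ?case by fastforce
    qed
    then have "{pi/2<..<pi} \<in> null_sets lborel"
      by (subst AE_iff_null_sets) simp_all
    then have "emeasure lborel {pi/2<..<pi} = 0" by (rule null_setsD1)
    moreover have "emeasure lborel {pi/2<..<pi} = ennreal (pi - pi/2)"
      by (rule emeasure_lborel_Ioo) simp
    ultimately have "pi - pi/2 \<le> 0" by (metis ennreal_eq_0_iff)
    then show False using pi_gt_zero by linarith
  qed
  then have "(LINT x|lborel. cosker 1 x) \<noteq> 0"
    using integral_nonneg_eq_0_iff_AE[OF cosker_integrable] cosker_bound by simp
  moreover have "(LINT x|lborel. cosker 1 x) \<ge> 0" using cosker_bound by (intro integral_nonneg_AE) simp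
  ultimately show ?thesis by linarith
qed

text \<open>The division makes the Fourier transform equal to 1 on \<open>[-1/2, 1/2]\<close>.\<close>

definition vp_kernel :: "real \<Rightarrow> real"
  where "vp_kernel x = (cosker (2 * pi) x - cosker pi x) / (pi * (LINT x|lborel. cosker 1 x))"

lemma vp_kernel_measurable[measurable]: "vp_kernel \<in> borel_measurable borel"
  unfolding vp_kernel_def[abs_def] by measurable

lemma vp_kernel_integrable: "integrable lborel vp_kernel"
  unfolding vp_kernel_def[abs_def] using cosker_integrable[of "2 * pi"] cosker_integrable[of pi] by simp

lemma vp_kernel_bound: "\<exists>A>0. \<forall>x. \<bar>vp_kernel x\<bar> \<le> A * decay x"
proof -
  define J where "J = pi * (LINT x|lborel. cosker 1 x)"
  have J: "J > 0" using integral_cosker_pos by (simp add: J_def)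
  define D where "D = ((2*pi)\<^sup>2 / 2 + 2) + (pi\<^sup>2 / 2 + 2)"
  have "\<bar>vp_kernel x\<bar> \<le> (D / J) * decay x" for x
  proof -
    have "\<bar>cosker (2 * pi) x - cosker pi x\<bar> \<le> D * decay x"
      using cosker_bound[of "2*pi" x] cosker_bound[of pi x] unfolding D_def distrib_right[of _ _ "decay x"] by linarith
    then have "\<bar>cosker (2 * pi) x - cosker pi x\<bar> / J \<le> D * decay x / J" using J by (intro divide_right_mono) auto
    then show ?thesis using J by (simp add: vp_kernel_def J_def[symmetric])
  qed
  moreover have "D / J > 0" using J by (simp add: D_def add_pos_nonneg)
  ultimately show ?thesis by blast
qed

text \<open>The product-to-sum formula: modulation by \<xi> moves the frequencies \<open>pi\<close>
  and \<open>2 * pi\<close> to four new ones. The four constants 1 inside the \<open>cosker\<close>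
  terms cancel, so each term can be integrated by \<open>integral_cosker\<close>.\<close>

lemma vp_kernel_cos:
  "vp_kernel x * cos (2 * pi * x * \<xi>) * (pi * (LINT x|lborel. cosker 1 x)) =
    (cosker (2 * pi * (1 + \<xi>)) x + cosker (2 * pi * (1 - \<xi>)) x - cosker (pi * (1 + 2 * \<xi>)) x - cosker (pi * (1 - 2 * \<xi>)) x) / 2"
proof (cases "x = 0")
  case True then show ?thesis by (simp add: vp_kernel_def cosker_def)
next
  case False
  have "vp_kernel x * cos (2 * pi * x * \<xi>) * (pi * (LINT x|lborel. cosker 1 x)) = (cosker (2 * pi) x - cosker pi x) * cos (2 * pi * x * \<xi>)"
    using integral_cosker_pos by (simp add: vp_kernel_def)
  also have "\<dots> = (cos (pi * x) * cos (2 * pi * x * \<xi>) - cos (2 * pi * x) * cos (2 * pi * x * \<xi>)) / x\<^sup>2"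
    using False by (simp add: cosker_def field_simps)
  also have "\<dots> = ((cos (pi * (1 - 2 * \<xi>) * x) + cos (pi * (1 + 2 * \<xi>) * x)) / 2 - (cos (2 * pi * (1 - \<xi>) * x) + cos (2 * pi * (1 + \<xi>) * x)) / 2) / x\<^sup>2"
    unfolding cos_times_cos by (simp add: algebra_simps)
  also have "\<dots> = (cosker (2 * pi * (1 + \<xi>)) x + cosker (2 * pi * (1 - \<xi>)) x - cosker (pi * (1 + 2 * \<xi>)) x - cosker (pi * (1 - 2 * \<xi>)) x) / 2"
    using False by (simp add: cosker_def field_simps)
  finally show ?thesis .
qed

lemma integrable_vp_kernel_cis: "integrable lborel (\<lambda>x. complex_of_real (vp_kernel x) * cis (c * x))"
proof (rule Bochner_Integration.integrable_bound)
  have [measurable]: "(\<lambda>x. cis (c * x)) \<in> borel_measurable borel"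
    unfolding cis_conv_exp by (intro borel_measurable_continuous_onI continuous_intros)
  show "(\<lambda>x. complex_of_real (vp_kernel x) * cis (c * x)) \<in> borel_measurable lborel" by measurable
  show "integrable lborel vp_kernel" by (rule vp_kernel_integrable)
  show "AE x in lborel. norm (complex_of_real (vp_kernel x) * cis (c * x)) \<le> norm (vp_kernel x)"
    by (simp add: norm_mult)
qed

text \<open>For these \<xi> all four absolute values given by \<open>integral_cosker\<close> open
  with a plus sign and the dependence on \<xi> cancels. The imaginary part is the integral of an odd
  function.\<close>

lemma vp_kernel_fourier:
  assumes "\<bar>\<xi>\<bar> \<le> 1/2"
  shows "(LINT x|lborel. complex_of_real (vp_kernel x) * cis (- 2 * pi * x * \<xi>)) = 1"
proof -
  define J where "J = (LINT x|lborel. cosker 1 x)"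
  have J: "J > 0" using integral_cosker_pos by (simp add: J_def)
  let ?h = "\<lambda>x. complex_of_real (vp_kernel x) * cis (- 2 * pi * x * \<xi>)"
  have i: "integrable lborel ?h" using integrable_vp_kernel_cis[of "- 2 * pi * \<xi>"] by (simp add: mult_ac)
  have "Im (LINT x|lborel. ?h x) = - (LINT x|lborel. vp_kernel x * sin (2 * pi * x * \<xi>))"
    using i by (simp add: integral_Im[symmetric])
  moreover have "(LINT x|lborel. - vp_kernel x * sin (2 * pi * x * \<xi>)) = - (LINT x|lborel. vp_kernel x * sin (2 * pi * x * \<xi>))"
    by simp
  \<comment> \<open>The reflection \<open>x \<mapsto> - x\<close>: the kernel is even and the sine
    odd.\<close>
  moreover have "(LINT x|lborel. - vp_kernel x * sin (2 * pi * x * \<xi>)) = (LINT x|lborel. vp_kernel x * sin (2 * pi * x * \<xi>))"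
    using lborel_integral_real_affine[of "-1" "\<lambda>x. - vp_kernel x * sin (2 * pi * x * \<xi>)" 0]
    by (simp add: vp_kernel_def cosker_def)
  ultimately have im: "Im (LINT x|lborel. ?h x) = 0" by linarith
  have "Re (LINT x|lborel. ?h x) = (LINT x|lborel. vp_kernel x * cos (2 * pi * x * \<xi>))"
    using i by (simp add: integral_Re[symmetric])
  then have "Re (LINT x|lborel. ?h x) * (pi * J) = (LINT x|lborel. vp_kernel x * cos (2 * pi * x * \<xi>) * (pi * J))"
    by simp
  also have "\<dots> = (LINT x|lborel. (cosker (2 * pi * (1 + \<xi>)) x + cosker (2 * pi * (1 - \<xi>)) x - cosker (pi * (1 + 2 * \<xi>)) x - cosker (pi * (1 - 2 * \<xi>)) x) / 2)"
    by (simp only: J_def vp_kernel_cos)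
  also have "\<dots> = (\<bar>2 * pi * (1 + \<xi>)\<bar> * J + \<bar>2 * pi * (1 - \<xi>)\<bar> * J - \<bar>pi * (1 + 2 * \<xi>)\<bar> * J - \<bar>pi * (1 - 2 * \<xi>)\<bar> * J) / 2"
    unfolding J_def integral_cosker[symmetric] by (simp add: cosker_integrable)
  also have "\<dots> = pi * J"
  proof -
    have "\<bar>2 * pi * (1 + \<xi>)\<bar> = 2 * pi * (1 + \<xi>)" "\<bar>2 * pi * (1 - \<xi>)\<bar> = 2 * pi * (1 - \<xi>)"
      "\<bar>pi * (1 + 2 * \<xi>)\<bar> = pi * (1 + 2 * \<xi>)" "\<bar>pi * (1 - 2 * \<xi>)\<bar> = pi * (1 - 2 * \<xi>)"
      using assms by (auto intro!: abs_of_nonneg mult_nonneg_nonneg)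
    then show ?thesis by (simp only:) (simp add: algebra_simps)
  qed
  finally have "Re (LINT x|lborel. ?h x) = 1" using J by simp
  with im show ?thesis by (simp add: complex_eq_iff)
qed

section \<open>Random signs\<close>

text \<open>A choice of signs is encoded by the set where the sign is +1. Averaging over all choices
  becomes a finite sum over \<open>Pow A\<close>, and induction on \<open>A\<close> splits it by
  \<open>sum_Pow_insert\<close>.\<close>

definition pm :: "'a set \<Rightarrow> 'a \<Rightarrow> real" where "pm S x = (if x \<in> S then 1 else - 1)"

lemma sum_Pow_insert:
  fixes g :: "'a set \<Rightarrow> 'b::comm_monoid_add"
  assumes "finite A" "x \<notin> A"
  shows "(\<Sum>S\<in>Pow (insert x A). g S) = (\<Sum>S\<in>Pow A. g S + g (insert x S))"
proof -
  have "inj_on (insert x) (Pow A)" using assms(2) by (auto simp: inj_on_def)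
  moreover have "Pow A \<inter> insert x ` Pow A = {}" using assms(2) by auto
  ultimately show ?thesis using assms(1)
    by (simp add: Pow_insert sum.union_disjoint sum.reindex sum.distrib)
qed

lemma sum_pm_insert:
  fixes a :: "'a \<Rightarrow> 'b::real_vector"
  assumes "finite A" "x \<notin> A" "S \<subseteq> A"
  shows "(\<Sum>t\<in>insert x A. pm S t *\<^sub>R a t) = (\<Sum>t\<in>A. pm S t *\<^sub>R a t) - a x"
    and "(\<Sum>t\<in>insert x A. pm (insert x S) t *\<^sub>R a t) = (\<Sum>t\<in>A. pm S t *\<^sub>R a t) + a x"
proof -
  show "(\<Sum>t\<in>insert x A. pm S t *\<^sub>R a t) = (\<Sum>t\<in>A. pm S t *\<^sub>R a t) - a x"
    using assms by (auto simp: pm_def)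
  have "(\<Sum>t\<in>A. pm (insert x S) t *\<^sub>R a t) = (\<Sum>t\<in>A. pm S t *\<^sub>R a t)"
    using assms by (intro sum.cong) (auto simp: pm_def)
  then show "(\<Sum>t\<in>insert x A. pm (insert x S) t *\<^sub>R a t) = (\<Sum>t\<in>A. pm S t *\<^sub>R a t) + a x"
    using assms by (simp add: pm_def)
qed

text \<open>Cross terms cancel between the two signs of a newly added element; this is the
  parallelogram law.\<close>

lemma sum_signs_norm_square:
  fixes a :: "'a \<Rightarrow> complex"
  assumes "finite A"
  shows "(\<Sum>S\<in>Pow A. (cmod (\<Sum>t\<in>A. pm S t *\<^sub>R a t))\<^sup>2) = 2 ^ card A * (\<Sum>t\<in>A. (cmod (a t))\<^sup>2)"
  using assms
proof (induction A)
  case empty then show ?case by simp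
next
  case (insert x A)
  have par: "(cmod (u - v))\<^sup>2 + (cmod (u + v))\<^sup>2 = 2 * (cmod u)\<^sup>2 + 2 * (cmod v)\<^sup>2" for u v
    unfolding cmod_power2 by (simp add: power2_eq_square algebra_simps)
  have "(\<Sum>S\<in>Pow (insert x A). (cmod (\<Sum>t\<in>insert x A. pm S t *\<^sub>R a t))\<^sup>2)
      = (\<Sum>S\<in>Pow A. 2 * (cmod (\<Sum>t\<in>A. pm S t *\<^sub>R a t))\<^sup>2 + 2 * (cmod (a x))\<^sup>2)"
    unfolding sum_Pow_insert[OF insert(1,2)]
  proof (rule sum.cong)
    fix S assume "S \<in> Pow A"
    then have "S \<subseteq> A" by simp
    then show "(cmod (\<Sum>t\<in>insert x A. pm S t *\<^sub>R a t))\<^sup>2 + (cmod (\<Sum>t\<in>insert x A. pm (insert x S) t *\<^sub>R a t))\<^sup>2 =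
         2 * (cmod (\<Sum>t\<in>A. pm S t *\<^sub>R a t))\<^sup>2 + 2 * (cmod (a x))\<^sup>2"
      by (simp only: sum_pm_insert[OF insert(1,2)] par)
  qed simp
  also have "\<dots> = 2 ^ card (insert x A) * (\<Sum>t\<in>insert x A. (cmod (a t))\<^sup>2)"
    using insert by (simp add: sum.distrib card_Pow algebra_simps flip: sum_distrib_left)
  finally show ?case .
qed

text \<open>The subgaussian bound for one random sign. The exponent \<open>x\<^sup>2\<close> in
  place of the sharp \<open>x\<^sup>2 / 2\<close> keeps the proof elementary and affects only
  constants.\<close>

lemma exp_add_exp_minus_le: "exp x + exp (- x) \<le> 2 * exp (x\<^sup>2 :: real)"
proof -
  have *: "exp x + exp (- x) \<le> 2 * exp (x\<^sup>2)" if "x \<ge> 0" for x :: real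
  proof (cases "x \<le> 1")
    case True
    have "exp x \<le> 1 + x + x\<^sup>2" using True that by (intro exp_bound) auto
    moreover have "exp (- x) \<le> 1 - x + x\<^sup>2"
    proof -
      have "0 \<le> 1 - x + x\<^sup>2" using True by (simp add: add_nonneg_nonneg)
      \<comment> \<open>The product equals \<open>1 + x ^ 3\<close>.\<close>
      then have "1 \<le> (1 - x + x\<^sup>2) * (1 + x)" using that by (simp add: power2_eq_square algebra_simps)
      also have "\<dots> \<le> (1 - x + x\<^sup>2) * exp x" using \<open>0 \<le> 1 - x + x\<^sup>2\<close> by (intro mult_left_mono) auto
      finally show ?thesis by (simp add: exp_minus field_simps)
    qed
    ultimately show ?thesis using exp_ge_add_one_self[of "x\<^sup>2"] by linarith
  next
    case False
    then have "x * 1 \<le> x * x" by (intro mult_left_mono) auto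
    then have "exp x \<le> exp (x\<^sup>2)" "exp (- x) \<le> exp (x\<^sup>2)" using False that by (auto simp: power2_eq_square intro: order_trans[of _ 0])
    then show ?thesis by linarith
  qed
  show ?thesis using *[of x] *[of "- x"] by (cases "x \<ge> 0") auto
qed

text \<open>Independence of the signs: the exponential moment factors, one factor per
  element.\<close>

lemma sum_signs_exp_le:
  fixes a :: "'a \<Rightarrow> real"
  assumes "finite A"
  shows "(\<Sum>S\<in>Pow A. exp (\<Sum>t\<in>A. pm S t *\<^sub>R a t)) \<le> 2 ^ card A * exp (\<Sum>t\<in>A. (a t)\<^sup>2)"
  using assms
proof (induction A)
  case empty then show ?case by simp
next
  case (insert x A)
  have "(\<Sum>S\<in>Pow (insert x A). exp (\<Sum>t\<in>insert x A. pm S t *\<^sub>R a t))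
      = (\<Sum>S\<in>Pow A. exp (\<Sum>t\<in>A. pm S t *\<^sub>R a t) * (exp (a x) + exp (- a x)))"
    unfolding sum_Pow_insert[OF insert(1,2)]
  proof (rule sum.cong)
    fix S assume "S \<in> Pow A"
    then have "S \<subseteq> A" by simp
    then show "exp (\<Sum>t\<in>insert x A. pm S t *\<^sub>R a t) + exp (\<Sum>t\<in>insert x A. pm (insert x S) t *\<^sub>R a t) =
         exp (\<Sum>t\<in>A. pm S t *\<^sub>R a t) * (exp (a x) + exp (- a x))"
      by (simp only: sum_pm_insert[OF insert(1,2)]) (simp add: exp_add exp_diff exp_minus field_simps)
  qed simp
  also have "\<dots> = (\<Sum>S\<in>Pow A. exp (\<Sum>t\<in>A. pm S t *\<^sub>R a t)) * (exp (a x) + exp (- a x))"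
    by (simp add: sum_distrib_right)
  also have "\<dots> \<le> (2 ^ card A * exp (\<Sum>t\<in>A. (a t)\<^sup>2)) * (2 * exp ((a x)\<^sup>2))"
    using insert exp_add_exp_minus_le by (intro mult_mono sum_nonneg) (auto intro: add_nonneg_nonneg)
  also have "\<dots> = 2 ^ card (insert x A) * exp (\<Sum>t\<in>insert x A. (a t)\<^sup>2)"
    using insert by (simp add: exp_add)
  finally show ?case .
qed

text \<open>One term of the exponential series. The second exponential takes care of negative
  \<open>x\<close>, as the exponent is even.\<close>

lemma power_le_fact_exp: "x ^ (2 * r) \<le> fact (2 * r) * (exp x + exp (- x :: real))"
proof -
  have *: "x ^ (2 * r) \<le> fact (2 * r) * (exp x + exp (- x))" if "x \<ge> 0" for x :: real
  proof -
    have "(\<Sum>i\<in>{2*r}. x ^ i /\<^sub>R fact i) \<le> (\<Sum>i. x ^ i /\<^sub>R fact i)"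
      using that by (intro sum_le_suminf summable_exp_generic) auto
    then have "x ^ (2 * r) / fact (2 * r) \<le> exp x" by (simp add: exp_def divide_inverse_commute)
    then have "x ^ (2 * r) \<le> fact (2 * r) * exp x" by (simp add: field_simps)
    also have "\<dots> \<le> fact (2 * r) * (exp x + exp (- x))" by (intro mult_left_mono) auto
    finally show ?thesis .
  qed
  show ?thesis using *[of x] *[of "- x"] by (cases "x \<ge> 0") (auto simp: add.commute)
qed

text \<open>Both sides have the same homogeneity, so the coefficients may be scaled to square sum 1.
  Then even moments are dominated by exponential moments, which \<open>sum_signs_exp_le\<close>
  bounds by \<open>exp 1\<close> on average.\<close>

lemma khintchine_real:
  fixes a :: "'a \<Rightarrow> real"
  assumes "finite A"
  shows "(\<Sum>S\<in>Pow A. (\<Sum>t\<in>A. pm S t *\<^sub>R a t) ^ (2 * r)) \<le> (fact (2 * r) * 2 * exp 1) * 2 ^ card A * (\<Sum>t\<in>A. (a t)\<^sup>2) ^ r"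
proof (cases "(\<Sum>t\<in>A. (a t)\<^sup>2) = 0")
  case True
  then have "\<And>t. t \<in> A \<Longrightarrow> a t = 0" using assms by (simp add: sum_nonneg_eq_0_iff)
  then have "(\<Sum>t\<in>A. pm S t *\<^sub>R a t) = 0" for S by (intro sum.neutral) simp
  \<comment> \<open>No scaling is possible here. For \<open>r = 0\<close> both powers are
    \<open>0 ^ 0 = 1\<close>, so the constant has to be at least 1.\<close>
  then have "(\<Sum>S\<in>Pow A. (\<Sum>t\<in>A. pm S t *\<^sub>R a t) ^ (2 * r)) = 2 ^ card A * 0 ^ r"
    using assms by (cases "r = 0") (simp_all add: card_Pow power_0_left)
  also have "\<dots> \<le> (fact (2 * r) * 2 * exp 1) * (2 ^ card A * 0 ^ r)"
  proof -
    have "1 * 1 * 1 \<le> fact (2 * r) * 2 * exp (1::real)"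
      by (intro mult_mono) (auto simp: fact_ge_1)
    then have "1 * (2 ^ card A * 0 ^ r) \<le> (fact (2 * r) * 2 * exp 1) * (2 ^ card A * 0 ^ r :: real)"
      by (intro mult_right_mono) auto
    then show ?thesis by simp
  qed
  finally show ?thesis using True by (simp only: mult.assoc)
next
  case False
  define s where "s = sqrt (\<Sum>t\<in>A. (a t)\<^sup>2)"
  have s: "s > 0" "s\<^sup>2 = (\<Sum>t\<in>A. (a t)\<^sup>2)" using False by (auto simp: s_def sum_nonneg order_less_le)
  define b where "b = (\<lambda>t. a t / s)"
  have b1: "(\<Sum>t\<in>A. (b t)\<^sup>2) = 1" using s False by (simp add: b_def power_divide flip: sum_divide_distrib)
  have "(\<Sum>S\<in>Pow A. (\<Sum>t\<in>A. pm S t *\<^sub>R b t) ^ (2 * r))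
      \<le> (\<Sum>S\<in>Pow A. fact (2 * r) * (exp (\<Sum>t\<in>A. pm S t *\<^sub>R b t) + exp (\<Sum>t\<in>A. pm S t *\<^sub>R (- b t))))"
    by (intro sum_mono) (use power_le_fact_exp in \<open>simp add: sum_negf\<close>)
  also have "\<dots> = fact (2 * r) * ((\<Sum>S\<in>Pow A. exp (\<Sum>t\<in>A. pm S t *\<^sub>R b t)) + (\<Sum>S\<in>Pow A. exp (\<Sum>t\<in>A. pm S t *\<^sub>R (- b t))))"
    by (simp only: sum_distrib_left[symmetric] sum.distrib)
  also have "\<dots> \<le> fact (2 * r) * (2 ^ card A * exp 1 + 2 ^ card A * exp 1)"
    using sum_signs_exp_le[OF assms, of b] sum_signs_exp_le[OF assms, of "\<lambda>t. - b t"] b1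
    by (intro mult_left_mono add_mono) auto
  finally have "(\<Sum>S\<in>Pow A. (\<Sum>t\<in>A. pm S t *\<^sub>R b t) ^ (2 * r)) \<le> (fact (2 * r) * 2 * exp 1) * 2 ^ card A"
    by (simp add: algebra_simps)
  then have "s ^ (2 * r) * (\<Sum>S\<in>Pow A. (\<Sum>t\<in>A. pm S t *\<^sub>R b t) ^ (2 * r)) \<le> s ^ (2 * r) * ((fact (2 * r) * 2 * exp 1) * 2 ^ card A)"
    using s by (intro mult_left_mono) auto
  moreover have "s ^ (2 * r) * (\<Sum>S\<in>Pow A. (\<Sum>t\<in>A. pm S t *\<^sub>R b t) ^ (2 * r)) = (\<Sum>S\<in>Pow A. (\<Sum>t\<in>A. pm S t *\<^sub>R a t) ^ (2 * r))"
    unfolding sum_distrib_left power_mult_distrib[symmetric] using s(1) by (simp add: b_def)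
  moreover have "s ^ (2 * r) = (\<Sum>t\<in>A. (a t)\<^sup>2) ^ r" using s(2) by (simp add: power_mult)
  ultimately show ?thesis by (simp add: mult_ac)
qed

lemma power_add_le:
  fixes x y :: real
  assumes "x \<ge> 0" "y \<ge> 0"
  shows "(x + y) ^ n \<le> 2 ^ n * (x ^ n + y ^ n)"
proof -
  have "(x + y) ^ n \<le> (2 * max x y) ^ n" using assms by (intro power_mono) auto
  also have "\<dots> = 2 ^ n * (max x y) ^ n" by (simp add: power_mult_distrib)
  also have "\<dots> \<le> 2 ^ n * (x ^ n + y ^ n)" using assms by (intro mult_left_mono) (auto simp: max_def)
  finally show ?thesis .
qed

text \<open>\<open>2 ^ r\<close> comes from splitting the modulus by \<open>power_add_le\<close>,
  the next 2 from having a real and an imaginary part, and the bracket is the real constant.\<close>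

definition khintchine_const :: "nat \<Rightarrow> real" where "khintchine_const r = 2 ^ r * 2 * (fact (2 * r) * 2 * exp 1)"

lemma khintchine_const_nonneg: "khintchine_const r \<ge> 0" by (simp add: khintchine_const_def)

lemma khintchine:
  fixes a :: "'a \<Rightarrow> complex"
  assumes "finite A"
  shows "(\<Sum>S\<in>Pow A. cmod (\<Sum>t\<in>A. pm S t *\<^sub>R a t) ^ (2 * r)) \<le> khintchine_const r * 2 ^ card A * (\<Sum>t\<in>A. (cmod (a t))\<^sup>2) ^ r"
proof -
  define K :: real where "K = fact (2 * r) * 2 * exp 1"
  have K: "K \<ge> 0" by (simp add: K_def)
  have "cmod z ^ (2 * r) \<le> 2 ^ r * (Re z ^ (2 * r) + Im z ^ (2 * r))" for z
    using power_add_le[of "(Re z)\<^sup>2" "(Im z)\<^sup>2" r] by (simp add: power_mult cmod_power2)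
  then have "(\<Sum>S\<in>Pow A. cmod (\<Sum>t\<in>A. pm S t *\<^sub>R a t) ^ (2 * r)) \<le>
      (\<Sum>S\<in>Pow A. 2 ^ r * (Re (\<Sum>t\<in>A. pm S t *\<^sub>R a t) ^ (2 * r) + Im (\<Sum>t\<in>A. pm S t *\<^sub>R a t) ^ (2 * r)))"
    by (rule sum_mono)
  also have "\<dots> = 2 ^ r * ((\<Sum>S\<in>Pow A. (\<Sum>t\<in>A. pm S t *\<^sub>R Re (a t)) ^ (2 * r)) + (\<Sum>S\<in>Pow A. (\<Sum>t\<in>A. pm S t *\<^sub>R Im (a t)) ^ (2 * r)))"
    by (simp add: sum_distrib_left[symmetric] sum.distrib)
  also have "\<dots> \<le> 2 ^ r * (K * 2 ^ card A * (\<Sum>t\<in>A. (Re (a t))\<^sup>2) ^ r + K * 2 ^ card A * (\<Sum>t\<in>A. (Im (a t))\<^sup>2) ^ r)"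
    unfolding K_def by (intro mult_left_mono add_mono khintchine_real assms) auto
  also have "\<dots> \<le> 2 ^ r * (K * 2 ^ card A * (\<Sum>t\<in>A. (cmod (a t))\<^sup>2) ^ r + K * 2 ^ card A * (\<Sum>t\<in>A. (cmod (a t))\<^sup>2) ^ r)"
    using K by (intro mult_left_mono add_mono power_mono[of "sum _ _"] sum_mono) (simp_all add: cmod_power2 sum_nonneg)
  finally show ?thesis by (simp add: khintchine_const_def K_def algebra_simps)
qed

text \<open>The easy half of Khintchine's inequality: the second moment is known exactly from
  \<open>sum_signs_norm_square\<close>, and by convexity the r-th power of the mean is at most the
  mean of the r-th powers.\<close>

lemma square_function_le_signs:
  fixes a :: "'a \<Rightarrow> complex"
  assumes "finite A" "r \<ge> 1"
  shows "2 ^ card A * (\<Sum>t\<in>A. (cmod (a t))\<^sup>2) ^ r \<le> (\<Sum>S\<in>Pow A. cmod (\<Sum>t\<in>A. pm S t *\<^sub>R a t) ^ (2 * r))"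
proof -
  obtain n where r: "r = Suc n" using assms(2) by (cases r) auto
  define Q where "Q = (\<Sum>t\<in>A. (cmod (a t))\<^sup>2)"
  have "(2 ^ card A * Q) ^ Suc n \<le> (2 ^ card A) ^ n * (\<Sum>S\<in>Pow A. cmod (\<Sum>t\<in>A. pm S t *\<^sub>R a t) ^ (2 * r))"
    using power_sum_le[of "Pow A" "\<lambda>_. 1" "\<lambda>S. (cmod (\<Sum>t\<in>A. pm S t *\<^sub>R a t))\<^sup>2" n] assms
    by (simp add: sum_signs_norm_square card_Pow Q_def[symmetric] r power_mult[symmetric] del: power_Suc mult_Suc_right)
  then have "(2 ^ card A) ^ n * (2 ^ card A * Q ^ r) \<le> (2 ^ card A) ^ n * (\<Sum>S\<in>Pow A. cmod (\<Sum>t\<in>A. pm S t *\<^sub>R a t) ^ (2 * r))"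
    by (simp add: r power_mult_distrib mult_ac)
  then show ?thesis unfolding Q_def by (subst (asm) mult_le_cancel_left_pos) auto
qed

section \<open>The large sieve\<close>

text \<open>Orthogonality is read off from Fourier inversion for the unit mass at 0, whose Fourier
  series is the constant 1.\<close>

lemma integral_cis_01:
  "(LINT t|lborel. indicator {0..1} t *\<^sub>R cis (2 * pi * of_int n * t)) = (if n = 0 then 1 else 0)"
proof -
  define f :: "int \<Rightarrow> complex" where "f = (\<lambda>k. if k = 0 then 1 else 0)"
  have "(\<lambda>k. norm (f k) powr 1) = (indicator {0} :: int \<Rightarrow> real)" by (auto simp: f_def fun_eq_iff)
  then have "f \<in> ell 1" by (simp add: Lp_space_def)
  then have "inv_fourier_Z (fourier_Z f) n = f n" by (rule inv_fourier_Z_fourier_Z)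
  moreover have "fourier_Z f \<xi> = 1" for \<xi>
  proof -
    have "fourier_Z f \<xi> = (\<Sum>\<^sub>\<infinity>n\<in>{0}. f n * cis (- 2 * pi * of_int n * \<xi>))"
      unfolding fourier_Z_def by (rule infsum_cong_neutral) (auto simp: f_def)
    then show ?thesis by (simp add: f_def)
  qed
  ultimately have "(LINT t|lebesgue. indicator {0..1} t *\<^sub>R cis (2 * pi * of_int n * t)) = f n"
    by (simp add: inv_fourier_Z_def set_lebesgue_integral_def)
  also have "(LINT t|lebesgue. indicator {0..1} t *\<^sub>R cis (2 * pi * of_int n * t)) = (LINT t|lborel. indicator {0..1} t *\<^sub>R cis (2 * pi * of_int n * t))"
  proof (rule integral_completion)
    have [measurable]: "(\<lambda>t. cis (2 * pi * of_int n * t)) \<in> borel_measurable borel"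
      unfolding cis_conv_exp by (intro borel_measurable_continuous_onI continuous_intros)
    show "(\<lambda>t. indicator {0..1} t *\<^sub>R cis (2 * pi * of_int n * t)) \<in> borel_measurable lborel" by measurable
  qed
  finally show ?thesis by (simp add: f_def)
qed

lemma continuous_on_cis_linear: "continuous_on A (\<lambda>t::real. cis (c * t))"
  unfolding cis_conv_exp by (intro continuous_intros)

lemma borel_measurable_cis_linear[measurable]: "(\<lambda>t::real. cis (c * t)) \<in> borel_measurable borel"
  by (rule borel_measurable_continuous_onI) (rule continuous_on_cis_linear)

lemma parseval_01:
  fixes c :: "int \<Rightarrow> complex"
  assumes "finite A"
  shows "(LINT t|lborel. indicator {0..1} t * (cmod (\<Sum>k\<in>A. c k * cis (- 2 * pi * of_int k * t)))\<^sup>2) = (\<Sum>k\<in>A. (cmod (c k))\<^sup>2)"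
proof -
  have sq: "complex_of_real ((cmod (\<Sum>k\<in>A. c k * cis (- 2 * pi * of_int k * t)))\<^sup>2) =
      (\<Sum>k\<in>A. \<Sum>l\<in>A. c k * cnj (c l) * cis (2 * pi * of_int (l - k) * t))" for t
  proof -
    have *: "c k * cis (- 2 * pi * of_int k * t) * cnj (c l * cis (- 2 * pi * of_int l * t)) = c k * cnj (c l) * cis (2 * pi * of_int (l - k) * t)" for k l
      by (simp add: cis_cnj cis_mult mult_ac) (simp add: algebra_simps)
    show ?thesis
      unfolding complex_norm_square by (simp only: cnj_sum sum_product *)
  qed
  have int: "integrable lborel (\<lambda>t. indicator {0..1} t *\<^sub>R cis (2 * pi * of_int n * t))" for n :: int
    using borel_integrable_compact[of "{0..1::real}" "\<lambda>t. cis (2 * pi * of_int n * t)"] continuous_on_cis_linear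
    by (simp add: set_integrable_def indicator_scaleR_eq_if)
  have "complex_of_real (LINT t|lborel. indicator {0..1} t * (cmod (\<Sum>k\<in>A. c k * cis (- 2 * pi * of_int k * t)))\<^sup>2)
    = (LINT t|lborel. complex_of_real (indicator {0..1} t * (cmod (\<Sum>k\<in>A. c k * cis (- 2 * pi * of_int k * t)))\<^sup>2))"
    by (rule integral_complex_of_real[symmetric])
  also have "\<dots> = (LINT t|lborel. (\<Sum>k\<in>A. \<Sum>l\<in>A. c k * cnj (c l) * (indicator {0..1} t *\<^sub>R cis (2 * pi * of_int (l - k) * t))))"
    by (simp only: of_real_mult sq sum_distrib_left) (simp add: scaleR_conv_of_real mult_ac)
  also have "\<dots> = (\<Sum>k\<in>A. \<Sum>l\<in>A. c k * cnj (c l) * (LINT t|lborel. indicator {0..1} t *\<^sub>R cis (2 * pi * of_int (l - k) * t)))"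
    by (simp only: Bochner_Integration.integral_sum Bochner_Integration.integrable_sum integrable_mult_right int integral_mult_right_zero)
  also have "\<dots> = (\<Sum>k\<in>A. \<Sum>l\<in>A. if l = k then c k * cnj (c l) else 0)"
    unfolding integral_cis_01 by (intro sum.cong refl) auto
  also have "\<dots> = complex_of_real (\<Sum>k\<in>A. (cmod (c k))\<^sup>2)"
    using assms by (simp add: complex_norm_square[symmetric])
  finally show ?thesis by (simp only: of_real_eq_iff)
qed

text \<open>Gallagher's form of the large sieve: on \<open>[\<theta>, \<theta> + \<delta>]\<close> integrate the derivative of
  \<open>(\<theta> + \<delta> - t) \<bar>S t\<bar>\<^sup>2\<close>. The modulation by the real number \<open>y\<close> does not change \<open>\<bar>S\<bar>\<close>,
  but centres the frequencies that the derivative brings down at \<open>y\<close>.\<close>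

lemma sobolev_point_bound:
  fixes b :: "int \<Rightarrow> complex" and w :: "int \<Rightarrow> real"
  assumes "finite A" "\<delta> > 0"
  defines "S \<equiv> \<lambda>t. \<Sum>k\<in>A. b k * cis (w k * t)" and "D \<equiv> \<lambda>t. \<Sum>k\<in>A. w k *\<^sub>R b k * cis (w k * t)"
  shows "(cmod (S \<theta>))\<^sup>2 \<le> (LINT t|lborel. indicator {\<theta>..\<theta> + \<delta>} t * (2 / \<delta> * (cmod (S t))\<^sup>2 + \<delta> * (cmod (D t))\<^sup>2))"
proof -
  define u where "u = (\<lambda>t. (cmod (S t))\<^sup>2)"
  \<comment> \<open>\<open>D\<close> is the derivative of \<open>S\<close> divided by the imaginary
    unit, so this is \<open>2 * Re (cnj (S t) * S' t)\<close>.\<close>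
  define u' where "u' = (\<lambda>t. 2 * (Im (S t) * Re (D t) - Re (S t) * Im (D t)))"
  have dRe: "((\<lambda>t. Re (S t)) has_real_derivative - Im (D t)) (at t)" for t
    unfolding S_def D_def by (auto intro!: derivative_eq_intros sum.cong simp: sum_negf[symmetric] algebra_simps)
  have dIm: "((\<lambda>t. Im (S t)) has_real_derivative Re (D t)) (at t)" for t
    unfolding S_def D_def by (auto intro!: derivative_eq_intros sum.cong simp: algebra_simps)
  have du: "(u has_real_derivative u' t) (at t)" for t
    unfolding u_def cmod_power2 u'_def
    by (rule derivative_eq_intros dRe dIm refl)+ (simp add: algebra_simps)
  have contS: "continuous_on UNIV S" "continuous_on UNIV D" unfolding S_def D_def
    by (intro continuous_intros continuous_on_cis_linear)+
  then have c: "isCont S t" "isCont D t" for t by (auto simp: continuous_on_eq_continuous_at)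
  then have c': "isCont (\<lambda>t. Re (S t)) t" "isCont (\<lambda>t. Im (S t)) t" "isCont (\<lambda>t. Re (D t)) t" "isCont (\<lambda>t. Im (D t)) t" for t
    by (intro isCont_Re isCont_Im; simp)+
  have cu: "isCont u t" "isCont u' t" for t unfolding u_def u'_def by (intro continuous_intros c c')+
  define g where "g = (\<lambda>t. 2 / \<delta> * (cmod (S t))\<^sup>2 + \<delta> * (cmod (D t))\<^sup>2)"
  have cg: "isCont g t" for t unfolding g_def by (intro continuous_intros c)
  define f where "f = (\<lambda>t. - u t + (\<theta> + \<delta> - t) * u' t)"
  have cf: "isCont f t" for t unfolding f_def by (intro continuous_intros cu)
  \<comment> \<open>The weight vanishes at the right end, so only the value at \<theta>
    survives.\<close>
  have fi: "(LINT t|lborel. f t * indicator {\<theta>..\<theta> + \<delta>} t) = (\<theta> + \<delta> - (\<theta> + \<delta>)) * u (\<theta> + \<delta>) - (\<theta> + \<delta> - \<theta>) * u \<theta>"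
  proof (rule integral_FTC_Icc_real)
    show "\<theta> \<le> \<theta> + \<delta>" using assms by simp
    show "((\<lambda>t. (\<theta> + \<delta> - t) * u t) has_real_derivative f x) (at x)" for x
      unfolding f_def by (auto intro!: derivative_eq_intros du)
  qed (rule cf)
  \<comment> \<open>The weight is at most \<delta> on the window. The product of
    \<open>cmod (S t)\<close> and \<open>cmod (D t)\<close> is split with parameter \<delta>, which
    explains the shape of \<open>g\<close>; one of its two units of \<open>1 / \<delta>\<close>
    stems from \<open>u\<close> itself.\<close>
  have bound: "- f t \<le> \<delta> * g t" if "\<theta> \<le> t" "t \<le> \<theta> + \<delta>" for t
  proof -
    have "\<bar>Im (cnj (S t) * D t)\<bar> \<le> cmod (S t) * cmod (D t)"
      using abs_Im_le_cmod[of "cnj (S t) * D t"] by (simp add: norm_mult)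
    then have "\<bar>u' t\<bar> \<le> 2 * (cmod (S t) * cmod (D t))" by (simp add: u'_def abs_if algebra_simps split: if_splits)
    also have "2 * (cmod (S t) * cmod (D t)) \<le> (cmod (S t))\<^sup>2 / \<delta> + \<delta> * (cmod (D t))\<^sup>2"
    proof -
      have "0 \<le> (cmod (S t) - \<delta> * cmod (D t))\<^sup>2 / \<delta>" using assms by simp
      then show ?thesis using assms by (simp add: power2_eq_square field_simps)
    qed
    finally have 1: "\<bar>u' t\<bar> \<le> (cmod (S t))\<^sup>2 / \<delta> + \<delta> * (cmod (D t))\<^sup>2" .
    have "- ((\<theta> + \<delta> - t) * u' t) \<le> (\<theta> + \<delta> - t) * \<bar>u' t\<bar>" using that
      by (metis abs_ge_minus_self abs_mult abs_of_nonneg diff_ge_0_iff_ge)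
    also have "\<dots> \<le> \<delta> * ((cmod (S t))\<^sup>2 / \<delta> + \<delta> * (cmod (D t))\<^sup>2)" using 1 that by (intro mult_mono) auto
    finally show ?thesis using assms by (simp add: f_def g_def u_def algebra_simps)
  qed
  have "\<delta> * u \<theta> = (LINT t|lborel. - f t * indicator {\<theta>..\<theta> + \<delta>} t)"
    using fi by simp
  also have "\<dots> \<le> (LINT t|lborel. \<delta> * (indicator {\<theta>..\<theta> + \<delta>} t * g t))"
  proof (rule integral_mono)
    have "integrable lborel (\<lambda>t. indicator {\<theta>..\<theta> + \<delta>} t *\<^sub>R f t)" "integrable lborel (\<lambda>t. indicator {\<theta>..\<theta> + \<delta>} t *\<^sub>R g t)"
      using cf cg by (auto intro!: borel_integrable_compact continuous_at_imp_continuous_on simp del: real_scaleR_def)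
    then show "integrable lborel (\<lambda>t. - f t * indicator {\<theta>..\<theta> + \<delta>} t)" "integrable lborel (\<lambda>t. \<delta> * (indicator {\<theta>..\<theta> + \<delta>} t * g t))"
      by (auto simp: mult.commute)
    show "- f t * indicator {\<theta>..\<theta> + \<delta>} t \<le> \<delta> * (indicator {\<theta>..\<theta> + \<delta>} t * g t)" for t
      using bound[of t] by (auto simp: indicator_def)
  qed
  also have "\<dots> = \<delta> * (LINT t|lborel. indicator {\<theta>..\<theta> + \<delta>} t * g t)" by simp
  finally show ?thesis using assms by (simp add: u_def g_def)
qed

text \<open>The windows \<open>[\<theta>, \<theta> + \<delta>]\<close> are disjoint and lie in one
  period, so the local bounds add up to an integral over \<open>[0, 1]\<close>, and Parseval
  evaluates it for both \<open>S\<close> and \<open>D\<close>. The free \<open>y\<close> will be the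
  centre of the block of \<open>k\<close> that matters.\<close>

lemma large_sieve:
  fixes b :: "int \<Rightarrow> complex"
  assumes "finite A" "finite \<Theta>" "\<delta> > 0"
    and \<Theta>: "\<And>\<theta>. \<theta> \<in> \<Theta> \<Longrightarrow> 0 \<le> \<theta> \<and> \<theta> + \<delta> \<le> 1"
    and sep: "\<And>\<theta> \<theta>'. \<theta> \<in> \<Theta> \<Longrightarrow> \<theta>' \<in> \<Theta> \<Longrightarrow> \<theta> < \<theta>' \<Longrightarrow> \<theta> + \<delta> < \<theta>'"
  shows "(\<Sum>\<theta>\<in>\<Theta>. (cmod (\<Sum>k\<in>A. b k * cis (- 2 * pi * of_int k * \<theta>)))\<^sup>2)
    \<le> (\<Sum>k\<in>A. (cmod (b k))\<^sup>2 * (2 + (2 * pi * (\<delta> * (y - of_int k)))\<^sup>2)) / \<delta>"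
proof -
  define w where "w = (\<lambda>k::int. 2 * pi * (y - of_int k))"
  define S D where "S = (\<lambda>t. \<Sum>k\<in>A. b k * cis (w k * t))" and "D = (\<lambda>t. \<Sum>k\<in>A. w k *\<^sub>R b k * cis (w k * t))"
  have mod: "cmod (\<Sum>k\<in>A. c k * cis (w k * t)) = cmod (\<Sum>k\<in>A. c k * cis (- 2 * pi * of_int k * t))" for c t
  proof -
    have "(\<Sum>k\<in>A. c k * cis (w k * t)) = cis (2 * pi * y * t) * (\<Sum>k\<in>A. c k * cis (- 2 * pi * of_int k * t))"
      unfolding sum_distrib_left by (rule sum.cong) (simp_all add: w_def cis_mult algebra_simps)
    then show ?thesis by (simp add: norm_mult)
  qed
  define g where "g = (\<lambda>t. 2 / \<delta> * (cmod (S t))\<^sup>2 + \<delta> * (cmod (D t))\<^sup>2)"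
  have contS: "continuous_on X S" "continuous_on X D" for X unfolding S_def D_def
    by (intro continuous_intros continuous_on_cis_linear)+
  have cg: "continuous_on X g" for X unfolding g_def by (intro continuous_intros contS)
  have ig: "integrable lborel (\<lambda>t. indicator {p..q} t * h t)" if "continuous_on {p..q} h" for p q and h :: "real \<Rightarrow> real"
  proof -
    have "integrable lborel (\<lambda>t. indicator {p..q} t *\<^sub>R h t)"
      using borel_integrable_compact[OF compact_Icc that] by simp
    then show ?thesis by simp
  qed
  have "(\<Sum>\<theta>\<in>\<Theta>. (cmod (\<Sum>k\<in>A. b k * cis (- 2 * pi * of_int k * \<theta>)))\<^sup>2) = (\<Sum>\<theta>\<in>\<Theta>. (cmod (S \<theta>))\<^sup>2)"
    by (simp add: S_def mod)
  also have "\<dots> \<le> (\<Sum>\<theta>\<in>\<Theta>. (LINT t|lborel. indicator {\<theta>..\<theta> + \<delta>} t * g t))"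
    unfolding g_def S_def D_def by (intro sum_mono sobolev_point_bound assms)
  also have "\<dots> = (LINT t|lborel. (\<Sum>\<theta>\<in>\<Theta>. indicator {\<theta>..\<theta> + \<delta>} t * g t))"
    by (intro Bochner_Integration.integral_sum[symmetric] ig cg)
  also have "\<dots> \<le> (LINT t|lborel. indicator {0..1} t * g t)"
  proof (rule integral_mono)
    fix t
    have g0: "g t \<ge> 0" using assms by (simp add: g_def)
    show "(\<Sum>\<theta>\<in>\<Theta>. indicator {\<theta>..\<theta> + \<delta>} t * g t) \<le> indicator {0..1} t * g t"
    proof (cases "\<exists>\<theta>\<in>\<Theta>. t \<in> {\<theta>..\<theta> + \<delta>}")
      case True
      then obtain \<theta> where \<theta>: "\<theta> \<in> \<Theta>" "t \<in> {\<theta>..\<theta> + \<delta>}" by blast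
      have "indicator {\<theta>'..\<theta>' + \<delta>} t = (0::real)" if "\<theta>' \<in> \<Theta> - {\<theta>}" for \<theta>'
        using sep[of \<theta> \<theta>'] sep[of \<theta>' \<theta>] that \<theta> by (cases "\<theta> < \<theta>'") (auto simp: indicator_def)
      then have "(\<Sum>\<theta>'\<in>\<Theta> - {\<theta>}. indicator {\<theta>'..\<theta>' + \<delta>} t * g t) = 0" by (intro sum.neutral) auto
      then have "(\<Sum>\<theta>\<in>\<Theta>. indicator {\<theta>..\<theta> + \<delta>} t * g t) = g t"
        using \<theta> by (simp add: sum.remove[OF assms(2) \<theta>(1)])
      moreover have "t \<in> {0..1}" using \<theta> \<Theta>[of \<theta>] by auto
      ultimately show ?thesis by simp
    next
      case False
      then have "(\<Sum>\<theta>\<in>\<Theta>. indicator {\<theta>..\<theta> + \<delta>} t * g t) = 0" by (intro sum.neutral) (auto simp: indicator_def)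
      then show ?thesis using g0 by simp
    qed
  qed (intro Bochner_Integration.integrable_sum ig cg)+
  also have "\<dots> = (LINT t|lborel. 2 / \<delta> * (indicator {0..1} t * (cmod (S t))\<^sup>2) + \<delta> * (indicator {0..1} t * (cmod (D t))\<^sup>2))"
    by (simp add: g_def algebra_simps)
  also have "\<dots> = 2 / \<delta> * (LINT t|lborel. indicator {0..1} t * (cmod (S t))\<^sup>2) + \<delta> * (LINT t|lborel. indicator {0..1} t * (cmod (D t))\<^sup>2)"
  proof -
    have "integrable lborel (\<lambda>t. indicator {0..1} t * (cmod (S t))\<^sup>2)" "integrable lborel (\<lambda>t. indicator {0..1} t * (cmod (D t))\<^sup>2)"
      by (intro ig continuous_intros contS)+
    then show ?thesis by simp
  qed
  also have "\<dots> = 2 / \<delta> * (\<Sum>k\<in>A. (cmod (b k))\<^sup>2) + \<delta> * (\<Sum>k\<in>A. (cmod (w k *\<^sub>R b k))\<^sup>2)"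
    unfolding S_def D_def mod parseval_01[OF assms(1)] ..
  also have "\<dots> = (\<Sum>k\<in>A. (cmod (b k))\<^sup>2 * (2 + (2 * pi * (\<delta> * (y - of_int k)))\<^sup>2)) / \<delta>"
  proof -
    have nw: "(cmod (w k *\<^sub>R b k))\<^sup>2 = (w k)\<^sup>2 * (cmod (b k))\<^sup>2" for k by (simp add: power_mult_distrib)
    show ?thesis using assms(3) unfolding nw sum_divide_distrib sum_distrib_left sum.distrib[symmetric]
      by (intro sum.cong refl) (simp add: w_def power_mult_distrib field_simps power2_eq_square)
  qed
  finally show ?thesis .
qed

section \<open>Sampling of band-limited functions\<close>

lemma powr_diff_le:
  fixes a b :: "'a::real_normed_vector"
  assumes "p > 0"
  shows "norm (a - b) powr p \<le> 2 powr p * (norm a powr p + norm b powr p)"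
proof -
  have "norm (a - b) \<le> 2 * max (norm a) (norm b)" using norm_triangle_ineq4[of a b] by linarith
  then have "norm (a - b) powr p \<le> (2 * max (norm a) (norm b)) powr p" using assms by (intro powr_mono2) auto
  also have "\<dots> = 2 powr p * (max (norm a) (norm b)) powr p" by (rule powr_mult)
  also have "\<dots> \<le> 2 powr p * (norm a powr p + norm b powr p)" by (intro mult_left_mono) (auto simp: max_def)
  finally show ?thesis .
qed

lemma Lp_space_diff:
  assumes "p > 0" "f \<in> Lp_space M p" "g \<in> Lp_space M p"
  shows "(\<lambda>x. f x - g x) \<in> Lp_space M p"
proof -
  have [measurable]: "f \<in> borel_measurable M" "g \<in> borel_measurable M"
    and i: "integrable M (\<lambda>x. norm (f x) powr p)" "integrable M (\<lambda>x. norm (g x) powr p)"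
    using assms by (auto simp: Lp_space_def)
  have "integrable M (\<lambda>x. norm (f x - g x) powr p)"
  proof (rule Bochner_Integration.integrable_bound)
    show "integrable M (\<lambda>x. 2 powr p * (norm (f x) powr p + norm (g x) powr p))" using i by simp
    show "AE x in M. norm (norm (f x - g x) powr p) \<le> norm (2 powr p * (norm (f x) powr p + norm (g x) powr p))"
      using powr_diff_le[OF assms(1)] by (intro AE_I2) (simp add: abs_of_nonneg)
  qed measurable
  then show ?thesis by (simp add: Lp_space_def)
qed

lemma Lp_tendsto_const:
  assumes "f \<in> Lp_space M p"
  shows "Lp_tendsto M p (\<lambda>_. f) f"
  using assms by (simp add: Lp_tendsto_def Lp_norm_def)

text \<open>On the domain the extension by density agrees almost everywhere with the operator: test
  \<open>density_ext\<close> with the constant sequence \<open>F\<close>.\<close>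

lemma multiplier_op_bound:
  assumes m: "Lp_multiplier p m B" and p: "p > 0" and F: "F \<in> multiplier_dom p m"
  shows "multiplier_op m F \<in> Lp_space lebesgue p"
    and "Lp_norm lebesgue p (multiplier_op m F) \<le> B * Lp_norm lebesgue p F"
proof -
  have FL: "F \<in> Lp_space lebesgue p" using F by (simp add: multiplier_dom_def)
  then obtain g where g: "density_ext lebesgue p (multiplier_dom p m) (multiplier_op m) F g"
      "Lp_norm lebesgue p g \<le> B * Lp_norm lebesgue p F"
    using m unfolding Lp_multiplier_def by blast
  define G where "G = multiplier_op m F"
  have "Lp_tendsto lebesgue p (\<lambda>_. G) g"
    using g(1) F Lp_tendsto_const[OF FL] unfolding density_ext_def G_def by auto
  then have G: "G \<in> Lp_space lebesgue p" "g \<in> Lp_space lebesgue p" "Lp_norm lebesgue p (\<lambda>x. G x - g x) = 0"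
    by (auto simp: Lp_tendsto_def LIMSEQ_const_iff)
  have d: "(\<lambda>x. G x - g x) \<in> Lp_space lebesgue p" by (rule Lp_space_diff[OF p G(1,2)])
  have [measurable]: "G \<in> borel_measurable lebesgue" "g \<in> borel_measurable lebesgue"
    using G by (auto simp: Lp_space_def)
  have "(LINT x|lebesgue. norm (G x - g x) powr p) = 0" using G(3) p by (simp add: Lp_norm_def)
  then have "AE x in lebesgue. norm (G x - g x) powr p = 0"
    using d by (subst (asm) integral_nonneg_eq_0_iff_AE) (auto simp: Lp_space_def)
  then have "AE x in lebesgue. norm (G x) powr p = norm (g x) powr p"
    by eventually_elim auto
  then have "(LINT x|lebesgue. norm (G x) powr p) = (LINT x|lebesgue. norm (g x) powr p)"
    by (intro integral_cong_AE) auto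
  then show "Lp_norm lebesgue p (multiplier_op m F) \<le> B * Lp_norm lebesgue p F"
    using g(2) by (simp add: Lp_norm_def G_def)
  show "multiplier_op m F \<in> Lp_space lebesgue p" using G by (simp add: G_def)
qed

lemma integrable_vp_kernel_abs_affine: "integrable lborel (\<lambda>x. \<bar>vp_kernel (y - x)\<bar>)"
  using lborel_integrable_real_affine[OF integrable_abs[OF vp_kernel_integrable], of "-1" y] by simp

lemma integral_vp_kernel_abs_affine: "(LINT x|lborel. \<bar>vp_kernel (y - x)\<bar>) = (LINT x|lborel. \<bar>vp_kernel x\<bar>)"
  using lborel_integral_real_affine[of "-1" "\<lambda>x. \<bar>vp_kernel x\<bar>" y] by simp

lemma borel_measurable_ident_lebesgue: "(\<lambda>x::'a::euclidean_space. x) \<in> borel_measurable lebesgue"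
  by (rule measurable_completion) simp

text \<open>\<open>h\<close> is only Lebesgue measurable, yet the result is Borel in
  \<open>x\<close>; this allows the later passage from \<open>lebesgue\<close> to
  \<open>lborel\<close>.\<close>

lemma borel_measurable_inv_fourier_R:
  assumes "h \<in> borel_measurable lebesgue"
  shows "inv_fourier_R h \<in> borel_measurable borel"
proof -
  interpret L: sigma_finite_measure "lebesgue :: real measure" by (rule sigma_finite_lebesgue)
  have c: "continuous_on UNIV (\<lambda>z::real\<times>real. cis (2 * pi * fst z * snd z))"
    unfolding cis_conv_exp by (intro continuous_intros)
  have cm: "(\<lambda>z::real\<times>real. cis (2 * pi * fst z * snd z)) \<in> borel_measurable (borel \<Otimes>\<^sub>M borel)"
    unfolding borel_prod by (rule borel_measurable_continuous_onI[OF c])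
  have "(\<lambda>x::real. x) \<in> lebesgue \<rightarrow>\<^sub>M borel" by (rule borel_measurable_ident_lebesgue)
  then have "(\<lambda>z. (fst z, snd z)) \<in> borel \<Otimes>\<^sub>M lebesgue \<rightarrow>\<^sub>M borel \<Otimes>\<^sub>M (borel :: real measure)"
    by (intro measurable_Pair measurable_fst measurable_compose[OF measurable_snd])
  from measurable_compose[OF this cm] have "(\<lambda>z. cis (2 * pi * fst z * snd z)) \<in> borel_measurable (borel \<Otimes>\<^sub>M (lebesgue :: real measure))"
    by (simp only: fst_conv snd_conv)
  moreover have "(\<lambda>z. h (snd z)) \<in> borel_measurable ((borel :: real measure) \<Otimes>\<^sub>M lebesgue)"
    using assms by measurable
  ultimately have "(\<lambda>z. h (snd z) * cis (2 * pi * fst z * snd z)) \<in> borel_measurable ((borel :: real measure) \<Otimes>\<^sub>M lebesgue)"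
    by (rule borel_measurable_times[rotated])
  then show ?thesis
    unfolding inv_fourier_R_def[abs_def] by (intro L.borel_measurable_lebesgue_integral) (simp add: case_prod_beta')
qed

lemma inv_fourier_R_bound: "cmod (inv_fourier_R h x) \<le> (LINT \<xi>|lebesgue. cmod (h \<xi>))"
proof -
  have "cmod (inv_fourier_R h x) \<le> (LINT \<xi>|lebesgue. cmod (h \<xi> * cis (2 * pi * x * \<xi>)))"
    unfolding inv_fourier_R_def by (rule integral_norm_bound)
  then show ?thesis by (simp add: norm_mult)
qed

text \<open>Convolution with the kernel multiplies \<open>h\<close> by a function that is 1 where
  \<open>h\<close> lives. Fubini applies since \<open>h\<close> and the kernel are both
  integrable.\<close>

lemma reproducing:
  assumes h: "integrable lebesgue h" and supp: "\<And>\<xi>. \<bar>\<xi>\<bar> > 1/2 \<Longrightarrow> h \<xi> = 0"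
  shows "inv_fourier_R h y = (LINT x|lborel. inv_fourier_R h x * vp_kernel (y - x))"
proof -
  interpret L: sigma_finite_measure "lebesgue :: real measure" by (rule sigma_finite_lebesgue)
  interpret P: pair_sigma_finite "lebesgue :: real measure" "lborel :: real measure" ..
  define K where "K = (\<lambda>\<xi> x. h \<xi> * cis (2 * pi * x * \<xi>) * complex_of_real (vp_kernel (y - x)))"
  have [measurable]: "h \<in> borel_measurable lebesgue" using h by simp
  have c: "continuous_on UNIV (\<lambda>z::real\<times>real. cis (2 * pi * snd z * fst z))"
    unfolding cis_conv_exp by (intro continuous_intros)
  have cm: "(\<lambda>z::real\<times>real. cis (2 * pi * snd z * fst z)) \<in> borel_measurable (borel \<Otimes>\<^sub>M borel)"
    unfolding borel_prod by (rule borel_measurable_continuous_onI[OF c])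
  have "(\<lambda>x::real. x) \<in> lebesgue \<rightarrow>\<^sub>M borel" "(\<lambda>x::real. x) \<in> lborel \<rightarrow>\<^sub>M borel"
    by (simp_all add: borel_measurable_ident_lebesgue)
  note i = this
  have "(\<lambda>z. (fst z, snd z)) \<in> (lebesgue :: real measure) \<Otimes>\<^sub>M lborel \<rightarrow>\<^sub>M borel \<Otimes>\<^sub>M (borel :: real measure)"
    by (rule measurable_Pair[OF measurable_compose[OF measurable_fst i(1)] measurable_compose[OF measurable_snd i(2)]])
  from measurable_compose[OF this cm] have [measurable]: "(\<lambda>z. cis (2 * pi * snd z * fst z)) \<in> borel_measurable (lebesgue \<Otimes>\<^sub>M (lborel :: real measure))"
    by (simp only: fst_conv snd_conv)
  have mK: "case_prod K \<in> borel_measurable (lebesgue \<Otimes>\<^sub>M lborel)"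
    unfolding K_def case_prod_beta' by measurable
  have e: "K \<xi> x = h \<xi> * (cis (2 * pi * \<xi> * x) * complex_of_real (vp_kernel (y - x)))" for \<xi> x
    by (simp add: K_def mult_ac)
  have i1: "integrable lborel (\<lambda>x. cis (2 * pi * \<xi> * x) * complex_of_real (vp_kernel (y - x)))" for \<xi>
  proof (rule Bochner_Integration.integrable_bound[OF integrable_vp_kernel_abs_affine[of y]])
    show "AE x in lborel. cmod (cis (2 * pi * \<xi> * x) * complex_of_real (vp_kernel (y - x))) \<le> norm \<bar>vp_kernel (y - x)\<bar>"
      by (simp add: norm_mult)
  qed measurable
  have iK: "integrable (lebesgue \<Otimes>\<^sub>M lborel) (case_prod K)"
  proof (rule P.Fubini_integrable[OF mK])
    have "(LINT x|lborel. norm (case_prod K (\<xi>, x))) = cmod (h \<xi>) * (LINT x|lborel. \<bar>vp_kernel x\<bar>)" for \<xi>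
      by (simp add: K_def norm_mult integral_vp_kernel_abs_affine)
    then show "integrable lebesgue (\<lambda>\<xi>. LINT x|lborel. norm (case_prod K (\<xi>, x)))"
      using h by simp
    show "AE \<xi> in lebesgue. integrable lborel (\<lambda>x. case_prod K (\<xi>, x))"
      using i1 by (simp add: e)
  qed
  have "(LINT x|lborel. inv_fourier_R h x * vp_kernel (y - x)) = (LINT x|lborel. LINT \<xi>|lebesgue. K \<xi> x)"
    unfolding inv_fourier_R_def K_def by simp
  also have "\<dots> = (LINT \<xi>|lebesgue. LINT x|lborel. K \<xi> x)"
    using P.Fubini_integral[OF iK] by simp
  also have "\<dots> = (LINT \<xi>|lebesgue. h \<xi> * cis (2 * pi * y * \<xi>))"
  proof (rule Bochner_Integration.integral_cong[OF refl])
    fix \<xi> :: real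
    show "(LINT x|lborel. K \<xi> x) = h \<xi> * cis (2 * pi * y * \<xi>)"
    proof (cases "\<bar>\<xi>\<bar> > 1/2")
      case True
      then show ?thesis by (simp add: K_def supp)
    next
      case False
      have "(LINT x|lborel. K \<xi> x) = h \<xi> * (LINT x|lborel. cis (2 * pi * \<xi> * x) * complex_of_real (vp_kernel (y - x)))"
        unfolding e by simp
      also have "(LINT x|lborel. cis (2 * pi * \<xi> * x) * complex_of_real (vp_kernel (y - x))) =
          (LINT x|lborel. cis (2 * pi * \<xi> * (y - x)) * complex_of_real (vp_kernel x))"
        using lborel_integral_real_affine[of "-1" "\<lambda>x. cis (2 * pi * \<xi> * x) * complex_of_real (vp_kernel (y - x))" y]
        by simp
      also have "\<dots> = (LINT x|lborel. cis (2 * pi * y * \<xi>) * (complex_of_real (vp_kernel x) * cis (- 2 * pi * x * \<xi>)))"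
        by (intro Bochner_Integration.integral_cong refl) (simp add: cis_mult mult_ac, simp add: algebra_simps)
      also have "\<dots> = cis (2 * pi * y * \<xi>)"
        using False by (simp only: integral_mult_right_zero vp_kernel_fourier) simp
      finally show ?thesis .
    qed
  qed
  also have "\<dots> = inv_fourier_R h y" by (simp add: inv_fourier_R_def)
  finally show ?thesis by simp
qed

text \<open>Jensen's inequality for the weight \<open>\<bar>vp_kernel (y - x)\<bar>\<close> turns
  the reproducing formula into a bound for a power at one point. Summed over the samples, for each
  \<open>x\<close> the kernel is evaluated on a grid of step \<epsilon>, where its total is of order
  \<open>1 / \<epsilon>\<close>. The \<open>obtains\<close> form fixes \<open>C\<close> before
  \<open>h\<close> and \<epsilon>.\<close>

lemma sampling:
  obtains C where "C \<ge> 0"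
    "\<And>h \<epsilon> N. integrable lebesgue h \<Longrightarrow> (\<And>\<xi>. \<bar>\<xi>\<bar> > 1/2 \<Longrightarrow> h \<xi> = 0) \<Longrightarrow>
      integrable lborel (\<lambda>x. cmod (inv_fourier_R h x) ^ Suc n) \<Longrightarrow> 0 < \<epsilon> \<Longrightarrow> \<epsilon> \<le> 1 \<Longrightarrow> finite N \<Longrightarrow>
      (\<Sum>j\<in>N. cmod (inv_fourier_R h (\<epsilon> * of_int j)) ^ Suc n) \<le> C / \<epsilon> * (LINT x|lborel. cmod (inv_fourier_R h x) ^ Suc n)"
proof -
  obtain A where A: "A > 0" "\<And>x. \<bar>vp_kernel x\<bar> \<le> A * decay x" using vp_kernel_bound by blast
  define W where "W = (LINT x|lborel. \<bar>vp_kernel x\<bar>)"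
  define J where "J = (LINT x|lborel. decay x)"
  have W: "W \<ge> 0" and J: "J \<ge> 0" unfolding W_def J_def by (simp_all add: integral_nonneg_AE)
  show thesis
  proof (rule that[of "W ^ n * (A * (3 * J))"])
    show "W ^ n * (A * (3 * J)) \<ge> 0" using W J A by simp
    fix h :: "real \<Rightarrow> complex" and \<epsilon> :: real and N :: "int set"
    assume h: "integrable lebesgue h" "\<And>\<xi>. \<bar>\<xi>\<bar> > 1/2 \<Longrightarrow> h \<xi> = 0"
      and ip: "integrable lborel (\<lambda>x. cmod (inv_fourier_R h x) ^ Suc n)" and \<epsilon>: "0 < \<epsilon>" "\<epsilon> \<le> 1" and N: "finite N"
    define G where "G = inv_fourier_R h"
    have [measurable]: "G \<in> borel_measurable borel" unfolding G_def
      by (rule borel_measurable_inv_fourier_R) (use h in simp)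
    define H where "H = (LINT \<xi>|lebesgue. cmod (h \<xi>))"
    have GH: "cmod (G x) \<le> H" for x unfolding G_def H_def by (rule inv_fourier_R_bound)
    have iy: "integrable lborel (\<lambda>x. cmod (G x) ^ q * \<bar>vp_kernel (y - x)\<bar>)" for q y
    proof (rule Bochner_Integration.integrable_bound[OF integrable_mult_right[OF integrable_vp_kernel_abs_affine[of y], of "H ^ q"]])
      have "cmod (G x) ^ q \<le> \<bar>H ^ q\<bar>" for x using power_mono[OF GH[of x], of q] by simp
      then show "AE x in lborel. norm (cmod (G x) ^ q * \<bar>vp_kernel (y - x)\<bar>) \<le> norm (H ^ q * \<bar>vp_kernel (y - x)\<bar>)"
        by (intro AE_I2) (simp add: abs_mult mult_right_mono)
    qed measurable
    have pt: "cmod (G y) ^ Suc n \<le> W ^ n * (LINT x|lborel. cmod (G x) ^ Suc n * \<bar>vp_kernel (y - x)\<bar>)" for y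
    proof -
      have "cmod (G y) \<le> (LINT x|lborel. cmod (G x * vp_kernel (y - x)))"
        unfolding G_def by (subst reproducing[OF h]) (simp, rule integral_norm_bound)
      then have "cmod (G y) ^ Suc n \<le> (LINT x|lborel. cmod (G x) * \<bar>vp_kernel (y - x)\<bar>) ^ Suc n"
        by (intro power_mono) (simp_all add: norm_mult)
      also have "\<dots> \<le> (LINT x|lborel. \<bar>vp_kernel (y - x)\<bar>) ^ n * (LINT x|lborel. cmod (G x) ^ Suc n * \<bar>vp_kernel (y - x)\<bar>)"
        using iy[of 1 y] iy[of "Suc n" y] integrable_vp_kernel_abs_affine[of y]
        by (intro power_integral_le) simp_all
      finally show ?thesis by (simp only: integral_vp_kernel_abs_affine W_def)
    qed
    have "(\<Sum>j\<in>N. cmod (G (\<epsilon> * of_int j)) ^ Suc n) \<le> (\<Sum>j\<in>N. W ^ n * (LINT x|lborel. cmod (G x) ^ Suc n * \<bar>vp_kernel (\<epsilon> * of_int j - x)\<bar>))"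
      by (intro sum_mono pt)
    also have "\<dots> = W ^ n * (LINT x|lborel. (\<Sum>j\<in>N. cmod (G x) ^ Suc n * \<bar>vp_kernel (\<epsilon> * of_int j - x)\<bar>))"
      using iy by (simp add: sum_distrib_left del: power_Suc)
    also have "\<dots> \<le> W ^ n * (LINT x|lborel. cmod (G x) ^ Suc n * (A * (3 * J / \<epsilon>)))"
    proof (intro mult_left_mono integral_mono)
      fix x
      have "(\<Sum>j\<in>N. \<bar>vp_kernel (\<epsilon> * of_int j - x)\<bar>) \<le> (\<Sum>j\<in>N. A * decay (x - \<epsilon> * of_int j))"
        using A(2) by (intro sum_mono) (simp add: decay_minus[of x])
      also have "\<dots> \<le> A * (3 * J / \<epsilon>)"
        unfolding sum_distrib_left[symmetric] J_def using A by (intro mult_left_mono sum_decay_le N \<epsilon>) auto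
      finally show "(\<Sum>j\<in>N. cmod (G x) ^ Suc n * \<bar>vp_kernel (\<epsilon> * of_int j - x)\<bar>) \<le> cmod (G x) ^ Suc n * (A * (3 * J / \<epsilon>))"
        unfolding sum_distrib_left[symmetric] by (intro mult_left_mono) auto
    qed (use W ip iy in \<open>auto simp: G_def simp del: power_Suc\<close>)
    also have "\<dots> = W ^ n * (A * (3 * J)) / \<epsilon> * (LINT x|lborel. cmod (G x) ^ Suc n)"
      by (simp add: mult_ac)
    finally show "(\<Sum>j\<in>N. cmod (inv_fourier_R h (\<epsilon> * of_int j)) ^ Suc n) \<le> W ^ n * (A * (3 * J)) / \<epsilon> * (LINT x|lborel. cmod (inv_fourier_R h x) ^ Suc n)"
      by (simp add: G_def)
  qed
qed

section \<open>The multiplier applied to wave packets\<close>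

lemma integrable_compact_support_mult:
  fixes m g :: "real \<Rightarrow> complex"
  assumes m: "bounded (range m)" "m \<in> borel_measurable lebesgue" "\<And>x. \<bar>x\<bar> > 1/2 \<Longrightarrow> m x = 0"
    and g: "g \<in> borel_measurable lebesgue" "\<And>x. cmod (g x) \<le> c"
  shows "integrable lebesgue (\<lambda>x. m x * g x)"
proof -
  obtain M where M: "\<And>x. cmod (m x) \<le> M" using m(1) by (auto simp: bounded_iff)
  have [measurable]: "m \<in> borel_measurable lebesgue" "g \<in> borel_measurable lebesgue" using m g by auto
  show ?thesis
  proof (rule Bochner_Integration.integrable_bound)
    show "integrable lebesgue (\<lambda>x::real. indicator {-1/2..1/2} x * (M * c))"
      by (intro integrable_mult_left integrable_real_indicator) auto
    have "cmod (m x * g x) \<le> norm (indicator {-1/2..1/2} x * (M * c))" for x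
    proof (cases "\<bar>x\<bar> > 1/2")
      case True then show ?thesis by (simp add: m(3))
    next
      case False
      have M0: "0 \<le> M" using order_trans[OF norm_ge_zero M[of 0]] .
      then have "cmod (m x) * cmod (g x) \<le> M * c" using M g(2) by (intro mult_mono) auto
      moreover have "x \<in> {-1/2..1/2}" using False by auto
      ultimately show ?thesis by (simp add: norm_mult)
    qed
    then show "AE x in lebesgue. cmod (m x * g x) \<le> norm (indicator {-1/2..1/2} x * (M * c))" by simp
  qed measurable
qed

lemma vp_kernel_fourier_affine:
  assumes "\<bar>\<xi>\<bar> \<le> 1/2"
  shows "(LINT x|lborel. complex_of_real (vp_kernel (x - a)) * cis (- 2 * pi * x * \<xi>)) = cis (- 2 * pi * a * \<xi>)"
proof -
  have "(LINT x|lborel. complex_of_real (vp_kernel (x - a)) * cis (- 2 * pi * x * \<xi>)) =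
      (LINT x|lborel. complex_of_real (vp_kernel x) * cis (- 2 * pi * (a + x) * \<xi>))"
    using lborel_integral_real_affine[of 1 "\<lambda>x. complex_of_real (vp_kernel (x - a)) * cis (- 2 * pi * x * \<xi>)" a] by simp
  also have "\<dots> = (LINT x|lborel. cis (- 2 * pi * a * \<xi>) * (complex_of_real (vp_kernel x) * cis (- 2 * pi * x * \<xi>)))"
    by (intro Bochner_Integration.integral_cong refl) (simp add: cis_mult mult_ac, simp add: algebra_simps)
  also have "\<dots> = cis (- 2 * pi * a * \<xi>)"
    using assms by (simp only: integral_mult_right_zero vp_kernel_fourier) simp
  finally show ?thesis .
qed

lemma integrable_vp_kernel_cis_affine:
  "integrable lborel (\<lambda>x. complex_of_real (vp_kernel (x - a)) * cis (c * x))"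
proof (rule Bochner_Integration.integrable_bound)
  show "integrable lborel (\<lambda>x. vp_kernel (x - a))"
    using lborel_integrable_real_affine[OF vp_kernel_integrable, of 1 "-a"] by simp
  show "AE x in lborel. cmod (complex_of_real (vp_kernel (x - a)) * cis (c * x)) \<le> norm (vp_kernel (x - a))"
    by (simp add: norm_mult)
qed measurable

text \<open>The successor matters: \<open>0 powr 0\<close> is 0 while \<open>0 ^ 0\<close> is 1.
  Hence exponents are written \<open>Suc n\<close> throughout.\<close>

lemma powr_Suc: "(y::real) \<ge> 0 \<Longrightarrow> y powr real (Suc n) = y ^ Suc n"
  by (rule powr_realpow') auto

lemma Lp_norm_power: "Lp_norm M (real (Suc n)) f ^ Suc n = (LINT x|M. norm (f x) ^ Suc n)"
proof -
  define I where "I = (LINT x|M. norm (f x) ^ Suc n)"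
  have I: "I \<ge> 0" unfolding I_def by (intro integral_nonneg_AE) simp
  have "Lp_norm M (real (Suc n)) f = I powr (1 / real (Suc n))"
    unfolding Lp_norm_def I_def by (simp only: powr_Suc norm_ge_zero)
  then have "Lp_norm M (real (Suc n)) f ^ Suc n = (I powr (1 / real (Suc n))) powr real (Suc n)"
    by (simp only: powr_Suc powr_ge_zero)
  also have "\<dots> = I" using I by (simp only: powr_powr) simp
  finally show ?thesis by (simp only: I_def)
qed

locale band_multiplier =
  fixes m :: "real \<Rightarrow> complex" and B :: real and n :: nat
  assumes mult: "Lp_multiplier (real (Suc n)) m B" and supp: "\<And>x. \<bar>x\<bar> > 1/2 \<Longrightarrow> m x = 0"
begin

lemma m_bounded: "bounded (range m)" and m_measurable[measurable]: "m \<in> borel_measurable lebesgue"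
  using mult by (auto simp: Lp_multiplier_def)

lemma integrable_m_mult:
  assumes "g \<in> borel_measurable lebesgue" "\<And>x. cmod (g x) \<le> c"
  shows "integrable lebesgue (\<lambda>x. m x * g x)"
  using m_bounded m_measurable supp assms by (rule integrable_compact_support_mult)

lemma cis_measurable_lebesgue[measurable]: "(\<lambda>x::real. cis (c * x)) \<in> borel_measurable lebesgue"
  by (rule measurable_completion) simp

text \<open>The test function on the line to which the multiplier hypothesis is applied;
  \<open>d\<close> will carry the values of \<open>f\<close>, the modulations and the signs.\<close>

definition packet :: "int set \<Rightarrow> (int \<Rightarrow> complex) \<Rightarrow> real \<Rightarrow> real \<Rightarrow> complex"
  where "packet A d \<epsilon> x = (\<Sum>k\<in>A. d k * complex_of_real (vp_kernel (x - \<epsilon> * of_int k)))"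

text \<open>The trigonometric sum agrees with the Fourier transform of \<open>packet\<close> only on
  \<open>[-1/2, 1/2]\<close>, but \<open>m\<close> vanishes elsewhere, so the product is right
  everywhere.\<close>

definition symbol :: "int set \<Rightarrow> (int \<Rightarrow> complex) \<Rightarrow> real \<Rightarrow> real \<Rightarrow> complex"
  where "symbol A d \<epsilon> \<xi> = m \<xi> * (\<Sum>k\<in>A. d k * cis (- 2 * pi * (\<epsilon> * of_int k) * \<xi>))"

lemma symbol_supp: "\<bar>\<xi>\<bar> > 1/2 \<Longrightarrow> symbol A d \<epsilon> \<xi> = 0" by (simp add: symbol_def supp)

lemma packet_measurable[measurable]: "packet A d \<epsilon> \<in> borel_measurable borel"
  unfolding packet_def[abs_def] by measurable

lemma symbol_integrable: "integrable lebesgue (symbol A d \<epsilon>)"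
  unfolding symbol_def
proof (rule integrable_m_mult)
  show "cmod (\<Sum>k\<in>A. d k * cis (- 2 * pi * (\<epsilon> * of_int k) * \<xi>)) \<le> (\<Sum>k\<in>A. cmod (d k))" for \<xi>
    by (rule sum_norm_le) (simp add: norm_mult)
qed measurable

lemma inv_fourier_symbol:
  "inv_fourier_R (symbol A d \<epsilon>) x = (\<Sum>k\<in>A. d k * inv_fourier_R m (x - \<epsilon> * of_int k))"
proof -
  have i: "integrable lebesgue (\<lambda>\<xi>. m \<xi> * cis (2 * pi * y * \<xi>))" for y
    by (rule integrable_m_mult[where c = 1]) auto
  have "inv_fourier_R (symbol A d \<epsilon>) x = (LINT \<xi>|lebesgue. (\<Sum>k\<in>A. d k * (m \<xi> * cis (2 * pi * (x - \<epsilon> * of_int k) * \<xi>))))"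
    unfolding inv_fourier_R_def symbol_def sum_distrib_left sum_distrib_right
    by (intro Bochner_Integration.integral_cong refl sum.cong) (simp add: cis_mult mult_ac, simp add: algebra_simps)
  also have "\<dots> = (\<Sum>k\<in>A. d k * (LINT \<xi>|lebesgue. m \<xi> * cis (2 * pi * (x - \<epsilon> * of_int k) * \<xi>)))"
    using i by simp
  finally show ?thesis by (simp add: inv_fourier_R_def)
qed

lemma fourier_packet:
  assumes "\<bar>\<xi>\<bar> \<le> 1/2"
  shows "fourier_R (packet A d \<epsilon>) \<xi> = (\<Sum>k\<in>A. d k * cis (- 2 * pi * (\<epsilon> * of_int k) * \<xi>))"
proof -
  have i: "integrable lborel (\<lambda>x. complex_of_real (vp_kernel (x - a)) * cis (- 2 * pi * x * \<xi>))" for a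
    using integrable_vp_kernel_cis_affine[of a "- 2 * pi * \<xi>"] by (simp add: mult_ac)
  have "fourier_R (packet A d \<epsilon>) \<xi> = (LINT x|lborel. packet A d \<epsilon> x * cis (- 2 * pi * x * \<xi>))"
    unfolding fourier_R_def
  proof (rule integral_completion)
    have "(\<lambda>x. packet A d \<epsilon> x * cis (- 2 * pi * \<xi> * x)) \<in> borel_measurable lborel" by measurable
    then show "(\<lambda>x. packet A d \<epsilon> x * cis (- 2 * pi * x * \<xi>)) \<in> borel_measurable lborel"
      by (simp add: mult_ac)
  qed
  also have "\<dots> = (LINT x|lborel. (\<Sum>k\<in>A. d k * (complex_of_real (vp_kernel (x - \<epsilon> * of_int k)) * cis (- 2 * pi * x * \<xi>))))"
    by (simp add: packet_def sum_distrib_right mult.assoc)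
  also have "\<dots> = (\<Sum>k\<in>A. d k * (LINT x|lborel. complex_of_real (vp_kernel (x - \<epsilon> * of_int k)) * cis (- 2 * pi * x * \<xi>)))"
    using i by (simp only: Bochner_Integration.integral_sum Bochner_Integration.integrable_sum integrable_mult_right integral_mult_right_zero)
  finally show ?thesis unfolding vp_kernel_fourier_affine[OF assms] .
qed

lemma packet_integrable: "integrable lborel (packet A d \<epsilon>)"
proof -
  have "integrable lborel (\<lambda>x. complex_of_real (vp_kernel (x - a)))" for a
    using lborel_integrable_real_affine[OF vp_kernel_integrable, of 1 "-a"] by simp
  then show ?thesis unfolding packet_def[abs_def] by simp
qed

lemma packet_power_integrable: "integrable lborel (\<lambda>x. cmod (packet A d \<epsilon> x) ^ Suc n)"
proof -
  obtain C where C: "C > 0" "\<And>x. \<bar>vp_kernel x\<bar> \<le> C * decay x" using vp_kernel_bound by blast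
  define M where "M = (\<Sum>k\<in>A. cmod (d k) * C)"
  have "\<bar>vp_kernel x\<bar> \<le> C" for x
    using C(2)[of x] mult_left_mono[OF decay_le_1[of x], of C] C(1) by linarith
  then have M: "cmod (packet A d \<epsilon> x) \<le> M" for x
    unfolding packet_def M_def by (intro sum_norm_le) (simp add: norm_mult mult_left_mono)
  show ?thesis
  proof (rule Bochner_Integration.integrable_bound)
    show "integrable lborel (\<lambda>x. M ^ n * cmod (packet A d \<epsilon> x))" using packet_integrable by simp
    have "cmod (packet A d \<epsilon> x) ^ n * cmod (packet A d \<epsilon> x) \<le> M ^ n * cmod (packet A d \<epsilon> x)" for x
      using M by (intro mult_right_mono power_mono) auto
    moreover have "0 \<le> M" using order_trans[OF norm_ge_zero M[of 0]] .
    ultimately show "AE x in lborel. norm (cmod (packet A d \<epsilon> x) ^ Suc n) \<le> norm (M ^ n * cmod (packet A d \<epsilon> x))"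
      by (intro AE_I2) (simp add: mult.commute)
  qed measurable
qed

lemma multiplier_op_packet: "multiplier_op m (packet A d \<epsilon>) = inv_fourier_R (symbol A d \<epsilon>)"
proof -
  have "m \<xi> * fourier_R (packet A d \<epsilon>) \<xi> = symbol A d \<epsilon> \<xi>" for \<xi>
    by (cases "\<bar>\<xi>\<bar> > 1/2") (simp_all add: supp symbol_def fourier_packet)
  then show ?thesis by (simp add: multiplier_op_def)
qed

lemma packet_in_dom: "packet A d \<epsilon> \<in> multiplier_dom (real (Suc n)) m"
proof -
  have "packet A d \<epsilon> \<in> borel_measurable lebesgue" by (rule measurable_completion) simp
  moreover have "integrable lebesgue (\<lambda>x. cmod (packet A d \<epsilon> x) ^ Suc n)"
    using packet_power_integrable by (subst integrable_completion) auto
  moreover have "integrable lebesgue (packet A d \<epsilon>)"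
    using packet_integrable by (subst integrable_completion) auto
  moreover have "m \<xi> * fourier_R (packet A d \<epsilon>) \<xi> = symbol A d \<epsilon> \<xi>" for \<xi>
    by (cases "\<bar>\<xi>\<bar> > 1/2") (simp_all add: supp symbol_def fourier_packet)
  ultimately show ?thesis
    using symbol_integrable[of A d \<epsilon>] by (simp add: multiplier_dom_def Lp_space_def powr_Suc del: of_nat_Suc power_Suc)
qed

lemma inv_fourier_symbol_bound:
  shows "integrable lborel (\<lambda>x. cmod (inv_fourier_R (symbol A d \<epsilon>) x) ^ Suc n)"
    and "(LINT x|lborel. cmod (inv_fourier_R (symbol A d \<epsilon>) x) ^ Suc n) \<le> \<bar>B\<bar> ^ Suc n * (LINT x|lborel. cmod (packet A d \<epsilon> x) ^ Suc n)"
proof -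
  let ?G = "inv_fourier_R (symbol A d \<epsilon>)"
  have [measurable]: "?G \<in> borel_measurable borel"
    by (rule borel_measurable_inv_fourier_R) (use symbol_integrable in simp)
  have "?G \<in> Lp_space lebesgue (real (Suc n))"
    using multiplier_op_bound(1)[OF mult _ packet_in_dom] by (simp add: multiplier_op_packet)
  then have "integrable lebesgue (\<lambda>x. cmod (?G x) ^ Suc n)"
    by (simp add: Lp_space_def powr_Suc del: of_nat_Suc power_Suc)
  then show "integrable lborel (\<lambda>x. cmod (?G x) ^ Suc n)"
    by (subst (asm) integrable_completion) auto
  have "Lp_norm lebesgue (real (Suc n)) ?G \<le> B * Lp_norm lebesgue (real (Suc n)) (packet A d \<epsilon>)"
    using multiplier_op_bound(2)[OF mult _ packet_in_dom, of A d \<epsilon>] by (simp add: multiplier_op_packet)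
  \<comment> \<open>\<open>Lp_multiplier\<close> does not state \<open>B \<ge> 0\<close>; the
    absolute value yields a factor that is visibly nonnegative.\<close>
  also have "\<dots> \<le> \<bar>B\<bar> * Lp_norm lebesgue (real (Suc n)) (packet A d \<epsilon>)"
    by (intro mult_right_mono) (auto simp: Lp_norm_def)
  finally have "Lp_norm lebesgue (real (Suc n)) ?G ^ Suc n \<le> (\<bar>B\<bar> * Lp_norm lebesgue (real (Suc n)) (packet A d \<epsilon>)) ^ Suc n"
    by (intro power_mono) (auto simp: Lp_norm_def)
  then have "(LINT x|lebesgue. cmod (?G x) ^ Suc n) \<le> \<bar>B\<bar> ^ Suc n * (LINT x|lebesgue. cmod (packet A d \<epsilon> x) ^ Suc n)"
    unfolding power_mult_distrib Lp_norm_power .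
  then show "(LINT x|lborel. cmod (?G x) ^ Suc n) \<le> \<bar>B\<bar> ^ Suc n * (LINT x|lborel. cmod (packet A d \<epsilon> x) ^ Suc n)"
    by (simp add: integral_completion del: power_Suc)
qed

end

section \<open>The square function of a finitely supported sequence\<close>

text \<open>The large sieve is used with window length \<epsilon> and centre
  \<open>y = x / \<epsilon>\<close>. Its weight is then
  \<open>2 + (2 * pi * (x - \<epsilon> * k))\<^sup>2\<close>, a multiple of \<open>1 / decay\<close>
  at most, which uses up one of the two factors \<open>decay\<close> in the squared kernel.\<close>

lemma packet_square_function:
  fixes j :: nat
  obtains C where "C \<ge> 0"
    "\<And>f A \<Theta> \<epsilon> x. finite A \<Longrightarrow> finite \<Theta> \<Longrightarrow> 0 < \<epsilon> \<Longrightarrow> \<epsilon> \<le> 1 \<Longrightarrow> (\<And>\<theta>. \<theta> \<in> \<Theta> \<Longrightarrow> 0 \<le> \<theta> \<and> \<theta> + \<epsilon> \<le> 1) \<Longrightarrow>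
      (\<And>\<theta> \<theta>'. \<theta> \<in> \<Theta> \<Longrightarrow> \<theta>' \<in> \<Theta> \<Longrightarrow> \<theta> < \<theta>' \<Longrightarrow> \<theta> + \<epsilon> < \<theta>') \<Longrightarrow>
      (\<Sum>\<theta>\<in>\<Theta>. (cmod (\<Sum>k\<in>A. (f k * complex_of_real (vp_kernel (x - \<epsilon> * of_int k))) * cis (- 2 * pi * of_int k * \<theta>)))\<^sup>2) ^ Suc j
      \<le> C / \<epsilon> ^ Suc (2 * j) * (\<Sum>k\<in>A. cmod (f k) ^ (2 * Suc j) * decay (x - \<epsilon> * of_int k))"
proof -
  obtain C where C: "C > 0" "\<And>x. \<bar>vp_kernel x\<bar> \<le> C * decay x" using vp_kernel_bound by blast
  define J where "J = (LINT x|lborel. decay x)"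
  have J: "J \<ge> 0" unfolding J_def by (simp add: integral_nonneg_AE)
  define D where "D = C\<^sup>2 * (2 * pi)\<^sup>2"
  have D: "D \<ge> 0" by (simp add: D_def)
  show thesis
  proof (rule that[of "D ^ Suc j * (3 * J) ^ j"])
    show "D ^ Suc j * (3 * J) ^ j \<ge> 0" using D J by simp
    fix f :: "int \<Rightarrow> complex" and A :: "int set" and \<Theta> :: "real set" and \<epsilon> x :: real
    assume A: "finite A" and T: "finite \<Theta>" and \<epsilon>: "0 < \<epsilon>" "\<epsilon> \<le> 1" and sep: "\<And>\<theta>. \<theta> \<in> \<Theta> \<Longrightarrow> 0 \<le> \<theta> \<and> \<theta> + \<epsilon> \<le> 1"
      "\<And>\<theta> \<theta>'. \<theta> \<in> \<Theta> \<Longrightarrow> \<theta>' \<in> \<Theta> \<Longrightarrow> \<theta> < \<theta>' \<Longrightarrow> \<theta> + \<epsilon> < \<theta>'"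
    define w where "w = (\<lambda>k::int. decay (x - \<epsilon> * of_int k))"
    define b where "b = (\<lambda>k. f k * complex_of_real (vp_kernel (x - \<epsilon> * of_int k)))"
    have pt: "(cmod (b k))\<^sup>2 * (2 + (2 * pi * (\<epsilon> * (x / \<epsilon> - of_int k)))\<^sup>2) \<le> D * ((cmod (f k))\<^sup>2 * w k)" for k
    proof -
      define y where "y = x - \<epsilon> * of_int k"
      have y: "\<epsilon> * (x / \<epsilon> - of_int k) = y" using \<epsilon> by (simp add: y_def field_simps)
      have "(vp_kernel y)\<^sup>2 \<le> (C * decay y)\<^sup>2" using C(2)[of y] by (rule power2_le_iff_abs_le[THEN iffD2, rotated]) (use C in simp)
      then have "(cmod (b k))\<^sup>2 \<le> (cmod (f k))\<^sup>2 * (C * decay y)\<^sup>2"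
        by (simp add: b_def y_def[symmetric] norm_mult power_mult_distrib mult_left_mono)
      moreover have "2 + (2 * pi * y)\<^sup>2 \<le> (2 * pi)\<^sup>2 * (1 + y\<^sup>2)"
      proof -
        have "2\<^sup>2 \<le> (2 * pi)\<^sup>2" using pi_ge_two by (intro power_mono) auto
        then show ?thesis by (simp add: power_mult_distrib algebra_simps)
      qed
      ultimately have "(cmod (b k))\<^sup>2 * (2 + (2 * pi * y)\<^sup>2) \<le> ((cmod (f k))\<^sup>2 * (C * decay y)\<^sup>2) * ((2 * pi)\<^sup>2 * (1 + y\<^sup>2))"
        by (intro mult_mono) auto
      also have "\<dots> = D * ((cmod (f k))\<^sup>2 * decay y) * (decay y * (1 + y\<^sup>2))"
        by (simp add: D_def power_mult_distrib power2_eq_square)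
      also have "decay y * (1 + y\<^sup>2) = 1"
        using add_pos_nonneg[of 1 "y\<^sup>2"] by (simp add: decay_def)
      finally show ?thesis by (simp add: y w_def y_def[symmetric])
    qed
    have "(\<Sum>\<theta>\<in>\<Theta>. (cmod (\<Sum>k\<in>A. b k * cis (- 2 * pi * of_int k * \<theta>)))\<^sup>2)
        \<le> (\<Sum>k\<in>A. (cmod (b k))\<^sup>2 * (2 + (2 * pi * (\<epsilon> * (x / \<epsilon> - of_int k)))\<^sup>2)) / \<epsilon>"
      by (rule large_sieve[OF A T \<epsilon>(1) sep])
    also have "\<dots> \<le> (\<Sum>k\<in>A. D * ((cmod (f k))\<^sup>2 * w k)) / \<epsilon>"
      using \<epsilon> by (intro divide_right_mono sum_mono pt) auto
    also have "\<dots> = D / \<epsilon> * (\<Sum>k\<in>A. (cmod (f k))\<^sup>2 * w k)"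
      by (simp add: sum_distrib_left sum_divide_distrib)
    finally have "(\<Sum>\<theta>\<in>\<Theta>. (cmod (\<Sum>k\<in>A. b k * cis (- 2 * pi * of_int k * \<theta>)))\<^sup>2) ^ Suc j \<le> (D / \<epsilon> * (\<Sum>k\<in>A. (cmod (f k))\<^sup>2 * w k)) ^ Suc j"
      by (rule power_mono) (simp add: sum_nonneg)
    also have "\<dots> = (D / \<epsilon>) ^ Suc j * (\<Sum>k\<in>A. (cmod (f k))\<^sup>2 * w k) ^ Suc j" by (rule power_mult_distrib)
    \<comment> \<open>Jensen with the remaining weights \<open>w\<close>, of total mass at most
      \<open>3 * J / \<epsilon>\<close>: this adds \<open>j\<close> powers of
      \<open>1 / \<epsilon>\<close> to the \<open>Suc j\<close> already present.\<close>
    also have "\<dots> \<le> (D / \<epsilon>) ^ Suc j * ((\<Sum>k\<in>A. w k) ^ j * (\<Sum>k\<in>A. ((cmod (f k))\<^sup>2) ^ Suc j * w k))"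
      using D \<epsilon> A by (intro mult_left_mono power_sum_le) (auto simp: w_def)
    also have "\<dots> \<le> (D / \<epsilon>) ^ Suc j * ((3 * J / \<epsilon>) ^ j * (\<Sum>k\<in>A. ((cmod (f k))\<^sup>2) ^ Suc j * w k))"
    proof -
      have "(\<Sum>k\<in>A. w k) \<le> 3 * J / \<epsilon>" unfolding w_def J_def by (rule sum_decay_le[OF A \<epsilon>])
      then show ?thesis using D \<epsilon>
        by (intro mult_left_mono mult_right_mono power_mono sum_nonneg) (auto simp: w_def sum_nonneg)
    qed
    also have "\<dots> = (D ^ Suc j * (3 * J) ^ j) / \<epsilon> ^ Suc (2 * j) * (\<Sum>k\<in>A. cmod (f k) ^ (2 * Suc j) * w k)"
    proof -
      have "((cmod (f k))\<^sup>2) ^ Suc j = cmod (f k) ^ (2 * Suc j)" for k by (simp only: power_mult)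
      moreover have "\<epsilon> ^ Suc (2 * j) = \<epsilon> ^ Suc j * \<epsilon> ^ j" by (simp add: mult_2 power_add)
      ultimately show ?thesis by (simp add: power_divide del: power_Suc)
    qed
    finally show "(\<Sum>\<theta>\<in>\<Theta>. (cmod (\<Sum>k\<in>A. (f k * complex_of_real (vp_kernel (x - \<epsilon> * of_int k))) * cis (- 2 * pi * of_int k * \<theta>)))\<^sup>2) ^ Suc j
      \<le> (D ^ Suc j * (3 * J) ^ j) / \<epsilon> ^ Suc (2 * j) * (\<Sum>k\<in>A. cmod (f k) ^ (2 * Suc j) * decay (x - \<epsilon> * of_int k))"
      by (simp only: b_def w_def)
  qed
qed

text \<open>Here the powers of \<epsilon> meet and cancel. \<open>D\<close> is obtained before
  \<open>m\<close> and all other data, hence depends on \<open>B\<close> and \<open>j\<close>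
  only.\<close>

lemma square_function_finite:
  fixes B :: real and j :: nat
  obtains D where "D \<ge> 0"
    "\<And>m \<Theta> \<epsilon> A f N. Lp_multiplier (real (2 * Suc j)) m B \<Longrightarrow> (\<And>x. \<bar>x\<bar> > 1/2 \<Longrightarrow> m x = 0) \<Longrightarrow>
      finite A \<Longrightarrow> finite \<Theta> \<Longrightarrow> 0 < \<epsilon> \<Longrightarrow> \<epsilon> \<le> 1 \<Longrightarrow> (\<And>\<theta>. \<theta> \<in> \<Theta> \<Longrightarrow> 0 \<le> \<theta> \<and> \<theta> + \<epsilon> \<le> 1) \<Longrightarrow>
      (\<And>\<theta> \<theta>'. \<theta> \<in> \<Theta> \<Longrightarrow> \<theta>' \<in> \<Theta> \<Longrightarrow> \<theta> < \<theta>' \<Longrightarrow> \<theta> + \<epsilon> < \<theta>') \<Longrightarrow> finite N \<Longrightarrow>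
      (\<Sum>n\<in>N. (\<Sum>\<theta>\<in>\<Theta>. (cmod (\<epsilon> *\<^sub>R (\<Sum>k\<in>A. f k * cis (- 2 * pi * of_int k * \<theta>) * inv_fourier_R m (\<epsilon> * of_int (n - k)))))\<^sup>2) ^ Suc j)
        \<le> D * (\<Sum>k\<in>A. cmod (f k) ^ (2 * Suc j))"
proof -
  define q where "q = Suc (2 * j)"
  have q: "2 * Suc j = Suc q" by (simp add: q_def)
  obtain C1 where C1: "C1 \<ge> 0"
    "\<And>h \<epsilon> N. integrable lebesgue h \<Longrightarrow> (\<And>\<xi>. \<bar>\<xi>\<bar> > 1/2 \<Longrightarrow> h \<xi> = 0) \<Longrightarrow>
      integrable lborel (\<lambda>x. cmod (inv_fourier_R h x) ^ Suc q) \<Longrightarrow> 0 < \<epsilon> \<Longrightarrow> \<epsilon> \<le> 1 \<Longrightarrow> finite N \<Longrightarrow>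
      (\<Sum>j\<in>N. cmod (inv_fourier_R h (\<epsilon> * of_int j)) ^ Suc q) \<le> C1 / \<epsilon> * (LINT x|lborel. cmod (inv_fourier_R h x) ^ Suc q)"
    by (rule sampling[of q]) blast
  obtain C2 where C2: "C2 \<ge> 0"
    "\<And>f A \<Theta> \<epsilon> x. finite A \<Longrightarrow> finite \<Theta> \<Longrightarrow> 0 < \<epsilon> \<Longrightarrow> \<epsilon> \<le> 1 \<Longrightarrow> (\<And>\<theta>. \<theta> \<in> \<Theta> \<Longrightarrow> 0 \<le> \<theta> \<and> \<theta> + \<epsilon> \<le> 1) \<Longrightarrow>
      (\<And>\<theta> \<theta>'. \<theta> \<in> \<Theta> \<Longrightarrow> \<theta>' \<in> \<Theta> \<Longrightarrow> \<theta> < \<theta>' \<Longrightarrow> \<theta> + \<epsilon> < \<theta>') \<Longrightarrow>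
      (\<Sum>\<theta>\<in>\<Theta>. (cmod (\<Sum>k\<in>A. (f k * complex_of_real (vp_kernel (x - \<epsilon> * of_int k))) * cis (- 2 * pi * of_int k * \<theta>)))\<^sup>2) ^ Suc j
      \<le> C2 / \<epsilon> ^ q * (\<Sum>k\<in>A. cmod (f k) ^ Suc q * decay (x - \<epsilon> * of_int k))"
    unfolding q_def q[symmetric, unfolded q_def] by (rule packet_square_function[of j]) blast
  define J where "J = (LINT x|lborel. decay x)"
  have J: "J \<ge> 0" unfolding J_def by (simp add: integral_nonneg_AE)
  define K where "K = khintchine_const (Suc j)"
  have K: "K \<ge> 0" unfolding K_def by (rule khintchine_const_nonneg)
  show thesis
  proof (rule that[of "C1 * \<bar>B\<bar> ^ Suc q * K * C2 * J"], goal_cases)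
    case 1
    show ?case using C1 C2 J K by simp
  next
    case (2 m \<Theta> \<epsilon> A f N)
    note asm = 2
    interpret band_multiplier m B q
      by unfold_locales (use asm(1,2) in \<open>simp_all only: q\<close>)
    \<comment> \<open>\<open>a \<theta> n\<close> is the sample of \<open>G\<^sub>\<theta>\<close>
      at \<open>\<epsilon> * n\<close>, and \<open>F\<close> is the \<open>F\<^sub>\<theta>\<close>
      of the overview. The coefficients \<open>d S\<close> make a single packet out of the signed
      sum over all \<theta>.\<close>
    define a where "a = (\<lambda>\<theta> n. \<Sum>k\<in>A. f k * cis (- 2 * pi * of_int k * \<theta>) * inv_fourier_R m (\<epsilon> * of_int (n - k)))"
    define d where "d = (\<lambda>S k. f k * (\<Sum>\<theta>\<in>\<Theta>. pm S \<theta> *\<^sub>R cis (- 2 * pi * of_int k * \<theta>)))"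
    define F where "F = (\<lambda>\<theta> x. \<Sum>k\<in>A. (f k * complex_of_real (vp_kernel (x - \<epsilon> * of_int k))) * cis (- 2 * pi * of_int k * \<theta>))"
    have aS: "inv_fourier_R (symbol A (d S) \<epsilon>) (\<epsilon> * of_int n) = (\<Sum>\<theta>\<in>\<Theta>. pm S \<theta> *\<^sub>R a \<theta> n)" for S n
    proof -
      have "inv_fourier_R (symbol A (d S) \<epsilon>) (\<epsilon> * of_int n) = (\<Sum>k\<in>A. \<Sum>\<theta>\<in>\<Theta>. pm S \<theta> *\<^sub>R (f k * cis (- 2 * pi * of_int k * \<theta>) * inv_fourier_R m (\<epsilon> * of_int (n - k))))"
        unfolding inv_fourier_symbol d_def
        by (intro sum.cong refl) (simp add: sum_distrib_left sum_distrib_right algebra_simps)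
      then show ?thesis by (subst (asm) sum.swap) (simp add: a_def scaleR_sum_right)
    qed
    have FS: "packet A (d S) \<epsilon> x = (\<Sum>\<theta>\<in>\<Theta>. pm S \<theta> *\<^sub>R F \<theta> x)" for S x
    proof -
      have "packet A (d S) \<epsilon> x = (\<Sum>k\<in>A. \<Sum>\<theta>\<in>\<Theta>. pm S \<theta> *\<^sub>R ((f k * complex_of_real (vp_kernel (x - \<epsilon> * of_int k))) * cis (- 2 * pi * of_int k * \<theta>)))"
        unfolding packet_def d_def
        by (intro sum.cong refl) (simp add: sum_distrib_left sum_distrib_right algebra_simps)
      then show ?thesis by (subst (asm) sum.swap) (simp add: F_def scaleR_sum_right)
    qed
    define M where "M = (2::real) ^ card \<Theta>"
    have M: "M > 0" by (simp add: M_def)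
    have i: "integrable lborel (\<lambda>x. (\<Sum>S\<in>Pow \<Theta>. cmod (packet A (d S) \<epsilon> x) ^ Suc q))"
      using packet_power_integrable by (simp del: power_Suc)
    have id: "integrable lborel (\<lambda>x. decay (x - a))" for a
      using integrable_decay_affine[of 1 "-a"] by simp
    have "M * (\<Sum>n\<in>N. (\<Sum>\<theta>\<in>\<Theta>. (cmod (a \<theta> n))\<^sup>2) ^ Suc j) \<le> (\<Sum>n\<in>N. \<Sum>S\<in>Pow \<Theta>. cmod (\<Sum>\<theta>\<in>\<Theta>. pm S \<theta> *\<^sub>R a \<theta> n) ^ Suc q)"
      unfolding sum_distrib_left M_def q[symmetric]
      by (intro sum_mono square_function_le_signs asm) simp
    also have "\<dots> = (\<Sum>S\<in>Pow \<Theta>. \<Sum>n\<in>N. cmod (inv_fourier_R (symbol A (d S) \<epsilon>) (\<epsilon> * of_int n)) ^ Suc q)"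
      unfolding aS by (rule sum.swap)
    also have "\<dots> \<le> (\<Sum>S\<in>Pow \<Theta>. C1 / \<epsilon> * (LINT x|lborel. cmod (inv_fourier_R (symbol A (d S) \<epsilon>) x) ^ Suc q))"
      by (intro sum_mono C1(2) symbol_integrable symbol_supp inv_fourier_symbol_bound(1) asm)
    also have "\<dots> \<le> (\<Sum>S\<in>Pow \<Theta>. C1 / \<epsilon> * (\<bar>B\<bar> ^ Suc q * (LINT x|lborel. cmod (packet A (d S) \<epsilon> x) ^ Suc q)))"
      using C1(1) asm(5) by (intro sum_mono mult_left_mono inv_fourier_symbol_bound(2)) auto
    also have "\<dots> = C1 / \<epsilon> * (\<bar>B\<bar> ^ Suc q * (LINT x|lborel. (\<Sum>S\<in>Pow \<Theta>. cmod (packet A (d S) \<epsilon> x) ^ Suc q)))"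
      using packet_power_integrable by (simp add: sum_distrib_left del: power_Suc)
    also have "\<dots> \<le> C1 / \<epsilon> * (\<bar>B\<bar> ^ Suc q * (LINT x|lborel. K * M * (C2 / \<epsilon> ^ q * (\<Sum>k\<in>A. cmod (f k) ^ Suc q * decay (x - \<epsilon> * of_int k)))))"
    proof (intro mult_left_mono integral_mono i)
      show "(\<Sum>S\<in>Pow \<Theta>. cmod (packet A (d S) \<epsilon> x) ^ Suc q) \<le> K * M * (C2 / \<epsilon> ^ q * (\<Sum>k\<in>A. cmod (f k) ^ Suc q * decay (x - \<epsilon> * of_int k)))" for x
      proof -
        have "(\<Sum>S\<in>Pow \<Theta>. cmod (packet A (d S) \<epsilon> x) ^ Suc q) \<le> K * M * (\<Sum>\<theta>\<in>\<Theta>. (cmod (F \<theta> x))\<^sup>2) ^ Suc j"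
          unfolding FS K_def M_def q[symmetric] by (rule khintchine[OF asm(4)])
        also have "\<dots> \<le> K * M * (C2 / \<epsilon> ^ q * (\<Sum>k\<in>A. cmod (f k) ^ Suc q * decay (x - \<epsilon> * of_int k)))"
          unfolding F_def using K M by (intro mult_left_mono C2(2) asm) auto
        finally show ?thesis .
      qed
    qed (use C1(1) asm(5) id in auto)
    also have "\<dots> = C1 / \<epsilon> * (\<bar>B\<bar> ^ Suc q * (K * M * (C2 / \<epsilon> ^ q * (\<Sum>k\<in>A. cmod (f k) ^ Suc q * (LINT x|lborel. decay (x - \<epsilon> * of_int k))))))"
      using id by (simp del: power_Suc)
    also have "\<dots> = C1 / \<epsilon> * (\<bar>B\<bar> ^ Suc q * (K * M * (C2 / \<epsilon> ^ q * (\<Sum>k\<in>A. cmod (f k) ^ Suc q * J))))"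
    proof -
      have "(LINT x|lborel. decay (x - a)) = J" for a
        using lborel_integral_real_affine[of 1 decay "-a"] by (simp add: J_def)
      then show ?thesis by simp
    qed
    also have "\<dots> = M * (C1 * \<bar>B\<bar> ^ Suc q * K * C2 * J * (\<Sum>k\<in>A. cmod (f k) ^ Suc q) / \<epsilon> ^ Suc q)"
      by (simp add: sum_distrib_right[symmetric])
    \<comment> \<open>The number \<open>M\<close> of sign choices occurs on both sides and cancels,
      which removes the dependence on the number of fractions.\<close>
    finally have main: "(\<Sum>n\<in>N. (\<Sum>\<theta>\<in>\<Theta>. (cmod (a \<theta> n))\<^sup>2) ^ Suc j) \<le> C1 * \<bar>B\<bar> ^ Suc q * K * C2 * J * (\<Sum>k\<in>A. cmod (f k) ^ Suc q) / \<epsilon> ^ Suc q"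
      using M by (simp only: mult_le_cancel_left_pos)
    have "(\<Sum>n\<in>N. (\<Sum>\<theta>\<in>\<Theta>. (cmod (\<epsilon> *\<^sub>R a \<theta> n))\<^sup>2) ^ Suc j) = \<epsilon> ^ Suc q * (\<Sum>n\<in>N. (\<Sum>\<theta>\<in>\<Theta>. (cmod (a \<theta> n))\<^sup>2) ^ Suc j)"
    proof -
      have e: "(\<Sum>\<theta>\<in>\<Theta>. (cmod (\<epsilon> *\<^sub>R a \<theta> n))\<^sup>2) = \<epsilon>\<^sup>2 * (\<Sum>\<theta>\<in>\<Theta>. (cmod (a \<theta> n))\<^sup>2)" for n
        by (simp add: power_mult_distrib sum_distrib_left)
      have e2: "\<epsilon> ^ Suc q = (\<epsilon>\<^sup>2) ^ Suc j" by (simp only: q[symmetric] power_mult)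
      show ?thesis unfolding e e2 power_mult_distrib by (rule sum_distrib_left[symmetric])
    qed
    also have "\<dots> \<le> \<epsilon> ^ Suc q * (C1 * \<bar>B\<bar> ^ Suc q * K * C2 * J * (\<Sum>k\<in>A. cmod (f k) ^ Suc q) / \<epsilon> ^ Suc q)"
      using main asm(5) by (intro mult_left_mono) auto
    also have "\<dots> = C1 * \<bar>B\<bar> ^ Suc q * K * C2 * J * (\<Sum>k\<in>A. cmod (f k) ^ Suc q)"
      using asm(5) by simp
    finally show ?case by (simp only: a_def q)
  qed
qed

section \<open>The pieces on summable sequences\<close>

definition trunc :: "nat \<Rightarrow> (int \<Rightarrow> complex) \<Rightarrow> int \<Rightarrow> complex"
  where "trunc N f k = (if k \<in> {- int N..int N} then f k else 0)"

lemma integrable_count_space_finite_support: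
  fixes g :: "'a \<Rightarrow> 'b::{banach, second_countable_topology}"
  assumes "finite A" "\<And>x. x \<notin> A \<Longrightarrow> g x = 0"
  shows "integrable (count_space UNIV) g"
proof -
  have "integrable (count_space UNIV) (\<lambda>x. \<Sum>a\<in>A. indicator {a} x *\<^sub>R g a)"
    by (intro Bochner_Integration.integrable_sum integrable_scaleR_left integrable_real_indicator) auto
  also have "(\<lambda>x. \<Sum>a\<in>A. indicator {a} x *\<^sub>R g a) = g"
  proof
    fix x
    have "(\<Sum>a\<in>A. indicator {a} x *\<^sub>R g a) = (\<Sum>a\<in>A. if x = a then g a else 0)"
      by (intro sum.cong) auto
    then show "(\<Sum>a\<in>A. indicator {a} x *\<^sub>R g a) = g x" using assms by simp
  qed
  finally show ?thesis .
qed

lemma trunc_in_ell: "trunc N f \<in> ell p"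
  unfolding Lp_space_def
  by (auto intro!: integrable_count_space_finite_support[of "{- int N..int N}"] simp: trunc_def)

lemma trunc_integral_tendsto:
  assumes "f \<in> ell p"
  shows "(\<lambda>N. LINT k|count_space UNIV. norm (trunc N f k - f k) powr p) \<longlonglongrightarrow> 0"
proof -
  have "(\<lambda>N. LINT k|count_space UNIV. norm (trunc N f k - f k) powr p) \<longlonglongrightarrow> (LINT k|count_space (UNIV :: int set). 0)"
  proof (rule integral_dominated_convergence)
    show "integrable (count_space UNIV) (\<lambda>k. norm (f k) powr p)" using assms by (simp add: Lp_space_def)
    have "(\<lambda>N. norm (trunc N f k - f k) powr p) \<longlonglongrightarrow> 0" for k
    proof (rule tendsto_eventually)
      show "\<forall>\<^sub>F N in sequentially. norm (trunc N f k - f k) powr p = 0"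
        using eventually_ge_at_top[of "nat \<bar>k\<bar>"] by eventually_elim (auto simp: trunc_def)
    qed
    then show "AE k in count_space UNIV. (\<lambda>N. norm (trunc N f k - f k) powr p) \<longlonglongrightarrow> 0" by simp
  qed (auto simp: trunc_def)
  then show ?thesis by simp
qed

lemma ell_integrable: "f \<in> ell 1 \<Longrightarrow> integrable (count_space UNIV) f"
  by (auto simp: Lp_space_def intro: integrable_norm_cancel)

lemma fourier_Z_eq_integral:
  assumes "f \<in> ell 1"
  shows "integrable (count_space UNIV) (\<lambda>k. f k * cis (- 2 * pi * of_int k * \<xi>))"
    and "fourier_Z f \<xi> = (LINT k|count_space UNIV. f k * cis (- 2 * pi * of_int k * \<xi>))"
proof -
  show i: "integrable (count_space UNIV) (\<lambda>k. f k * cis (- 2 * pi * of_int k * \<xi>))"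
    by (rule Bochner_Integration.integrable_bound[OF ell_integrable[OF assms]]) (auto simp: norm_mult)
  then show "fourier_Z f \<xi> = (LINT k|count_space UNIV. f k * cis (- 2 * pi * of_int k * \<xi>))"
    unfolding fourier_Z_def
    by (subst infsetsum_infsum[symmetric])
       (auto simp: infsetsum_def abs_summable_on_def abs_summable_equivalent[symmetric])
qed

lemma fourier_Z_measurable:
  assumes "f \<in> ell 1"
  shows "fourier_Z f \<in> borel_measurable borel"
proof -
  interpret C: sigma_finite_measure "count_space (UNIV :: int set)"
    by (rule sigma_finite_measure_count_space)
  have c: "(\<lambda>\<xi>. cis (- (2 * pi * of_int k * \<xi>))) \<in> borel_measurable borel" for k :: int
    using borel_measurable_cis_linear[of "- (2 * pi * of_int k)"] by simp
  have "case_prod (\<lambda>\<xi> k. f k * cis (- 2 * pi * of_int k * \<xi>)) \<in> borel_measurable (borel \<Otimes>\<^sub>M count_space UNIV)"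
    by (subst measurable_pair_swap_iff)
       (auto simp: case_prod_unfold intro!: measurable_pair_measure_countable1 borel_measurable_times c)
  then have "(\<lambda>\<xi>. LINT k|count_space UNIV. f k * cis (- 2 * pi * of_int k * \<xi>)) \<in> borel_measurable borel"
    by (rule C.borel_measurable_lebesgue_integral)
  then show ?thesis by (simp only: fourier_Z_eq_integral(2)[OF assms, symmetric])
qed

lemma fourier_Z_bound: "f \<in> ell 1 \<Longrightarrow> cmod (fourier_Z f \<xi>) \<le> (LINT k|count_space UNIV. cmod (f k))"
  using integral_norm_bound[of "count_space UNIV" "\<lambda>k. f k * cis (- 2 * pi * of_int k * \<xi>)"]
  by (simp add: fourier_Z_eq_integral norm_mult)

lemma fourier_Z_diff:
  assumes "f \<in> ell 1" "g \<in> ell 1"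
  shows "fourier_Z (\<lambda>k. f k - g k) \<xi> = fourier_Z f \<xi> - fourier_Z g \<xi>"
  using Lp_space_diff[OF _ assms] fourier_Z_eq_integral[OF assms(1), of \<xi>] fourier_Z_eq_integral[OF assms(2), of \<xi>]
  by (simp add: fourier_Z_eq_integral(2) left_diff_distrib)

lemma fourier_Z_trunc: "fourier_Z (trunc N f) \<xi> = (\<Sum>k\<in>{- int N..int N}. f k * cis (- 2 * pi * of_int k * \<xi>))"
proof -
  have "fourier_Z (trunc N f) \<xi> = (\<Sum>\<^sub>\<infinity>k\<in>{- int N..int N}. f k * cis (- 2 * pi * of_int k * \<xi>))"
    unfolding fourier_Z_def by (rule infsum_cong_neutral) (auto simp: trunc_def)
  then show ?thesis by simp
qed

text \<open>\<open>m ((\<xi> - \<theta>) / \<epsilon>)\<close> lives within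
  \<open>\<epsilon> / 2\<close> of \<theta>. The last two conditions keep this inside
  \<open>[0, 1]\<close>, so nothing wraps around the period.\<close>

locale band_piece =
  fixes m :: "real \<Rightarrow> complex" and \<epsilon> \<theta> :: real
  assumes m: "bounded (range m)" "m \<in> borel_measurable lebesgue" "\<And>x. \<bar>x\<bar> > 1/2 \<Longrightarrow> m x = 0"
    and \<epsilon>: "0 < \<epsilon>" "\<epsilon> \<le> \<theta>" "\<theta> + \<epsilon> \<le> 1"
begin

text \<open>On \<open>[0, 1]\<close> only the term \<open>l = 0\<close> of the periodisation
  survives, and outside that term vanishes too, so the integral extends to the whole line. The
  substitution \<open>\<xi> = \<theta> + \<epsilon> * \<eta>\<close> produces the factor
  \<epsilon>.\<close>

lemma piece_formula:
  "piece_ell1 m \<epsilon> \<theta> f n = \<epsilon> *\<^sub>R (LINT \<eta>|lebesgue. m \<eta> * (fourier_Z f (\<theta> + \<epsilon> * \<eta>) * cis (2 * pi * of_int n * (\<theta> + \<epsilon> * \<eta>))))"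
proof -
  let ?g = "\<lambda>\<xi>. m ((\<xi> - \<theta>) / \<epsilon>) * (fourier_Z f \<xi> * cis (2 * pi * of_int n * \<xi>))"
  have "indicator {0..1} \<xi> *\<^sub>R ((\<Sum>\<^sub>\<infinity>l::int. m ((\<xi> - of_int l - \<theta>) / \<epsilon>) * fourier_Z f \<xi>) * cis (2 * pi * of_int n * \<xi>)) = ?g \<xi>" for \<xi> :: real
  proof (cases "\<xi> \<in> {0..1}")
    case True
    have "m ((\<xi> - of_int l - \<theta>) / \<epsilon>) = 0" if "l \<noteq> 0" for l :: int
    proof -
      have "\<epsilon> \<le> \<bar>\<xi> - of_int l - \<theta>\<bar>"
      proof (cases "l \<ge> 1")
        case True then have "1 \<le> real_of_int l" by simp
        then show ?thesis using \<epsilon> \<open>\<xi> \<in> {0..1}\<close> by auto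
      next
        case False then have "real_of_int l \<le> - 1" using that by linarith
        then show ?thesis using \<epsilon> \<open>\<xi> \<in> {0..1}\<close> by auto
      qed
      then have "1 \<le> \<bar>(\<xi> - of_int l - \<theta>) / \<epsilon>\<bar>" using \<epsilon> by (simp add: abs_divide)
      then show ?thesis by (intro m(3)) linarith
    qed
    then have "(\<Sum>\<^sub>\<infinity>l::int. m ((\<xi> - of_int l - \<theta>) / \<epsilon>) * fourier_Z f \<xi>) = (\<Sum>\<^sub>\<infinity>l\<in>{0::int}. m ((\<xi> - of_int l - \<theta>) / \<epsilon>) * fourier_Z f \<xi>)"
      by (intro infsum_cong_neutral) auto
    then show ?thesis using True by simp
  next
    case False
    then have "\<epsilon> \<le> \<bar>\<xi> - \<theta>\<bar>" using \<epsilon> by auto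
    then have "1 \<le> \<bar>(\<xi> - \<theta>) / \<epsilon>\<bar>" using \<epsilon> by (simp add: abs_divide)
    then have "m ((\<xi> - \<theta>) / \<epsilon>) = 0" by (intro m(3)) linarith
    then show ?thesis using False by simp
  qed
  then have "piece_ell1 m \<epsilon> \<theta> f n = (LINT \<xi>|lebesgue. ?g \<xi>)"
    by (simp only: piece_ell1_def inv_fourier_Z_def set_lebesgue_integral_def)
  also have "\<dots> = \<epsilon> *\<^sub>R (LINT \<eta>|lebesgue. ?g (\<theta> + \<epsilon> * \<eta>))"
    using lebesgue_integral_real_affine[of \<epsilon> ?g \<theta>] \<epsilon>(1) by (simp only: abs_of_pos)
  finally show ?thesis using \<epsilon>(1) by simp
qed

lemma piece_integrand:
  assumes "f \<in> ell 1"
  shows "integrable lebesgue (\<lambda>\<eta>. m \<eta> * (fourier_Z f (\<theta> + \<epsilon> * \<eta>) * cis (2 * pi * of_int n * (\<theta> + \<epsilon> * \<eta>))))"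
proof (rule integrable_compact_support_mult[OF m])
  have [measurable]: "fourier_Z f \<in> borel_measurable borel" by (rule fourier_Z_measurable[OF assms])
  have "(\<lambda>\<eta>. fourier_Z f (\<theta> + \<epsilon> * \<eta>) * cis (2 * pi * of_int n * (\<theta> + \<epsilon> * \<eta>))) \<in> borel_measurable lborel"
    by (intro borel_measurable_times measurable_compose[OF _ borel_measurable_cis_linear]) measurable
  then show "(\<lambda>\<eta>. fourier_Z f (\<theta> + \<epsilon> * \<eta>) * cis (2 * pi * of_int n * (\<theta> + \<epsilon> * \<eta>))) \<in> borel_measurable lebesgue"
    by (rule measurable_completion)
  show "cmod (fourier_Z f (\<theta> + \<epsilon> * x) * cis (2 * pi * of_int n * (\<theta> + \<epsilon> * x))) \<le> (LINT k|count_space UNIV. cmod (f k))" for x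
    using fourier_Z_bound[OF assms] by (simp add: norm_mult)
qed

lemma piece_diff:
  assumes "f \<in> ell 1" "g \<in> ell 1"
  shows "piece_ell1 m \<epsilon> \<theta> (\<lambda>k. f k - g k) n = piece_ell1 m \<epsilon> \<theta> f n - piece_ell1 m \<epsilon> \<theta> g n"
  using piece_integrand[OF assms(1), of n] piece_integrand[OF assms(2), of n]
  by (simp add: piece_formula fourier_Z_diff[OF assms] left_diff_distrib right_diff_distrib scaleR_diff_right)

lemma integrable_m: "integrable lebesgue m"
  using integrable_compact_support_mult[OF m, of "\<lambda>_. 1" 1] by simp

text \<open>A crude bound by the sum of \<open>cmod (f k)\<close>; it only serves to pass from
  truncations to summable sequences pointwise.\<close>

lemma piece_bound:
  assumes "f \<in> ell 1"
  shows "cmod (piece_ell1 m \<epsilon> \<theta> f n) \<le> \<epsilon> * (LINT \<eta>|lebesgue. cmod (m \<eta>)) * (LINT k|count_space UNIV. cmod (f k))"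
proof -
  let ?F = "LINT k|count_space UNIV. cmod (f k)"
  have "cmod (piece_ell1 m \<epsilon> \<theta> f n) = \<epsilon> * cmod (LINT \<eta>|lebesgue. m \<eta> * (fourier_Z f (\<theta> + \<epsilon> * \<eta>) * cis (2 * pi * of_int n * (\<theta> + \<epsilon> * \<eta>))))"
    using \<epsilon>(1) by (simp add: piece_formula)
  also have "\<dots> \<le> \<epsilon> * (LINT \<eta>|lebesgue. cmod (m \<eta>) * ?F)"
  proof (intro mult_left_mono order_trans[OF integral_norm_bound] integral_mono)
    show "integrable lebesgue (\<lambda>\<eta>. cmod (m \<eta> * (fourier_Z f (\<theta> + \<epsilon> * \<eta>) * cis (2 * pi * of_int n * (\<theta> + \<epsilon> * \<eta>)))))"
      using piece_integrand[OF assms] by (rule integrable_norm)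
    show "integrable lebesgue (\<lambda>\<eta>. cmod (m \<eta>) * ?F)" using integrable_m by simp
    show "cmod (m \<eta> * (fourier_Z f (\<theta> + \<epsilon> * \<eta>) * cis (2 * pi * of_int n * (\<theta> + \<epsilon> * \<eta>)))) \<le> cmod (m \<eta>) * ?F" for \<eta>
      using fourier_Z_bound[OF assms] by (simp add: norm_mult mult_left_mono)
  qed (use \<epsilon> in simp)
  finally show ?thesis by (simp add: mult.assoc)
qed

lemma piece_trunc_tendsto:
  assumes "f \<in> ell 1"
  shows "(\<lambda>N. piece_ell1 m \<epsilon> \<theta> (trunc N f) n) \<longlonglongrightarrow> piece_ell1 m \<epsilon> \<theta> f n"
proof (rule Lim_null[THEN iffD2], rule Lim_null_comparison)
  let ?c = "\<epsilon> * (LINT \<eta>|lebesgue. cmod (m \<eta>))"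
  show "\<forall>\<^sub>F N in sequentially. cmod (piece_ell1 m \<epsilon> \<theta> (trunc N f) n - piece_ell1 m \<epsilon> \<theta> f n) \<le> ?c * (LINT k|count_space UNIV. cmod (trunc N f k - f k) powr 1)"
  proof (rule always_eventually, rule allI)
    fix N
    have "(\<lambda>k. trunc N f k - f k) \<in> ell 1" by (rule Lp_space_diff[OF _ trunc_in_ell assms]) simp
    from piece_bound[OF this, of n]
    show "cmod (piece_ell1 m \<epsilon> \<theta> (trunc N f) n - piece_ell1 m \<epsilon> \<theta> f n) \<le> ?c * (LINT k|count_space UNIV. cmod (trunc N f k - f k) powr 1)"
      by (simp add: piece_diff[OF trunc_in_ell assms])
  qed
  show "(\<lambda>N. ?c * (LINT k|count_space UNIV. cmod (trunc N f k - f k) powr 1)) \<longlonglongrightarrow> 0"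
    using tendsto_mult_left[OF trunc_integral_tendsto[OF assms], of ?c] by simp
qed

text \<open>The link between the two sides: the common phase
  \<open>cis (2 * pi * n * \<theta>)\<close> disappears in the modulus, and what remains is
  \<epsilon> times a sample of \<open>inv_fourier_R (symbol ...)\<close> at
  \<open>\<epsilon> * n\<close>.\<close>

lemma cmod_piece_trunc:
  "cmod (piece_ell1 m \<epsilon> \<theta> (trunc N f) n) =
    cmod (\<epsilon> *\<^sub>R (\<Sum>k\<in>{- int N..int N}. f k * cis (- 2 * pi * of_int k * \<theta>) * inv_fourier_R m (\<epsilon> * of_int (n - k))))"
proof -
  have i: "integrable lebesgue (\<lambda>\<eta>. m \<eta> * cis (2 * pi * y * \<eta>))" for y
    by (rule integrable_compact_support_mult[OF m, of _ 1]) (auto intro: measurable_completion)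
  have "(LINT \<eta>|lebesgue. m \<eta> * (fourier_Z (trunc N f) (\<theta> + \<epsilon> * \<eta>) * cis (2 * pi * of_int n * (\<theta> + \<epsilon> * \<eta>)))) =
    (LINT \<eta>|lebesgue. (\<Sum>k\<in>{- int N..int N}. cis (2 * pi * of_int n * \<theta>) * (f k * cis (- 2 * pi * of_int k * \<theta>)) * (m \<eta> * cis (2 * pi * (\<epsilon> * of_int (n - k)) * \<eta>))))"
    unfolding fourier_Z_trunc sum_distrib_left sum_distrib_right
    by (intro Bochner_Integration.integral_cong refl sum.cong) (simp add: cis_mult mult_ac, simp add: algebra_simps)
  also have "\<dots> = (\<Sum>k\<in>{- int N..int N}. cis (2 * pi * of_int n * \<theta>) * (f k * cis (- 2 * pi * of_int k * \<theta>)) * inv_fourier_R m (\<epsilon> * of_int (n - k)))"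
    using i unfolding inv_fourier_R_def
    by (simp only: Bochner_Integration.integral_sum Bochner_Integration.integrable_sum integrable_mult_right integral_mult_right_zero)
  also have "\<dots> = cis (2 * pi * of_int n * \<theta>) * (\<Sum>k\<in>{- int N..int N}. f k * cis (- 2 * pi * of_int k * \<theta>) * inv_fourier_R m (\<epsilon> * of_int (n - k)))"
    by (simp only: sum_distrib_left mult.assoc)
  finally show ?thesis by (simp add: piece_formula norm_mult)
qed

end

section \<open>Extension by density\<close>

text \<open>Bounds on finite sums yield membership and norm bound at once.\<close>

lemma integral_count_space_le:
  fixes g :: "'a \<Rightarrow> real"
  assumes "\<And>x. g x \<ge> 0" "\<And>A. finite A \<Longrightarrow> (\<Sum>x\<in>A. g x) \<le> S"
  shows "integrable (count_space UNIV) g" "(LINT x|count_space UNIV. g x) \<le> S"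
proof -
  have s: "g summable_on UNIV" by (rule nonneg_bdd_above_summable_on) (use assms in \<open>auto intro!: bdd_aboveI2\<close>)
  then show i: "integrable (count_space UNIV) g"
    using assms(1) by (simp add: abs_summable_on_def[symmetric] abs_summable_equivalent[symmetric])
  have "(LINT x|count_space UNIV. g x) = infsum g UNIV"
    using i by (subst infsetsum_infsum[symmetric]) (auto simp: infsetsum_def abs_summable_on_def abs_summable_equivalent[symmetric])
  also have "\<dots> \<le> S" by (rule infsum_le_finite_sums[OF s]) (use assms in auto)
  finally show "(LINT x|count_space UNIV. g x) \<le> S" .
qed

lemma sum_le_integral_count_space:
  fixes g :: "'a \<Rightarrow> real"
  assumes "integrable (count_space UNIV) g" "\<And>x. g x \<ge> 0" "finite A"
  shows "(\<Sum>x\<in>A. g x) \<le> (LINT x|count_space UNIV. g x)"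
proof -
  define h where "h = (\<lambda>x. if x \<in> A then g x else 0)"
  have i: "integrable (count_space UNIV) h"
    by (rule integrable_count_space_finite_support[OF assms(3)]) (simp add: h_def)
  have "finite {x \<in> UNIV. h x \<noteq> 0}" by (rule finite_subset[OF _ assms(3)]) (auto simp: h_def)
  then have "(LINT x|count_space UNIV. h x) = (\<Sum>x\<in>{x \<in> UNIV. h x \<noteq> 0}. h x)"
    by (subst lebesgue_integral_count_space_finite_support) auto
  also have "\<dots> = (\<Sum>x\<in>A. g x)"
    using assms(3) by (intro sum.mono_neutral_cong_left) (auto simp: h_def)
  finally have "(\<Sum>x\<in>A. g x) = (LINT x|count_space UNIV. h x)" by simp
  also have "\<dots> \<le> (LINT x|count_space UNIV. g x)"
    using assms by (intro integral_mono i) (auto simp: h_def)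
  finally show ?thesis .
qed

text \<open>The norm raised to its exponent: it is a plain sum, so no roots have to be carried
  along.\<close>

definition ell_mass :: "nat \<Rightarrow> (int \<Rightarrow> 'b::{banach, second_countable_topology}) \<Rightarrow> real"
  where "ell_mass q f = (LINT k|count_space UNIV. norm (f k) ^ q)"

lemma ell_mass_nonneg: "ell_mass q f \<ge> 0"
  unfolding ell_mass_def by (intro integral_nonneg_AE) simp

lemma ell_iff:
  fixes f :: "int \<Rightarrow> 'b::{banach, second_countable_topology}"
  shows "f \<in> ell (real (Suc n)) \<longleftrightarrow> integrable (count_space UNIV) (\<lambda>k. norm (f k) ^ Suc n)"
  by (simp add: Lp_space_def powr_Suc del: of_nat_Suc power_Suc)

lemma ell_norm_mass:
  fixes f :: "int \<Rightarrow> 'b::{banach, second_countable_topology}"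
  shows "ell_norm (real (Suc n)) f = ell_mass (Suc n) f powr (1 / real (Suc n))"
  by (simp add: Lp_norm_def ell_mass_def powr_Suc del: of_nat_Suc power_Suc)

lemma Lp_tendsto_ell_iff:
  fixes f :: "int \<Rightarrow> 'b::{banach, second_countable_topology}"
  shows "Lp_tendsto (count_space UNIV) (real (Suc n)) u f \<longleftrightarrow>
    f \<in> ell (real (Suc n)) \<and> (\<forall>k. u k \<in> ell (real (Suc n))) \<and> (\<lambda>k. ell_mass (Suc n) (\<lambda>x. u k x - f x)) \<longlonglongrightarrow> 0"
proof -
  have 1: "(\<lambda>k. ell_mass (Suc n) (\<lambda>x. u k x - f x)) \<longlonglongrightarrow> 0" if "(\<lambda>k. ell_norm (real (Suc n)) (\<lambda>x. u k x - f x)) \<longlonglongrightarrow> 0"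
  proof -
    have "(\<lambda>k. ell_norm (real (Suc n)) (\<lambda>x. u k x - f x) ^ Suc n) \<longlonglongrightarrow> 0 ^ Suc n"
      by (intro tendsto_power that)
    then show ?thesis unfolding Lp_norm_power ell_mass_def by simp
  qed
  have 2: "(\<lambda>k. ell_norm (real (Suc n)) (\<lambda>x. u k x - f x)) \<longlonglongrightarrow> 0" if "(\<lambda>k. ell_mass (Suc n) (\<lambda>x. u k x - f x)) \<longlonglongrightarrow> 0"
    unfolding ell_norm_mass by (rule tendsto_zero_powrI[OF that]) (auto simp: ell_mass_nonneg)
  show ?thesis unfolding Lp_tendsto_def using 1 2 by blast
qed

lemma ell_mass_diff_le:
  assumes "f \<in> ell (real (Suc n))" "g \<in> ell (real (Suc n))"
  shows "ell_mass (Suc n) (\<lambda>k. f k - g k) \<le> 2 ^ Suc n * (ell_mass (Suc n) f + ell_mass (Suc n) g)"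
proof -
  have i: "integrable (count_space UNIV) (\<lambda>k. norm (f k) ^ Suc n)" "integrable (count_space UNIV) (\<lambda>k. norm (g k) ^ Suc n)"
    "integrable (count_space UNIV) (\<lambda>k. norm (f k - g k) ^ Suc n)"
    using assms Lp_space_diff[OF _ assms] by (simp_all only: ell_iff)
  have "ell_mass (Suc n) (\<lambda>k. f k - g k) \<le> (LINT k|count_space UNIV. 2 ^ Suc n * (norm (f k) ^ Suc n + norm (g k) ^ Suc n))"
    unfolding ell_mass_def
  proof (rule integral_mono)
    show "norm (f k - g k) ^ Suc n \<le> 2 ^ Suc n * (norm (f k) ^ Suc n + norm (g k) ^ Suc n)" for k
      using powr_diff_le[of "real (Suc n)" "f k" "g k"] by (simp add: powr_Suc del: of_nat_Suc power_Suc)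
  qed (use i in \<open>auto simp del: power_Suc\<close>)
  also have "\<dots> = 2 ^ Suc n * (ell_mass (Suc n) f + ell_mass (Suc n) g)"
    using i unfolding ell_mass_def by (simp del: power_Suc)
  finally show ?thesis .
qed

lemma Lp_tendsto_pointwise:
  fixes f :: "int \<Rightarrow> 'b::{banach, second_countable_topology}"
  assumes "Lp_tendsto (count_space UNIV) (real (Suc n)) u f"
  shows "(\<lambda>k. u k x) \<longlonglongrightarrow> f x"
proof -
  have lim: "(\<lambda>k. ell_mass (Suc n) (\<lambda>x. u k x - f x)) \<longlonglongrightarrow> 0"
    and d: "(\<lambda>x. u k x - f x) \<in> ell (real (Suc n))" for k
    using assms by (auto simp: Lp_tendsto_ell_iff simp del: of_nat_Suc intro!: Lp_space_diff)
  have "(\<lambda>k. norm (u k x - f x) ^ Suc n) \<longlonglongrightarrow> 0"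
  proof (rule tendsto_sandwich[OF _ _ tendsto_const lim])
    show "\<forall>\<^sub>F k in sequentially. norm (u k x - f x) ^ Suc n \<le> ell_mass (Suc n) (\<lambda>x. u k x - f x)"
    proof (rule always_eventually, rule allI)
      fix k
      show "norm (u k x - f x) ^ Suc n \<le> ell_mass (Suc n) (\<lambda>x. u k x - f x)"
        using sum_le_integral_count_space[OF d[unfolded ell_iff, of k], of "{x}"] by (simp add: ell_mass_def)
    qed
  qed simp
  then have "(\<lambda>k. (norm (u k x - f x) ^ Suc n) powr (1 / real (Suc n))) \<longlonglongrightarrow> 0"
    by (rule tendsto_zero_powrI) auto
  moreover have "(y ^ Suc n) powr (1 / real (Suc n)) = y" if "y \<ge> 0" for y :: real
    using that by (simp only: powr_Suc[symmetric] powr_powr) simp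
  ultimately have "(\<lambda>k. norm (u k x - f x)) \<longlonglongrightarrow> 0" by (simp del: of_nat_Suc power_Suc)
  then show ?thesis by (simp add: tendsto_norm_zero_iff LIM_zero_iff)
qed

lemma trunc_Lp_tendsto:
  assumes "f \<in> ell (real (Suc n))"
  shows "Lp_tendsto (count_space UNIV) (real (Suc n)) (\<lambda>N. trunc N f) f"
  using trunc_integral_tendsto[OF assms] assms trunc_in_ell
  by (simp add: Lp_tendsto_ell_iff ell_mass_def powr_Suc del: of_nat_Suc power_Suc)

text \<open>Truncations of \<open>f\<close> are an admissible sequence, and convergence in norm over
  the integers forces pointwise convergence. This makes the \<open>THE\<close> in
  \<open>piece\<close> meaningful.\<close>

lemma density_ext_unique:
  fixes f g g' :: "int \<Rightarrow> complex"
  assumes "density_ext (count_space UNIV) (real (Suc n)) (ell 1) T f g"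
    and "density_ext (count_space UNIV) (real (Suc n)) (ell 1) T f g'"
    and f: "f \<in> ell (real (Suc n))"
  shows "g = g'"
proof
  fix x
  have "Lp_tendsto (count_space UNIV) (real (Suc n)) (\<lambda>N. T (trunc N f)) g"
    "Lp_tendsto (count_space UNIV) (real (Suc n)) (\<lambda>N. T (trunc N f)) g'"
    using assms(1,2) trunc_Lp_tendsto[OF f] trunc_in_ell by (auto simp: density_ext_def simp del: of_nat_Suc)
  then show "g x = g' x" by (rule LIMSEQ_unique[OF Lp_tendsto_pointwise Lp_tendsto_pointwise])
qed

text \<open>The pieces \<open>T \<theta> f\<close> of a general \<open>f\<close> are constructed as pointwise limits.\<close>

lemma square_function_density_ext:
  fixes T :: "'c \<Rightarrow> (int \<Rightarrow> complex) \<Rightarrow> int \<Rightarrow> complex"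
  assumes fin: "finite \<Theta>" and D: "D \<ge> 0" and q: "Suc q = 2 * r"
    and lin: "\<And>\<theta> u v x. \<theta> \<in> \<Theta> \<Longrightarrow> u \<in> ell 1 \<Longrightarrow> v \<in> ell 1 \<Longrightarrow> T \<theta> (\<lambda>k. u k - v k) x = T \<theta> u x - T \<theta> v x"
    and bd: "\<And>u N. u \<in> ell 1 \<Longrightarrow> u \<in> ell (real (Suc q)) \<Longrightarrow> finite N \<Longrightarrow>
        (\<Sum>x\<in>N. (\<Sum>\<theta>\<in>\<Theta>. (cmod (T \<theta> u x))\<^sup>2) ^ r) \<le> D * ell_mass (Suc q) u"
    and f: "f \<in> ell (real (Suc q))"
  obtains G where "\<And>\<theta>. \<theta> \<in> \<Theta> \<Longrightarrow> density_ext (count_space UNIV) (real (Suc q)) (ell 1) (T \<theta>) f (G \<theta>)"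
    and "\<And>N. finite N \<Longrightarrow> (\<Sum>x\<in>N. (\<Sum>\<theta>\<in>\<Theta>. (cmod (G \<theta> x))\<^sup>2) ^ r) \<le> D * ell_mass (Suc q) f"
proof -
  define I where "I = (\<lambda>u v :: int \<Rightarrow> complex. ell_mass (Suc q) (\<lambda>k. u k - v k))"
  have Itri: "I u v \<le> 2 ^ Suc q * (I u f + I v f)" if "u \<in> ell (real (Suc q))" "v \<in> ell (real (Suc q))" for u v
  proof -
    have "(\<lambda>k. u k - f k) \<in> ell (real (Suc q))" "(\<lambda>k. v k - f k) \<in> ell (real (Suc q))" using that f
      by (auto intro!: Lp_space_diff simp del: of_nat_Suc)
    from ell_mass_diff_le[OF this] show ?thesis by (simp add: I_def del: power_Suc)
  qed
  have term_le: "cmod (z \<theta>) ^ Suc q \<le> (\<Sum>\<theta>\<in>\<Theta>. (cmod (z \<theta>))\<^sup>2) ^ r" if "\<theta> \<in> \<Theta>" for z :: "'c \<Rightarrow> complex" and \<theta>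
  proof -
    have "(cmod (z \<theta>))\<^sup>2 \<le> (\<Sum>\<theta>\<in>\<Theta>. (cmod (z \<theta>))\<^sup>2)"
      by (rule member_le_sum[of \<theta> \<Theta> "\<lambda>\<theta>. (cmod (z \<theta>))\<^sup>2"]) (use that fin in auto)
    then have "((cmod (z \<theta>))\<^sup>2) ^ r \<le> (\<Sum>\<theta>\<in>\<Theta>. (cmod (z \<theta>))\<^sup>2) ^ r" by (rule power_mono) simp
    then show ?thesis by (simp only: q power_mult)
  qed
  \<comment> \<open>Each single piece is dominated by the square function, so every
    \<open>T \<theta>\<close> is bounded; linearity then gives the Cauchy property.\<close>
  have single: "(\<Sum>x\<in>N. cmod (T \<theta> u x) ^ Suc q) \<le> D * ell_mass (Suc q) u"
    if "\<theta> \<in> \<Theta>" "u \<in> ell 1" "u \<in> ell (real (Suc q))" "finite N" for \<theta> u N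
  proof -
    have "(\<Sum>x\<in>N. cmod (T \<theta> u x) ^ Suc q) \<le> (\<Sum>x\<in>N. (\<Sum>\<theta>\<in>\<Theta>. (cmod (T \<theta> u x))\<^sup>2) ^ r)"
      using term_le[OF that(1), of "\<lambda>\<theta>. T \<theta> u _"] by (intro sum_mono)
    also have "\<dots> \<le> D * ell_mass (Suc q) u" by (rule bd[OF that(2-4)])
    finally show ?thesis .
  qed
  have diff: "(\<Sum>x\<in>N. cmod (T \<theta> u x - T \<theta> v x) ^ Suc q) \<le> D * (2 ^ Suc q * (I u f + I v f))"
    if "\<theta> \<in> \<Theta>" "u \<in> ell 1" "u \<in> ell (real (Suc q))" "v \<in> ell 1" "v \<in> ell (real (Suc q))" "finite N" for \<theta> u v N
  proof -
    have "(\<lambda>k. u k - v k) \<in> ell 1" by (rule Lp_space_diff[OF zero_less_one that(2,4)])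
    moreover have "(\<lambda>k. u k - v k) \<in> ell (real (Suc q))" by (rule Lp_space_diff[OF _ that(3,5)]) simp
    ultimately have "(\<Sum>x\<in>N. cmod (T \<theta> (\<lambda>k. u k - v k) x) ^ Suc q) \<le> D * I u v"
      unfolding I_def by (rule single[OF that(1) _ _ that(6)])
    then have "(\<Sum>x\<in>N. cmod (T \<theta> u x - T \<theta> v x) ^ Suc q) \<le> D * I u v"
      by (simp only: lin[OF that(1,2,4)])
    also have "\<dots> \<le> D * (2 ^ Suc q * (I u f + I v f))" using Itri[OF that(3,5)] D by (rule mult_left_mono)
    finally show ?thesis .
  qed
  define w where "w = (\<lambda>N. trunc N f)"
  have w: "w N \<in> ell p" for N p by (simp add: w_def trunc_in_ell)
  have wI: "(\<lambda>N. I (w N) f) \<longlonglongrightarrow> 0" using trunc_Lp_tendsto[OF f] by (simp add: Lp_tendsto_ell_iff I_def w_def del: of_nat_Suc)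
  have wle: "ell_mass (Suc q) (w N) \<le> ell_mass (Suc q) f" for N
    unfolding ell_mass_def using w[of N "real (Suc q)"] f unfolding ell_iff
    by (intro integral_mono) (auto simp: w_def trunc_def simp del: power_Suc)
  define c where "c = D * 2 ^ Suc q"
  have Cau: "convergent (\<lambda>N. T \<theta> (w N) x)" if "\<theta> \<in> \<Theta>" for \<theta> x
  proof (rule Cauchy_convergent, rule CauchyI)
    fix e :: real assume e: "0 < e"
    have "(\<lambda>N. c * (I (w N) f)) \<longlonglongrightarrow> c * 0" by (intro tendsto_intros wI)
    moreover have "c * 0 < e ^ Suc q / 2" using e by simp
    ultimately have "\<forall>\<^sub>F N in sequentially. c * I (w N) f < e ^ Suc q / 2" by (rule order_tendstoD(2))
    then obtain N0 where N0: "\<And>N. N \<ge> N0 \<Longrightarrow> c * I (w N) f < e ^ Suc q / 2" by (auto simp: eventually_sequentially)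
    have "cmod (T \<theta> (w M) x - T \<theta> (w N) x) < e" if "M \<ge> N0" "N \<ge> N0" for M N
    proof -
      have "cmod (T \<theta> (w M) x - T \<theta> (w N) x) ^ Suc q \<le> c * I (w M) f + c * I (w N) f"
        using diff[OF \<open>\<theta> \<in> \<Theta>\<close> w w w w, of "{x}" M N] by (simp add: c_def algebra_simps del: power_Suc)
      also have "\<dots> < e ^ Suc q" using N0[OF that(1)] N0[OF that(2)] by linarith
      finally show ?thesis by (rule power_less_imp_less_base) (use e in simp)
    qed
    then show "\<exists>M. \<forall>m\<ge>M. \<forall>n\<ge>M. cmod (T \<theta> (w m) x - T \<theta> (w n) x) < e" by blast
  qed
  define G where "G = (\<lambda>\<theta> x. lim (\<lambda>N. T \<theta> (w N) x))"
  have G: "(\<lambda>N. T \<theta> (w N) x) \<longlonglongrightarrow> G \<theta> x" if "\<theta> \<in> \<Theta>" for \<theta> x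
    using Cau[OF that] by (simp add: G_def convergent_LIMSEQ_iff)
  have Gb: "(\<Sum>x\<in>N. (\<Sum>\<theta>\<in>\<Theta>. (cmod (G \<theta> x))\<^sup>2) ^ r) \<le> D * ell_mass (Suc q) f" if "finite N" for N
  proof (rule LIMSEQ_le_const2)
    show "(\<lambda>M. \<Sum>x\<in>N. (\<Sum>\<theta>\<in>\<Theta>. (cmod (T \<theta> (w M) x))\<^sup>2) ^ r) \<longlonglongrightarrow> (\<Sum>x\<in>N. (\<Sum>\<theta>\<in>\<Theta>. (cmod (G \<theta> x))\<^sup>2) ^ r)"
      by (intro tendsto_intros G)
    show "\<exists>M0. \<forall>M\<ge>M0. (\<Sum>x\<in>N. (\<Sum>\<theta>\<in>\<Theta>. (cmod (T \<theta> (w M) x))\<^sup>2) ^ r) \<le> D * ell_mass (Suc q) f"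
      by (intro exI allI impI) (rule order_trans[OF bd[OF w w that] mult_left_mono[OF wle D]])
  qed
  have "density_ext (count_space UNIV) (real (Suc q)) (ell 1) (T \<theta>) f (G \<theta>)" if \<theta>: "\<theta> \<in> \<Theta>" for \<theta>
    unfolding density_ext_def
  proof (intro conjI allI impI)
    have "(\<Sum>x\<in>N. cmod (G \<theta> x) ^ Suc q) \<le> D * ell_mass (Suc q) f" if "finite N" for N
    proof -
      have "(\<Sum>x\<in>N. cmod (G \<theta> x) ^ Suc q) \<le> (\<Sum>x\<in>N. (\<Sum>\<theta>\<in>\<Theta>. (cmod (G \<theta> x))\<^sup>2) ^ r)"
        using term_le[OF \<theta>, of "\<lambda>\<theta>. G \<theta> _"] by (intro sum_mono)
      also have "\<dots> \<le> D * ell_mass (Suc q) f" by (rule Gb[OF that])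
      finally show ?thesis .
    qed
    then show Gl: "G \<theta> \<in> ell (real (Suc q))" unfolding ell_iff by (intro integral_count_space_le(1)) simp_all
    fix u assume u: "(\<forall>k. u k \<in> ell 1) \<and> Lp_tendsto (count_space UNIV) (real (Suc q)) u f"
    then have u1: "u k \<in> ell 1" and uq: "u k \<in> ell (real (Suc q))" and uI: "(\<lambda>k. I (u k) f) \<longlonglongrightarrow> 0" for k
      by (auto simp: Lp_tendsto_ell_iff I_def simp del: of_nat_Suc)
    have Tu: "T \<theta> (u k) \<in> ell (real (Suc q))" for k
      unfolding ell_iff by (rule integral_count_space_le(1)[OF _ single[OF \<theta> u1 uq]]) simp_all
    have mass: "ell_mass (Suc q) (\<lambda>x. T \<theta> (u k) x - G \<theta> x) \<le> c * I (u k) f" for k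
      unfolding ell_mass_def
    proof (rule integral_count_space_le(2))
      fix N :: "int set" assume N: "finite N"
      show "(\<Sum>x\<in>N. cmod (T \<theta> (u k) x - G \<theta> x) ^ Suc q) \<le> c * I (u k) f"
      \<comment> \<open>An arbitrary approximating sequence \<open>u\<close> is compared with the
        truncations \<open>w\<close>: for fixed \<open>k\<close> and finite \<open>N\<close>, the
        estimate \<open>diff\<close> passes to the limit in \<open>M\<close>.\<close>
      proof (rule LIMSEQ_le)
        show "(\<lambda>M. \<Sum>x\<in>N. cmod (T \<theta> (u k) x - T \<theta> (w M) x) ^ Suc q) \<longlonglongrightarrow> (\<Sum>x\<in>N. cmod (T \<theta> (u k) x - G \<theta> x) ^ Suc q)"
          by (intro tendsto_intros G \<theta>)
        have "(\<lambda>M. c * (I (u k) f + I (w M) f)) \<longlonglongrightarrow> c * (I (u k) f + 0)"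
          by (intro tendsto_intros wI)
        then show "(\<lambda>M. c * (I (u k) f + I (w M) f)) \<longlonglongrightarrow> c * I (u k) f" by simp
        show "\<exists>M0. \<forall>M\<ge>M0. (\<Sum>x\<in>N. cmod (T \<theta> (u k) x - T \<theta> (w M) x) ^ Suc q) \<le> c * (I (u k) f + I (w M) f)"
          unfolding c_def mult.assoc by (intro exI allI impI) (rule diff[OF \<theta> u1 uq w w N])
      qed
    qed simp
    have "(\<lambda>k. ell_mass (Suc q) (\<lambda>x. T \<theta> (u k) x - G \<theta> x)) \<longlonglongrightarrow> 0"
    proof (rule tendsto_sandwich[OF _ _ tendsto_const])
      have "(\<lambda>k. c * I (u k) f) \<longlonglongrightarrow> c * 0" by (intro tendsto_intros uI)
      then show "(\<lambda>k. c * I (u k) f) \<longlonglongrightarrow> 0" by simp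
    qed (use mass ell_mass_nonneg in \<open>auto intro: always_eventually\<close>)
    then show "Lp_tendsto (count_space UNIV) (real (Suc q)) (\<lambda>k. T \<theta> (u k)) (G \<theta>)"
      unfolding Lp_tendsto_ell_iff using Gl Tu by blast
  qed
  then show thesis using Gb by (rule that)
qed

section \<open>Reduced fractions\<close>

lemma finite_reduced_fractions:
  assumes "finite Z"
  shows "finite (reduced_fractions Z)"
proof (rule finite_subset)
  show "reduced_fractions Z \<subseteq> (\<lambda>(q, a). of_int a / of_int q) ` (SIGMA q:Z. {1..q})"
    unfolding reduced_fractions_def by (auto simp: image_iff)
  show "finite ((\<lambda>(q, a). of_int a / of_int q) ` (SIGMA q:Z. {1..q}))" using assms by auto
qed

text \<open>All denominators exceed 1, so coprimality excludes the fraction 1. The distance to 0 and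
  to 1 is then at least \<open>1 / q\<close>, hence at least \<open>1 / qZ\<^sup>2\<close>.\<close>

lemma reduced_fractions_bounds:
  assumes Z: "real_of_int ` Z \<subseteq> {1<..qZ}" and \<epsilon>: "\<epsilon> < 1 / qZ\<^sup>2" and \<theta>: "\<theta> \<in> reduced_fractions Z"
  shows "\<epsilon> \<le> \<theta>" "\<theta> + \<epsilon> \<le> 1"
proof -
  obtain a q where aq: "\<theta> = of_int a / of_int q" "q \<in> Z" "1 \<le> a" "a \<le> q" "coprime a q"
    using \<theta> by (auto simp: reduced_fractions_def)
  have q: "1 < real_of_int q" "real_of_int q \<le> qZ" using Z aq(2) by auto
  then have "a \<noteq> q" using aq(5) by auto
  then have a: "1 \<le> real_of_int a" "real_of_int a + 1 \<le> real_of_int q" using aq by linarith+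
  have "1 * real_of_int q \<le> qZ * qZ" using q by (intro mult_mono) auto
  then have "1 / qZ\<^sup>2 \<le> 1 / real_of_int q" using q by (intro divide_left_mono) (auto simp: power2_eq_square)
  then have e: "\<epsilon> \<le> 1 / real_of_int q" using \<epsilon> by linarith
  have "1 / real_of_int q \<le> \<theta>" "\<theta> + 1 / real_of_int q \<le> 1"
    using a q unfolding aq(1) by (simp_all add: divide_right_mono flip: add_divide_distrib)
  then show "\<epsilon> \<le> \<theta>" "\<theta> + \<epsilon> \<le> 1" using e by linarith+
qed

text \<open>The difference of two distinct fractions has a nonzero integer numerator over
  \<open>q * s\<close>, and \<open>q * s \<le> qZ\<^sup>2\<close>.\<close>

lemma reduced_fractions_separated:
  assumes Z: "real_of_int ` Z \<subseteq> {1<..qZ}" and \<epsilon>: "\<epsilon> < 1 / qZ\<^sup>2"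
    and \<theta>: "\<theta> \<in> reduced_fractions Z" "\<theta>' \<in> reduced_fractions Z" "\<theta> < \<theta>'"
  shows "\<theta> + \<epsilon> < \<theta>'"
proof -
  obtain a q where aq: "\<theta> = of_int a / of_int q" "q \<in> Z" using \<theta> by (auto simp: reduced_fractions_def)
  obtain b s where bs: "\<theta>' = of_int b / of_int s" "s \<in> Z" using \<theta> by (auto simp: reduced_fractions_def)
  have q: "1 < real_of_int q" "real_of_int q \<le> qZ" and s: "1 < real_of_int s" "real_of_int s \<le> qZ"
    using Z aq(2) bs(2) by auto
  have d: "\<theta>' - \<theta> = real_of_int (b * q - a * s) / (real_of_int q * real_of_int s)"
    using q s unfolding aq bs by (simp add: field_simps)
  then have "0 < real_of_int (b * q - a * s) / (real_of_int q * real_of_int s)" using \<theta>(3) by linarith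
  moreover have "0 < real_of_int q * real_of_int s" using q s by (intro mult_pos_pos) linarith+
  ultimately have "0 < real_of_int (b * q - a * s)" by (simp only: pos_less_divide_eq mult_zero_left)
  then have "0 < b * q - a * s" by (simp only: of_int_0_less_iff)
  then have "1 \<le> b * q - a * s" by linarith
  then have "1 \<le> real_of_int (b * q - a * s)" by (simp only: of_int_1_le_iff)
  then have "1 / (real_of_int q * real_of_int s) \<le> \<theta>' - \<theta>" unfolding d using q s by (intro divide_right_mono) auto
  moreover have "1 / qZ\<^sup>2 \<le> 1 / (real_of_int q * real_of_int s)"
    using q s unfolding power2_eq_square by (intro divide_left_mono mult_mono) auto
  ultimately show ?thesis using \<epsilon> by linarith
qed

section \<open>From finitely supported sequences to the full space\<close>

lemma piece_eqI:
  assumes "density_ext (count_space UNIV) (real (Suc n)) (ell 1) (piece_ell1 m \<epsilon> \<theta>) f g"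
    and "f \<in> ell (real (Suc n))"
  shows "piece (real (Suc n)) m \<epsilon> \<theta> f = g"
  unfolding piece_def by (rule the_equality) (rule assms(1), erule density_ext_unique[OF _ assms])

text \<open>The finite case is applied to truncations; over finite \<open>N\<close> and \<Theta> the
  left side converges because each piece does.\<close>

lemma square_function_ell1:
  fixes B :: real and j :: nat
  defines "q \<equiv> Suc (2 * j)"
  obtains D where "D \<ge> 0"
    "\<And>m \<Theta> \<epsilon> f N. Lp_multiplier (real (Suc q)) m B \<Longrightarrow> (\<And>x. \<bar>x\<bar> > 1/2 \<Longrightarrow> m x = 0) \<Longrightarrow>
      finite \<Theta> \<Longrightarrow> 0 < \<epsilon> \<Longrightarrow> \<epsilon> \<le> 1 \<Longrightarrow> (\<And>\<theta>. \<theta> \<in> \<Theta> \<Longrightarrow> \<epsilon> \<le> \<theta> \<and> \<theta> + \<epsilon> \<le> 1) \<Longrightarrow>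
      (\<And>\<theta> \<theta>'. \<theta> \<in> \<Theta> \<Longrightarrow> \<theta>' \<in> \<Theta> \<Longrightarrow> \<theta> < \<theta>' \<Longrightarrow> \<theta> + \<epsilon> < \<theta>') \<Longrightarrow> f \<in> ell 1 \<Longrightarrow> f \<in> ell (real (Suc q)) \<Longrightarrow> finite N \<Longrightarrow>
      (\<Sum>n\<in>N. (\<Sum>\<theta>\<in>\<Theta>. (cmod (piece_ell1 m \<epsilon> \<theta> f n))\<^sup>2) ^ Suc j) \<le> D * ell_mass (Suc q) f"
proof -
  have q: "2 * Suc j = Suc q" by (simp add: q_def)
  obtain D where D: "D \<ge> 0"
    "\<And>m \<Theta> \<epsilon> A f N. Lp_multiplier (real (Suc q)) m B \<Longrightarrow> (\<And>x. \<bar>x\<bar> > 1/2 \<Longrightarrow> m x = 0) \<Longrightarrow>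
      finite A \<Longrightarrow> finite \<Theta> \<Longrightarrow> 0 < \<epsilon> \<Longrightarrow> \<epsilon> \<le> 1 \<Longrightarrow> (\<And>\<theta>. \<theta> \<in> \<Theta> \<Longrightarrow> 0 \<le> \<theta> \<and> \<theta> + \<epsilon> \<le> 1) \<Longrightarrow>
      (\<And>\<theta> \<theta>'. \<theta> \<in> \<Theta> \<Longrightarrow> \<theta>' \<in> \<Theta> \<Longrightarrow> \<theta> < \<theta>' \<Longrightarrow> \<theta> + \<epsilon> < \<theta>') \<Longrightarrow> finite N \<Longrightarrow>
      (\<Sum>n\<in>N. (\<Sum>\<theta>\<in>\<Theta>. (cmod (\<epsilon> *\<^sub>R (\<Sum>k\<in>A. f k * cis (- 2 * pi * of_int k * \<theta>) * inv_fourier_R m (\<epsilon> * of_int (n - k)))))\<^sup>2) ^ Suc j)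
        \<le> D * (\<Sum>k\<in>A. cmod (f k) ^ Suc q)"
    using square_function_finite[of j B] unfolding q by blast
  show thesis
  proof (rule that[OF D(1)], goal_cases)
    case (1 m \<Theta> \<epsilon> f N)
    note asm = 1
    have bp: "band_piece m \<epsilon> \<theta>" if "\<theta> \<in> \<Theta>" for \<theta>
      using asm(1,2,4) asm(6)[OF that] by unfold_locales (auto simp: Lp_multiplier_def)
    have T: "0 \<le> \<theta> \<and> \<theta> + \<epsilon> \<le> 1" if "\<theta> \<in> \<Theta>" for \<theta> using asm(4) asm(6)[OF that] by linarith
    show ?case
    proof (rule LIMSEQ_le_const2)
      show "(\<lambda>M. \<Sum>n\<in>N. (\<Sum>\<theta>\<in>\<Theta>. (cmod (piece_ell1 m \<epsilon> \<theta> (trunc M f) n))\<^sup>2) ^ Suc j)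
          \<longlonglongrightarrow> (\<Sum>n\<in>N. (\<Sum>\<theta>\<in>\<Theta>. (cmod (piece_ell1 m \<epsilon> \<theta> f n))\<^sup>2) ^ Suc j)"
        by (intro tendsto_sum tendsto_power tendsto_norm band_piece.piece_trunc_tendsto[OF bp asm(8)])
      have "(\<Sum>n\<in>N. (\<Sum>\<theta>\<in>\<Theta>. (cmod (piece_ell1 m \<epsilon> \<theta> (trunc M f) n))\<^sup>2) ^ Suc j) \<le> D * ell_mass (Suc q) f" for M
      proof -
        have "(\<Sum>n\<in>N. (\<Sum>\<theta>\<in>\<Theta>. (cmod (piece_ell1 m \<epsilon> \<theta> (trunc M f) n))\<^sup>2) ^ Suc j) =
          (\<Sum>n\<in>N. (\<Sum>\<theta>\<in>\<Theta>. (cmod (\<epsilon> *\<^sub>R (\<Sum>k\<in>{- int M..int M}. f k * cis (- 2 * pi * of_int k * \<theta>) * inv_fourier_R m (\<epsilon> * of_int (n - k)))))\<^sup>2) ^ Suc j)"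
          by (intro sum.cong refl arg_cong[where f = "\<lambda>x. x ^ Suc j"] arg_cong[where f = "\<lambda>x. x\<^sup>2"] band_piece.cmod_piece_trunc[OF bp])
        also have "\<dots> \<le> D * (\<Sum>k\<in>{- int M..int M}. cmod (f k) ^ Suc q)"
          by (rule D(2)[OF asm(1,2) finite_atLeastAtMost_int asm(3,4,5) T asm(7,10)])
        also have "\<dots> \<le> D * ell_mass (Suc q) f"
          unfolding ell_mass_def using asm(9) unfolding ell_iff
          by (intro mult_left_mono D(1) sum_le_integral_count_space) simp_all
        finally show ?thesis .
      qed
      then show "\<exists>M0. \<forall>M\<ge>M0. (\<Sum>n\<in>N. (\<Sum>\<theta>\<in>\<Theta>. (cmod (piece_ell1 m \<epsilon> \<theta> (trunc M f) n))\<^sup>2) ^ Suc j) \<le> D * ell_mass (Suc q) f"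
        by blast
    qed
  qed
qed

theorem proposition5p5:
  fixes r :: nat and B :: real
  assumes "r \<ge> 1"
  shows "\<exists>C :: real. \<forall>(m :: real \<Rightarrow> complex) (Z :: int set) (qZ :: real) (\<epsilon> :: real).
    Lp_multiplier (2 * r) m B \<and> (\<forall>x. x \<notin> {-1/2<..1/2} \<longrightarrow> m x = 0) \<and>
    finite Z \<and> real_of_int ` Z \<subseteq> {1<..qZ} \<and> 0 < \<epsilon> \<and> \<epsilon> < 1 / qZ\<^sup>2 \<longrightarrow>
    (\<forall>f \<in> ell (2 * r).
       (\<lambda>n. sqrt (\<Sum>\<theta> \<in> reduced_fractions Z. (cmod (piece (2 * r) m \<epsilon> \<theta> f n))\<^sup>2)) \<in> ell (2 * r) \<and>
       ell_norm (2 * r) (\<lambda>n. sqrt (\<Sum>\<theta> \<in> reduced_fractions Z. (cmod (piece (2 * r) m \<epsilon> \<theta> f n))\<^sup>2))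
         \<le> C * ell_norm (2 * r) f)"
proof -
  obtain j where r: "r = Suc j" using assms by (cases r) auto
  define q where "q = Suc (2 * j)"
  have rq: "2 * r = Suc q" by (simp add: r q_def)
  obtain D where D: "D \<ge> 0"
    "\<And>m \<Theta> \<epsilon> f N. Lp_multiplier (real (Suc q)) m B \<Longrightarrow> (\<And>x. \<bar>x\<bar> > 1/2 \<Longrightarrow> m x = 0) \<Longrightarrow>
      finite \<Theta> \<Longrightarrow> 0 < \<epsilon> \<Longrightarrow> \<epsilon> \<le> 1 \<Longrightarrow> (\<And>\<theta>. \<theta> \<in> \<Theta> \<Longrightarrow> \<epsilon> \<le> \<theta> \<and> \<theta> + \<epsilon> \<le> 1) \<Longrightarrow>
      (\<And>\<theta> \<theta>'. \<theta> \<in> \<Theta> \<Longrightarrow> \<theta>' \<in> \<Theta> \<Longrightarrow> \<theta> < \<theta>' \<Longrightarrow> \<theta> + \<epsilon> < \<theta>') \<Longrightarrow> f \<in> ell 1 \<Longrightarrow> f \<in> ell (real (Suc q)) \<Longrightarrow> finite N \<Longrightarrow>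
      (\<Sum>n\<in>N. (\<Sum>\<theta>\<in>\<Theta>. (cmod (piece_ell1 m \<epsilon> \<theta> f n))\<^sup>2) ^ r) \<le> D * ell_mass (Suc q) f"
    unfolding q_def r by (rule square_function_ell1[of j B]) blast
  show ?thesis
    unfolding rq
  \<comment> \<open>\<open>D\<close> bounds 2r-th powers of norms, so the constant is its root of
    order \<open>Suc q = 2 * r\<close>.\<close>
  proof (intro exI[of _ "D powr (1 / real (Suc q))"] allI impI ballI, elim conjE)
    fix m :: "real \<Rightarrow> complex" and Z :: "int set" and qZ \<epsilon> :: real and f :: "int \<Rightarrow> complex"
    assume m: "Lp_multiplier (real (Suc q)) m B" "\<forall>x. x \<notin> {-1/2<..1/2} \<longrightarrow> m x = 0"
      and Z: "finite Z" "real_of_int ` Z \<subseteq> {1<..qZ}" and \<epsilon>: "0 < \<epsilon>" "\<epsilon> < 1 / qZ\<^sup>2"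
      and f: "f \<in> ell (real (Suc q))"
    define \<Theta> where "\<Theta> = reduced_fractions Z"
    define s where "s = (\<lambda>n. sqrt (\<Sum>\<theta> \<in> \<Theta>. (cmod (piece (real (Suc q)) m \<epsilon> \<theta> f n))\<^sup>2))"
    have T: "finite \<Theta>" unfolding \<Theta>_def by (rule finite_reduced_fractions[OF Z(1)])
    have b: "\<epsilon> \<le> \<theta> \<and> \<theta> + \<epsilon> \<le> 1" if "\<theta> \<in> \<Theta>" for \<theta>
      using reduced_fractions_bounds[OF Z(2) \<epsilon>(2)] that by (auto simp: \<Theta>_def)
    have sep: "\<theta> + \<epsilon> < \<theta>'" if "\<theta> \<in> \<Theta>" "\<theta>' \<in> \<Theta>" "\<theta> < \<theta>'" for \<theta> \<theta>'
      using reduced_fractions_separated[OF Z(2) \<epsilon>(2)] that by (auto simp: \<Theta>_def)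
    have m0: "m x = 0" if "\<bar>x\<bar> > 1/2" for x
    proof -
      have "x \<notin> {-1/2<..1/2}" using that by (auto simp: abs_if split: if_splits)
      then show ?thesis using m(2) by blast
    qed
    have main: "(\<Sum>n\<in>N. norm (s n) ^ Suc q) \<le> D * ell_mass (Suc q) f" if N: "finite N" for N
    \<comment> \<open>Without fractions \<open>qZ\<close> may be small and \<epsilon> larger than 1;
      otherwise any element of \<Theta> forces \<open>\<epsilon> \<le> 1\<close>.\<close>
    proof (cases "\<Theta> = {}")
      case True
      then show ?thesis using D(1) ell_mass_nonneg[of "Suc q" f] by (simp add: s_def)
    next
      case False
      then obtain \<theta>0 where "\<theta>0 \<in> \<Theta>" by blast
      then have \<epsilon>1: "\<epsilon> \<le> 1" using b[of \<theta>0] \<epsilon>(1) by linarith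
      have bp: "band_piece m \<epsilon> \<theta>" if "\<theta> \<in> \<Theta>" for \<theta>
        using m(1) m0 \<epsilon>(1) b[OF that] by unfold_locales (auto simp: Lp_multiplier_def)
      obtain G where G: "\<And>\<theta>. \<theta> \<in> \<Theta> \<Longrightarrow> density_ext (count_space UNIV) (real (Suc q)) (ell 1) (piece_ell1 m \<epsilon> \<theta>) f (G \<theta>)"
        and Gb: "\<And>N. finite N \<Longrightarrow> (\<Sum>x\<in>N. (\<Sum>\<theta>\<in>\<Theta>. (cmod (G \<theta> x))\<^sup>2) ^ r) \<le> D * ell_mass (Suc q) f"
        using square_function_density_ext[OF T D(1) rq[symmetric] band_piece.piece_diff[OF bp] D(2)[OF m(1) m0 T \<epsilon>(1) \<epsilon>1 b sep] f]
        by blast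
      have "piece (real (Suc q)) m \<epsilon> \<theta> f = G \<theta>" if "\<theta> \<in> \<Theta>" for \<theta>
        by (rule piece_eqI[OF G[OF that] f])
      then have "norm (s n) ^ Suc q = (\<Sum>\<theta>\<in>\<Theta>. (cmod (G \<theta> n))\<^sup>2) ^ r" for n
        by (simp add: s_def rq[symmetric] power_mult sum_nonneg)
      then show ?thesis using Gb[OF N] by simp
    qed
    have "s \<in> ell (real (Suc q))" unfolding ell_iff
      by (rule integral_count_space_le(1)[OF _ main]) simp_all
    moreover have "ell_norm (real (Suc q)) s \<le> D powr (1 / real (Suc q)) * ell_norm (real (Suc q)) f"
    proof -
      have "ell_mass (Suc q) s \<le> D * ell_mass (Suc q) f"
        unfolding ell_mass_def[of _ s] by (rule integral_count_space_le(2)[OF _ main]) simp_all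
      then have "ell_mass (Suc q) s powr (1 / real (Suc q)) \<le> (D * ell_mass (Suc q) f) powr (1 / real (Suc q))"
        by (intro powr_mono2 ell_mass_nonneg) simp_all
      then show ?thesis unfolding ell_norm_mass powr_mult .
    qed
    ultimately show "(\<lambda>n. sqrt (\<Sum>\<theta> \<in> reduced_fractions Z. (cmod (piece (real (Suc q)) m \<epsilon> \<theta> f n))\<^sup>2)) \<in> ell (real (Suc q)) \<and>
       ell_norm (real (Suc q)) (\<lambda>n. sqrt (\<Sum>\<theta> \<in> reduced_fractions Z. (cmod (piece (real (Suc q)) m \<epsilon> \<theta> f n))\<^sup>2))
         \<le> D powr (1 / real (Suc q)) * ell_norm (real (Suc q)) f"
      unfolding s_def \<Theta>_def by blast
  qed
qed

end
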